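(* Let $d\ge2$, let $Q_1,Q_2$ be quadratic forms on $\mathbb{R}^d$ and suppose that the quadratic surface $\Sigma(Q_1,Q_2)$ is well-curved. Let $C>0$ be fixed. Then for every $1\le p,q,r\le\infty$ such that $$2+\frac dr>\frac{d+2}{p},\qquad \frac1r+\frac1q\ge\frac1p,\quad\text{ and }\quad\frac2r\ge\frac1p,$$ there is a constant $K$ (depending on $p,q,r,Q_1,Q_2$ and $C$) such that $$\|\mathcal{T}f\|_{L^q(L^r)}\le K\,\|f\|_{L^p(\mathbb{R}^{d+2})}$$ for every function $f$ supported in $B(0,C)\times[-1,1]^2$.
   Context: $B(0,C)$ is the ball of radius $C$ centred at $0$ in $\mathbb{R}^d$. Convention: $1/\infty=0$. The operator $\mathcal{T}=\mathcal{T}_{Q_1,Q_2}$ acts on functions $f:\mathbb{R}^{d+2}\to\mathbb{C}$ by $$\mathcal{T}f(x,\xi):=\iint_{|s|,|t|\le1}f\big(x-s\nabla Q_1(\xi)-t\nabla Q_2(\xi),s,t\big)\,ds\,dt,\qquad x\in\mathbb{R}^d,\ \xi\in[-1,1]^d.$$ The mixed norm of $F:\mathbb{R}^d\times[-1,1]^d\to\mathbb{C}$ is $$\|F\|_{L^q(L^r)}:=\Big(\int_{[-1,1]^d}\Big(\int_{\mathbb{R}^d}|F(x,\xi)|^r\,dx\Big)^{q/r}d\xi\Big)^{1/q}$$ (with the usual modifications when $q$ or $r$ is $\infty$). Well-curvedness. Let $\phi(\xi)=(\xi,Q_1(\xi),Q_2(\xi))$, $\xi\in[-1,1]^d$, and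 $\Sigma(Q_1,Q_2)=\phi([-1,1]^d)\subset\mathbb{R}^{d+2}$. The density with respect to $d\xi$ of Gressman's affine invariant surface measure $\nu$ on $\Sigma(Q_1,Q_2)$ is $$\frac{d\nu}{d\xi}=\Big[\inf_{M\in SL(\mathbb{R}^d)}\Big(\sum_{i_1,\dots,i_d,\,j_1,j_2,\,k_1,k_2=1}^d\big|\det\big(X_{i_1}\phi,\dots,X_{i_d}\phi,\;X_{j_1}X_{j_2}\phi,\;X_{k_1}X_{k_2}\phi\big)\big|^2\Big)^{1/2}\Big]^{d/(d+4)},$$ where $X_i=\sum_{k=1}^dM_{ik}\partial_k$. For this $\phi$ it is constant in $\xi$; with $A=\nabla^2Q_1$, $B=\nabla^2Q_2$ (constant Hessians), it equals a positive dimensional constant times $$\Big[\inf_{M\in SL(\mathbb{R}^d)}\Big(\sum_{j_1,j_2,k_1,k_2=1}^d\big((MAM^\top)_{j_1j_2}(MBM^\top)_{k_1k_2}-(MAM^\top)_{k_1k_2}(MBM^\top)_{j_1j_2}\big)^2\Big)^{1/2}\Big]^{d/(d+4)}.$$ $\Sigma(Q_1,Q_2)$ is well-curved if this constant is non-zero. *)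

theory Defs
  imports "HOL-Analysis.Analysis" "HOL-Probability.Essential_Supremum"
begin

definition quadratic_form :: "(real^'d \<Rightarrow> real) \<Rightarrow> bool" where
  "quadratic_form Q \<longleftrightarrow> (\<exists>A :: real^'d^'d. transpose A = A \<and> (\<forall>x. Q x = x \<bullet> (A *v x)))"

definition unit_cube :: "(real^'d) set" where
  "unit_cube = {\<xi>. \<forall>k. \<xi> $ k \<in> {-1..1}}"

definition partial_deriv :: "'d \<Rightarrow> (real^'d \<Rightarrow> 'b::real_normed_vector) \<Rightarrow> real^'d \<Rightarrow> 'b" where
  "partial_deriv k f \<xi> = frechet_derivative f (at \<xi>) (axis k 1)"

definition gradient :: "(real^'d \<Rightarrow> real) \<Rightarrow> real^'d \<Rightarrow> real^'d" where
  "gradient f \<xi> = (\<chi> k. partial_deriv k f \<xi>)"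


section \<open>Well-curved quadratic surfaces\<close>

text \<open>The space \<open>\<real>\<^sup>d\<^sup>+\<^sup>2\<close> is represented as \<open>real^'d \<times> real \<times> real\<close>.\<close>

definition surface_param ::
  "(real^'d \<Rightarrow> real) \<Rightarrow> (real^'d \<Rightarrow> real) \<Rightarrow> real^'d \<Rightarrow> (real^'d) \<times> real \<times> real" where
  "surface_param Q1 Q2 \<xi> = (\<xi>, Q1 \<xi>, Q2 \<xi>)"

text \<open>The determinant of \<open>d + 2\<close> vectors \<open>v\<^sub>1, \<dots>, v\<^sub>d, w, w'\<close> of this space, with respect to
  the standard basis. Rows and columns are indexed by the sum type \<open>'d + 2\<close>, where the two
  elements of the numeral type \<open>2\<close> are \<open>1\<close> and \<open>2\<close> (equal to \<open>0\<close>).\<close>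

definition coordinate :: "(real^'d) \<times> real \<times> real \<Rightarrow> 'd + 2 \<Rightarrow> real" where
  "coordinate v c =
     (case c of Inl k \<Rightarrow> fst v $ k | Inr j \<Rightarrow> if j = 1 then fst (snd v) else snd (snd v))"

definition det_vectors ::
  "('d \<Rightarrow> (real^'d) \<times> real \<times> real) \<Rightarrow> (real^'d) \<times> real \<times> real \<Rightarrow> (real^'d) \<times> real \<times> real \<Rightarrow> real" where
  "det_vectors v w w' =
     det (\<chi> (a :: 'd + 2) (c :: 'd + 2).
       coordinate (case a of Inl k \<Rightarrow> v k | Inr j \<Rightarrow> if j = 1 then w else w') c)"

definition frame_deriv ::
  "real^'d^'d \<Rightarrow> 'd \<Rightarrow> (real^'d \<Rightarrow> 'b::real_normed_vector) \<Rightarrow> real^'d \<Rightarrow> 'b" where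
  "frame_deriv M i f = (\<lambda>\<xi>. \<Sum>k\<in>UNIV. M $ i $ k *\<^sub>R partial_deriv k f \<xi>)"

text \<open>The density of Gressman's affine invariant surface measure. The multi-index
  \<open>(i\<^sub>1, \<dots>, i\<^sub>d)\<close> is a function \<open>i :: 'd \<Rightarrow> 'd\<close>.\<close>

definition affine_density ::
  "(real^'d \<Rightarrow> real) \<Rightarrow> (real^'d \<Rightarrow> real) \<Rightarrow> real^'d \<Rightarrow> real" where
  "affine_density Q1 Q2 \<xi> =
     (let \<phi> = surface_param Q1 Q2 in
      (INF M \<in> {M :: real^'d^'d. det M = 1}.
         sqrt (\<Sum>i\<in>(UNIV :: ('d \<Rightarrow> 'd) set). \<Sum>j1\<in>UNIV. \<Sum>j2\<in>UNIV. \<Sum>k1\<in>UNIV. \<Sum>k2\<in>UNIV.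
           \<bar>det_vectors (\<lambda>l. frame_deriv M (i l) \<phi> \<xi>)
              (frame_deriv M j1 (frame_deriv M j2 \<phi>) \<xi>)
              (frame_deriv M k1 (frame_deriv M k2 \<phi>) \<xi>)\<bar>\<^sup>2))
      powr (real CARD('d) / (real CARD('d) + 4)))"

text \<open>For quadratic forms the density does not depend on \<open>\<xi>\<close>.\<close>

definition well_curved :: "(real^'d \<Rightarrow> real) \<Rightarrow> (real^'d \<Rightarrow> real) \<Rightarrow> bool" where
  "well_curved Q1 Q2 \<longleftrightarrow> (\<forall>\<xi>\<in>unit_cube. affine_density Q1 Q2 \<xi> \<noteq> 0)"


section \<open>The operator and the norms\<close>

definition plane_transform ::
  "(real^'d \<Rightarrow> real) \<Rightarrow> (real^'d \<Rightarrow> real) \<Rightarrow> ((real^'d) \<times> real \<times> real \<Rightarrow> complex)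
     \<Rightarrow> real^'d \<Rightarrow> real^'d \<Rightarrow> complex" where
  "plane_transform Q1 Q2 f x \<xi> =
     (LINT (s, t) : {-1..1} \<times> {-1..1} | lebesgue.
        f (x - s *\<^sub>R gradient Q1 \<xi> - t *\<^sub>R gradient Q2 \<xi>, s, t))"

definition ennreal_powr :: "ennreal \<Rightarrow> real \<Rightarrow> ennreal" where
  "ennreal_powr y a = (if y = \<infinity> then \<infinity> else ennreal (enn2real y powr a))"

text \<open>The Lebesgue norm of exponent \<open>p \<in> [1, \<infinity>]\<close> of a nonnegative function; only positive real
  exponents are passed to \<open>ennreal_powr\<close>.\<close>

definition Lp_norm :: "ennreal \<Rightarrow> 'a measure \<Rightarrow> ('a \<Rightarrow> ennreal) \<Rightarrow> ennreal" where
  "Lp_norm p M g =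
     (if p = \<infinity> then esssup M g
      else ennreal_powr (\<integral>\<^sup>+ x. ennreal_powr (g x) (enn2real p) \<partial>M) (1 / enn2real p))"

definition mixed_norm :: "ennreal \<Rightarrow> ennreal \<Rightarrow> (real^'d \<Rightarrow> real^'d \<Rightarrow> complex) \<Rightarrow> ennreal" where
  "mixed_norm q r F =
     Lp_norm q (lebesgue_on unit_cube)
       (\<lambda>\<xi>. Lp_norm r lebesgue (\<lambda>x. ennreal (norm (F x \<xi>))))"

end

theory Submission
  imports Defs
begin

text \<open>
  Write \<open>Q1 \<xi> = \<xi> \<bullet> A \<xi>\<close>, \<open>Q2 \<xi> = \<xi> \<bullet> B \<xi>\<close> and \<open>L (s, t) = 2 (s A + t B)\<close>. The transform integrates \<open>f\<close> over
  the plane of all points \<open>(x - L z \<xi>, z)\<close>. Two points of such a plane, with parameters \<open>z\<close> and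
  \<open>z'\<close>, determine \<open>x\<close> and \<open>\<xi>\<close> with Jacobian \<open>\<bar>det (L (z - z'))\<bar>\<close>, so that everything depends on
  how small this determinant is. The proof has three parts.

  \<^item> Well-curvedness implies that \<open>\<bar>det (s A + t B)\<bar>\<close> to the power \<open>- g\<close> is locally integrable in the
  plane for every \<open>g < 2 / d\<close> (\<open>nn_integral_pencil_det_finite\<close>). Well-curvedness bounds the
  Gram determinant of the pair \<open>(M A M\<^sup>T, M B M\<^sup>T)\<close> from below over all \<open>M\<close> of determinant \<open>1\<close>
  (\<open>well_curved_gram_det\<close>). In the closure of the orbit of \<open>(h A, B + s A)\<close> under such \<open>M\<close> there is a
  pair \<open>(A', B')\<close> of least norm. As in the theory of Kempf and Ness, minimality forces
  \<open>A'\<^sup>2 + B'\<^sup>2 = k I\<close>, with \<open>k\<close> at least of order \<open>h\<close>. A pencil normalised in this way is not singular at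
  \<open>d + 1\<close> distinct points (\<open>normalised_pencil_nonsingular\<close>), and by compactness this holds
  quantitatively. Since the determinants of a pencil are invariant along the orbit, among the
  numbers \<open>\<bar>det (B + (s + \<sigma> h) A)\<bar>\<close>, with \<open>\<sigma>\<close> in a fixed set of \<open>d + 1\<close> reals, one is at least of order
  \<open>h\<^bsup>d/2\<^esup>\<close> (\<open>pencil_det_lower_bound\<close>). Hence every real root of \<open>det (B + s A)\<close>, and likewise of
  \<open>det (A + s B)\<close>, has order at most \<open>d / 2\<close>, and homogeneity gives the integrability.

  \<^item> For \<open>p > (d + 4) / 4\<close> the transform maps \<open>L\<^sup>p\<close> to \<open>L\<^bsup>2p\<^esup>\<close> in \<open>(x, \<xi>)\<close>
  (\<open>plane_integral_bounded_estimate\<close>, \<open>plane_integral_estimate\<close>). For \<open>f \<ge> 0\<close> and \<open>\<Phi>\<close> its transform,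
  the integral \<open>N\<close> of \<open>\<Phi>\<^bsup>2p\<^esup>\<close> is the integral of \<open>f(x - L z \<xi>, z) f(x - L z' \<xi>, z') \<Phi>\<^bsup>2p-2\<^esup>\<close> over \<open>z\<close>, \<open>z'\<close>,
  \<open>x\<close>, \<open>\<xi>\<close>. Hoelder's inequality with suitable weights separates this into three integrals. In the
  first two, one of \<open>z\<close>, \<open>z'\<close> enters only through \<open>\<bar>det (L (z - z'))\<bar>\<close> to the power
  \<open>- 1 / (2 (p - 1))\<close>, whose integral is finite by the first part exactly in this range of \<open>p\<close>. The third
  is a product of two integrals, by the change of variables above. The result is an inequality for
  \<open>N\<close> which can be solved for \<open>N\<close>.

  \<^item> The transform is positive, so Hoelder's inequality applied under the integral sign interpolates
  between this estimate and the trivial bound from \<open>L\<^sup>1\<close> to \<open>L\<^sup>\<infinity>(L\<^sup>1)\<close>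
  (\<open>plane_integral_interpolated\<close>). That covers \<open>p < r \<le> 2 p\<close> with \<open>1/q = 1/p - 1/r\<close>; the condition
  \<open>2 + d/r > (d + 2)/p\<close> says exactly that the exponent of the estimate used exceeds \<open>(d + 4) / 4\<close>. For
  \<open>r = p\<close> and \<open>q = \<infinity>\<close> the trivial bound suffices. As \<open>x\<close> and \<open>\<xi>\<close> range over bounded sets, both \<open>q\<close> and
  \<open>r\<close> may be lowered.
\<close>

section \<open>Pencils of symmetric matrices with scalar sum of squares\<close>

text \<open>Bessel's inequality, and Parseval's identity on the span, for a finite orthonormal set that need
  not be a basis of the whole space.\<close>

lemma bessel_inequality:
  fixes x :: "'a::euclidean_space"
  assumes fin: "finite E" and orth: "pairwise orthogonal E" and one: "\<And>e. e \<in> E \<Longrightarrow> norm e = 1"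
  shows "(\<Sum>e\<in>E. (x \<bullet> e)\<^sup>2) \<le> (norm x)\<^sup>2"
    and "x \<in> span E \<Longrightarrow> (\<Sum>e\<in>E. (x \<bullet> e)\<^sup>2) = (norm x)\<^sup>2"
proof -
  define y where "y = (\<Sum>e\<in>E. (x \<bullet> e) *\<^sub>R e)"
  have ye: "y \<bullet> e = x \<bullet> e" if "e \<in> E" for e
  proof -
    have "y \<bullet> e = (\<Sum>e'\<in>E. (x \<bullet> e') * (e' \<bullet> e))"
      by (simp add: y_def inner_sum_left)
    also have "\<dots> = (\<Sum>e'\<in>E. if e' = e then x \<bullet> e else 0)"
      by (intro sum.cong refl)
         (use orth one that in \<open>auto simp: pairwise_def orthogonal_def norm_eq_1\<close>)
    also have "\<dots> = x \<bullet> e" using fin that by simp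
    finally show ?thesis .
  qed
  have xy: "x \<bullet> y = (\<Sum>e\<in>E. (x \<bullet> e)\<^sup>2)"
    by (simp add: y_def inner_sum_right power2_eq_square)
  have yy: "y \<bullet> y = (\<Sum>e\<in>E. (x \<bullet> e)\<^sup>2)"
  proof -
    have "y \<bullet> y = (\<Sum>e\<in>E. (x \<bullet> e) * (y \<bullet> e))"
      by (subst (2) y_def) (simp add: inner_sum_right)
    also have "\<dots> = (\<Sum>e\<in>E. (x \<bullet> e)\<^sup>2)"
      by (intro sum.cong refl) (simp add: ye power2_eq_square)
    finally show ?thesis .
  qed
  have d: "(norm (x - y))\<^sup>2 = (norm x)\<^sup>2 - (\<Sum>e\<in>E. (x \<bullet> e)\<^sup>2)"
    using xy yy by (simp add: power2_norm_eq_inner inner_diff inner_commute)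
  show "(\<Sum>e\<in>E. (x \<bullet> e)\<^sup>2) \<le> (norm x)\<^sup>2"
    using d zero_le_power2[of "norm (x - y)"] by linarith
  show "(\<Sum>e\<in>E. (x \<bullet> e)\<^sup>2) = (norm x)\<^sup>2" if "x \<in> span E"
  proof -
    have "y \<in> span E" unfolding y_def by (intro span_sum span_scale span_base)
    then have "x - y \<in> span E" using that span_diff by blast
    moreover have "orthogonal (x - y) e" if "e \<in> E" for e
      using ye[OF that] by (simp add: orthogonal_def inner_diff)
    ultimately have "orthogonal (x - y) (x - y)"
      using orthogonal_to_span by blast
    then show ?thesis using d by (simp add: orthogonal_def)
  qed
qed

lemma symmetric_matrix_inner:
  fixes A :: "real^'n^'n"
  assumes "transpose A = A"
  shows "(A *v x) \<bullet> y = x \<bullet> (A *v y)"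
  by (metis assms dot_lmul_matrix inner_commute vector_transpose_matrix)

text \<open>Counting dimensions in a normalised pair: the trace of \<open>A\<^sup>2 + B\<^sup>2\<close> over \<open>W\<close> is \<open>k dim W\<close>, it is
  seen entirely by an orthonormal basis of the target \<open>U\<close>, and by symmetry the same sum is at most
  the trace over \<open>U\<close>.\<close>

lemma normalised_pair_dim_le:
  fixes A B :: "real^'n^'n"
  assumes sym: "transpose A = A" "transpose B = B"
    and norm: "\<And>x. (norm (A *v x))\<^sup>2 + (norm (B *v x))\<^sup>2 = k * (norm x)\<^sup>2" and k: "k > 0"
    and W: "subspace W" and U: "subspace U"
    and maps: "\<And>w. w \<in> W \<Longrightarrow> A *v w \<in> U" "\<And>w. w \<in> W \<Longrightarrow> B *v w \<in> U"
  shows "dim W \<le> dim U"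
proof -
  obtain E where E: "E \<subseteq> W" "pairwise orthogonal E" "\<And>x. x \<in> E \<Longrightarrow> norm x = 1"
      "independent E" "card E = dim W" "span E = W"
    using orthonormal_basis_subspace[OF W] by metis
  obtain F where F: "F \<subseteq> U" "pairwise orthogonal F" "\<And>x. x \<in> F \<Longrightarrow> norm x = 1"
      "independent F" "card F = dim U" "span F = U"
    using orthonormal_basis_subspace[OF U] by metis
  have fE: "finite E" and fF: "finite F" using E F independent_imp_finite by auto
  have half: "(\<Sum>e\<in>E. (norm (X *v e))\<^sup>2) \<le> (\<Sum>f\<in>F. (norm (X *v f))\<^sup>2)"
    if X: "transpose X = X" and m: "\<And>w. w \<in> W \<Longrightarrow> X *v w \<in> U" for X :: "real^'n^'n"
  proof -
    have sw: "(X *v e) \<bullet> f = e \<bullet> (X *v f)" for e f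
      using symmetric_matrix_inner[OF X] .
    have "(\<Sum>e\<in>E. (norm (X *v e))\<^sup>2) = (\<Sum>e\<in>E. \<Sum>f\<in>F. ((X *v e) \<bullet> f)\<^sup>2)"
      using bessel_inequality(2)[OF fF F(2,3)] m E(1) F(6) by (intro sum.cong refl) auto
    also have "\<dots> = (\<Sum>f\<in>F. \<Sum>e\<in>E. (e \<bullet> (X *v f))\<^sup>2)"
      by (subst sum.swap) (simp only: sw)
    also have "\<dots> \<le> (\<Sum>f\<in>F. (norm (X *v f))\<^sup>2)"
      using bessel_inequality(1)[OF fE E(2,3)] by (intro sum_mono) (subst inner_commute, blast)
    finally show ?thesis .
  qed
  have "k * real (dim W) = (\<Sum>e\<in>E. (norm (A *v e))\<^sup>2 + (norm (B *v e))\<^sup>2)"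
    using E(3,5) by (simp add: norm)
  also have "\<dots> \<le> (\<Sum>f\<in>F. (norm (A *v f))\<^sup>2 + (norm (B *v f))\<^sup>2)"
    using half[OF sym(1) maps(1)] half[OF sym(2) maps(2)] by (simp add: sum.distrib)
  also have "\<dots> = k * real (dim U)"
    using F(3,5) by (simp add: norm)
  finally show ?thesis using k by simp
qed

lemma singular_matrix_kernel:
  fixes A :: "real^'n^'n"
  assumes "det A = 0" shows "\<exists>x. x \<noteq> 0 \<and> A *v x = 0"
  using assms det_eq_0_rank[of A] matrix_nonfull_linear_equations_eq[of A] by auto

lemma dependent_family:
  fixes u :: "'i \<Rightarrow> 'a::real_vector"
  assumes R: "finite R" and nind: "\<not> (inj_on u R \<and> independent (u ` R))"
  shows "\<exists>c. (\<exists>s\<in>R. c s \<noteq> 0) \<and> (\<Sum>s\<in>R. c s *\<^sub>R u s) = 0"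
proof (cases "inj_on u R")
  case False
  then obtain a b where ab: "a \<in> R" "b \<in> R" "a \<noteq> b" "u a = u b" by (auto simp: inj_on_def)
  define c :: "'i \<Rightarrow> real" where "c s = (if s = a then 1 else if s = b then -1 else 0)" for s
  have "(\<Sum>s\<in>R. c s *\<^sub>R u s) = (\<Sum>s\<in>{a,b}. c s *\<^sub>R u s)"
    by (rule sum.mono_neutral_right) (use R ab in \<open>auto simp: c_def\<close>)
  also have "\<dots> = 0" using ab by (simp add: c_def)
  finally show ?thesis using ab(1) by (intro exI[of _ c]) (auto simp: c_def)
next
  case True
  then have "dependent (u ` R)" using nind by simp
  then obtain c where c: "\<exists>v\<in>u ` R. c v \<noteq> 0" "(\<Sum>v\<in>u ` R. c v *\<^sub>R v) = 0"
    using dependent_finite[of "u ` R"] R by auto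
  have "(\<Sum>s\<in>R. c (u s) *\<^sub>R u s) = 0" using c(2) by (simp add: sum.reindex[OF True])
  with c(1) show ?thesis by (intro exI[of _ "c \<circ> u"]) auto
qed

text \<open>If the pencil were singular at \<open>d + 1\<close> points \<open>s\<close>, the kernel vectors \<open>u s\<close> would be linearly
  dependent. In a minimal dependent subfamily of \<open>n\<close> vectors, \<open>B u s = - s A u s\<close> turns the one
  relation between the \<open>u s\<close> into two relations between the \<open>A u s\<close>: the pencil maps a space of
  dimension \<open>n - 1\<close> into one of dimension \<open>n - 2\<close>.\<close>

lemma normalised_pencil_nonsingular:
  fixes A B :: "real^'n^'n"
  assumes sym: "transpose A = A" "transpose B = B"
    and norm: "\<And>x. (norm (A *v x))\<^sup>2 + (norm (B *v x))\<^sup>2 = k * (norm x)\<^sup>2" and k: "k > 0"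
    and T: "finite T" "card T > CARD('n)"
  shows "\<exists>s\<in>T. det (B + s *\<^sub>R A) \<noteq> 0"
proof (rule ccontr)
  assume "\<not> ?thesis"
  then have "\<forall>s\<in>T. \<exists>x. x \<noteq> 0 \<and> (B + s *\<^sub>R A) *v x = 0"
    using singular_matrix_kernel by blast
  then obtain u where u0: "\<And>s. s \<in> T \<Longrightarrow> u s \<noteq> 0"
      and u1: "\<And>s. s \<in> T \<Longrightarrow> (B + s *\<^sub>R A) *v u s = 0"
    by metis
  have Bu: "B *v u s = - (s *\<^sub>R (A *v u s))" if "s \<in> T" for s
    using u1[OF that] by (simp add: matrix_vector_mult_add_rdistrib scaleR_matrix_vector_assoc eq_neg_iff_add_eq_0)
  define dep where "dep R \<longleftrightarrow> (\<exists>c. (\<exists>s\<in>R. c s \<noteq> 0) \<and> (\<Sum>s\<in>R. c s *\<^sub>R u s) = 0)" for R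
  have "dep T"
  proof -
    have "\<not> (inj_on u T \<and> independent (u ` T))"
      using T dependent_biggerset[of "u ` T"] by (auto simp: card_image)
    then show ?thesis using dependent_family[OF T(1), of u] by (simp add: dep_def)
  qed
  then have "\<exists>R. R \<subseteq> T \<and> dep R" by blast
  then obtain R where R: "R \<subseteq> T" "dep R" and Rmin: "\<And>R'. R' \<subseteq> T \<Longrightarrow> dep R' \<Longrightarrow> card R \<le> card R'"
    using exists_least_lemma ex_has_least_nat[of "\<lambda>R. R \<subseteq> T \<and> dep R" _ card] by metis
  have finR: "finite R" using R T finite_subset by blast
  \<comment> \<open>In a minimal dependent subfamily all coefficients are nonzero and proper subfamilies are independent.\<close>
  obtain c where c: "\<exists>s\<in>R. c s \<noteq> 0" "(\<Sum>s\<in>R. c s *\<^sub>R u s) = 0" using R(2) dep_def by auto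
  have nodep: "\<not> dep R'" if "R' \<subset> R" for R'
    using Rmin[of R'] that psubset_card_mono[OF finR that] R(1) by auto
  have cnz: "c s \<noteq> 0" if s: "s \<in> R" for s
  proof
    assume "c s = 0"
    have "(\<Sum>r\<in>R - {s}. c r *\<^sub>R u r) = 0"
      using c(2) sum.remove[OF finR s, of "\<lambda>s. c s *\<^sub>R u s"] \<open>c s = 0\<close> by simp
    moreover have "\<exists>r\<in>R - {s}. c r \<noteq> 0" using c(1) \<open>c s = 0\<close> by auto
    ultimately have "dep (R - {s})" unfolding dep_def by blast
    then show False using nodep[of "R - {s}"] s by blast
  qed
  obtain t where t: "t \<in> R" using c(1) by blast
  have "R \<noteq> {t}"
  proof
    assume "R = {t}" then have "c t *\<^sub>R u t = 0" using c(2) by simp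
    then show False using cnz[OF t] u0[of t] t R(1) by auto
  qed
  then obtain t' where t': "t' \<in> R" "t' \<noteq> t" using t by blast
  have "\<not> dep (R - {t})" using nodep[of "R - {t}"] t by blast
  then have ind: "independent (u ` (R - {t}))" and inj: "inj_on u (R - {t})"
    using dependent_family[of "R - {t}" u] finR by (auto simp: dep_def)
  define W where "W = span (u ` (R - {t}))"
  define U where "U = span ((\<lambda>s. A *v u s) ` (R - {t, t'}))"
  have dW: "dim W = card R - 1"
    using ind inj t finR unfolding W_def by (simp add: dim_eq_card_independent card_image)
  have "dim U \<le> card ((\<lambda>s. A *v u s) ` (R - {t, t'}))"
    unfolding U_def dim_span by (rule dim_le_card') (use finR in auto)
  also have "\<dots> \<le> card (R - {t, t'})" by (rule card_image_le) (use finR in auto)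
  also have "\<dots> = card R - 2" using t t' finR by (simp add: card_Diff_subset)
  finally have dU: "dim U \<le> card R - 2" .
  have card2: "card R \<ge> 2"
    using card_mono[OF finR, of "{t,t'}"] t t' by simp
  have R0: "(\<Sum>s\<in>R. c s *\<^sub>R (A *v u s)) = 0"
  proof -
    have "A *v (\<Sum>s\<in>R. c s *\<^sub>R u s) = (\<Sum>s\<in>R. c s *\<^sub>R (A *v u s))"
      by (simp add: linear_sum[OF matrix_vector_mul_linear] matrix_vector_mult_scaleR)
    then show ?thesis using c(2) by simp
  qed
  have R1: "(\<Sum>s\<in>R. (c s * s) *\<^sub>R (A *v u s)) = 0"
  proof -
    have "B *v (\<Sum>s\<in>R. c s *\<^sub>R u s) = (\<Sum>s\<in>R. c s *\<^sub>R (B *v u s))"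
      by (simp add: linear_sum[OF matrix_vector_mul_linear] matrix_vector_mult_scaleR)
    also have "\<dots> = (\<Sum>s\<in>R. - ((c s * s) *\<^sub>R (A *v u s)))"
      by (intro sum.cong refl) (use Bu R(1) in auto)
    finally show ?thesis using c(2) by (simp add: sum_negf)
  qed
  have base: "A *v u s \<in> U" if "s \<in> R - {t, t'}" for s
    unfolding U_def using that by (intro span_base) auto
  have tt: "A *v u r \<in> U" if r: "r = t \<and> q = t' \<or> r = t' \<and> q = t" for r q
  proof -
    have rq: "r \<in> R" "q \<in> R" "r \<noteq> q" "R - {r} = insert q (R - {t,t'})" using r t t' by auto
    \<comment> \<open>The combination of the two relations in which \<open>A u q\<close> drops out; it expresses \<open>A u r\<close> by the
      vectors that span \<open>U\<close>.\<close>
    have "(\<Sum>s\<in>R. (c s * (s - q)) *\<^sub>R (A *v u s)) = 0"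
    proof -
      have "(\<Sum>s\<in>R. (c s * (s - q)) *\<^sub>R (A *v u s))
          = (\<Sum>s\<in>R. (c s * s) *\<^sub>R (A *v u s)) - q *\<^sub>R (\<Sum>s\<in>R. c s *\<^sub>R (A *v u s))"
        by (simp add: scaleR_sum_right sum_subtractf[symmetric] algebra_simps)
      then show ?thesis using R0 R1 by simp
    qed
    then have "(c r * (r - q)) *\<^sub>R (A *v u r) + (\<Sum>s\<in>R - {r}. (c s * (s - q)) *\<^sub>R (A *v u s)) = 0"
      using sum.remove[OF finR rq(1), of "\<lambda>s. (c s * (s - q)) *\<^sub>R (A *v u s)"] by simp
    moreover have "(\<Sum>s\<in>R - {r}. (c s * (s - q)) *\<^sub>R (A *v u s)) \<in> U"
    proof -
      have "(c s * (s - q)) *\<^sub>R (A *v u s) \<in> U" if "s \<in> R - {r}" for s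
      proof (cases "s = q")
        case True then show ?thesis by (simp add: U_def span_zero)
      next
        case False
        then have "A *v u s \<in> U" using that rq(4) base by blast
        then show ?thesis unfolding U_def by (rule span_scale)
      qed
      then show ?thesis unfolding U_def by (intro span_sum) auto
    qed
    ultimately have "(c r * (r - q)) *\<^sub>R (A *v u r) \<in> U"
      using span_neg[of "\<Sum>s\<in>R - {r}. (c s * (s - q)) *\<^sub>R (A *v u s)"]
      unfolding U_def by (simp only: eq_neg_iff_add_eq_0[symmetric])
    moreover have nz: "c r * (r - q) \<noteq> 0" using cnz[OF rq(1)] rq(3) by simp
    moreover have "x \<in> U" if "z *\<^sub>R x \<in> U" "z \<noteq> 0" for z x
      using span_scale[of "z *\<^sub>R x" _ "inverse z"] that unfolding U_def by simp
    ultimately show ?thesis by blast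
  qed
  have AU: "A *v u s \<in> U" if "s \<in> R" for s
    using base tt that by blast
  have BU: "B *v u s \<in> U" if "s \<in> R" for s
    using AU[OF that] Bu[OF subsetD[OF R(1) that]] unfolding U_def
    by (simp add: span_neg span_scale)
  have map: "X *v w \<in> U" if "w \<in> W" "\<And>s. s \<in> R \<Longrightarrow> X *v u s \<in> U" for X w
    using that(1) unfolding W_def
  proof (induction rule: span_induct_alt)
    case base then show ?case by (simp add: U_def span_zero)
  next
    case (step a x y)
    then have "X *v x \<in> U" using that(2) by auto
    with step show ?case unfolding U_def
      by (auto simp: matrix_vector_right_distrib matrix_vector_mult_scaleR intro: span_add span_scale)
  qed
  have "dim W \<le> dim U"
    by (rule normalised_pair_dim_le[OF sym norm k])
       (use map AU BU in \<open>auto simp: W_def U_def\<close>)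
  then show False using dW dU card2 by linarith
qed

section \<open>Minimal vectors in the orbit of a pencil\<close>

definition congr_matrix :: "real^'n^'n \<Rightarrow> real^'n^'n \<Rightarrow> real^'n^'n" where
  "congr_matrix M A = M ** A ** transpose M"

lemma matrix_add_rdistrib: "(A + B) ** C = A ** C + B ** (C :: real^'k^'n)"
  by (simp add: matrix_matrix_mult_def vec_eq_iff sum.distrib algebra_simps)

lemma matrix_sub_distrib:
  "(A - B) ** C = A ** C - B ** (C :: real^'k^'n)"
  "D ** (A - B) = D ** A - D ** (B :: real^'n^'m)"
  by (simp_all add: matrix_matrix_mult_def vec_eq_iff sum_subtractf algebra_simps)

lemma congr_matrix_mult: "congr_matrix M (congr_matrix N A) = congr_matrix (M ** N) A"
  by (simp add: congr_matrix_def matrix_transpose_mul matrix_mul_assoc)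

lemma congr_matrix_linear:
  "congr_matrix M (s *\<^sub>R A + t *\<^sub>R B) = s *\<^sub>R congr_matrix M A + t *\<^sub>R congr_matrix M B"
  by (simp add: congr_matrix_def matrix_add_ldistrib matrix_add_rdistrib matrix_scalar_ac
      scalar_matrix_assoc)

lemma det_congr_matrix_pencil:
  "det (s *\<^sub>R congr_matrix M A + t *\<^sub>R congr_matrix M B) = (det M)\<^sup>2 * det (s *\<^sub>R A + t *\<^sub>R B)"
  by (simp only: congr_matrix_linear[symmetric]) (simp add: congr_matrix_def det_mul power2_eq_square)

lemma transpose_congr_matrix: "transpose A = A \<Longrightarrow> transpose (congr_matrix M A) = congr_matrix M A"
  by (simp add: congr_matrix_def matrix_transpose_mul matrix_mul_assoc)

lemma congr_matrix_mat_1 [simp]: "congr_matrix (mat 1) A = A"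
  by (simp add: congr_matrix_def)

lemma continuous_on_matrix_mult [continuous_intros]:
  fixes f :: "'a::topological_space \<Rightarrow> real^'n^'m" and g :: "'a \<Rightarrow> real^'k^'n"
  assumes "continuous_on S f" "continuous_on S g"
  shows "continuous_on S (\<lambda>x. f x ** g x)"
  unfolding matrix_matrix_mult_def using assms by (intro continuous_intros) 

lemma continuous_on_det [continuous_intros]:
  fixes f :: "'a::topological_space \<Rightarrow> real^'n^'n"
  assumes "continuous_on S f" shows "continuous_on S (\<lambda>x. det (f x))"
  unfolding det_def using assms by (intro continuous_intros) 

lemma continuous_on_transpose [continuous_intros]:
  fixes f :: "'a::topological_space \<Rightarrow> real^'n^'m"
  assumes "continuous_on S f" shows "continuous_on S (\<lambda>x. transpose (f x))"
  unfolding transpose_def using assms by (intro continuous_intros) 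

lemma continuous_on_congr_matrix [continuous_intros]:
  assumes "continuous_on S f" shows "continuous_on S (\<lambda>x. congr_matrix M (f x))"
  unfolding congr_matrix_def using assms by (intro continuous_intros)

text \<open>First order condition for a minimum at \<open>0\<close> of a polynomial of the shape that
  \<open>norm (M A M\<^sup>T)\<^sup>2\<close> takes along a line of matrices \<open>M\<close>.\<close>

lemma quartic_min_linear_coeff_0:
  fixes b c d e :: real
  assumes "\<And>t. 0 \<le> b * t + c * t^2 + d * t^3 + e * t^4"
  shows "b = 0"
proof -
  define f where "f t = b * t + c * t^2 + d * t^3 + e * t^4" for t
  have "(f has_real_derivative b) (at 0)"
    unfolding f_def by (auto intro!: derivative_eq_intros)
  then show ?thesis
    by (rule DERIV_local_min[of _ _ _ 1]) (use assms in \<open>auto simp: f_def\<close>)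
qed

text \<open>The matrix \<open>u v\<^sup>T\<close>.\<close>

definition rank_one :: "real^'n \<Rightarrow> real^'n \<Rightarrow> real^'n^'n" where
  "rank_one u v = (\<chi> i j. u $ i * v $ j)"

lemma inner_rank_one_mult:
  fixes A :: "real^'n^'n"
  assumes "transpose A = A"
  shows "A \<bullet> (rank_one u v ** A) = (A *v u) \<bullet> (A *v v)"
    and "A \<bullet> (A ** transpose (rank_one u v)) = (A *v u) \<bullet> (A *v v)"
proof -
  have a: "A $ i $ j = A $ j $ i" for i j using assms by (metis transpose_def vec_lambda_beta)
  have "A \<bullet> (rank_one u v ** A) = (\<Sum>i\<in>UNIV. \<Sum>j\<in>UNIV. \<Sum>k\<in>UNIV. A $ i $ j * (u $ i * v $ k * A $ k $ j))"
    by (simp add: inner_vec_def matrix_matrix_mult_def rank_one_def sum_distrib_left)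
  also have "\<dots> = (\<Sum>j\<in>UNIV. \<Sum>i\<in>UNIV. \<Sum>k\<in>UNIV. A $ i $ j * (u $ i * v $ k * A $ k $ j))"
    by (rule sum.swap)
  also have "\<dots> = (\<Sum>j\<in>UNIV. (\<Sum>i\<in>UNIV. A $ i $ j * u $ i) * (\<Sum>k\<in>UNIV. A $ k $ j * v $ k))"
    by (simp add: sum_product ac_simps)
  also have "\<dots> = (A *v u) \<bullet> (A *v v)"
    by (simp add: inner_vec_def matrix_vector_mult_def a)
  finally show 1: "A \<bullet> (rank_one u v ** A) = (A *v u) \<bullet> (A *v v)" .
  have "A \<bullet> (A ** transpose (rank_one u v)) = transpose A \<bullet> transpose (A ** transpose (rank_one u v))"
    by (simp add: inner_vec_def transpose_def) (rule sum.swap)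
  also have "\<dots> = A \<bullet> (rank_one u v ** A)" by (simp add: matrix_transpose_mul assms)
  finally show "A \<bullet> (A ** transpose (rank_one u v)) = (A *v u) \<bullet> (A *v v)" using 1 by simp
qed

text \<open>The first variation of the squared norm in the direction \<open>u v\<^sup>T\<close> is four times the inner product on the
  left, so minimality makes it vanish whenever \<open>I + \<tau> u v\<^sup>T\<close> stays in the group.\<close>

lemma minimal_pair_orthogonal:
  fixes A B :: "real^'n^'n"
  assumes sym: "transpose A = A" "transpose B = B"
    and min: "\<And>M. det M = 1 \<Longrightarrow>
      (norm A)\<^sup>2 + (norm B)\<^sup>2 \<le> (norm (congr_matrix M A))\<^sup>2 + (norm (congr_matrix M B))\<^sup>2"
    and det: "\<And>\<tau>. det (mat 1 + \<tau> *\<^sub>R rank_one u v) = 1"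
  shows "(A *v u) \<bullet> (A *v v) + (B *v u) \<bullet> (B *v v) = 0"
proof -
  let ?E = "rank_one u v"
  define lin where "lin X = ?E ** X + X ** transpose ?E" for X
  define quad where "quad X = ?E ** X ** transpose ?E" for X
  have expand: "congr_matrix (mat 1 + \<tau> *\<^sub>R ?E) X = X + \<tau> *\<^sub>R lin X + (\<tau>\<^sup>2) *\<^sub>R quad X" for \<tau> X
  proof -
    have "transpose (mat 1 + \<tau> *\<^sub>R ?E) = mat 1 + \<tau> *\<^sub>R transpose ?E"
      by (auto simp add: transpose_def mat_def vec_eq_iff)
    then show ?thesis
      by (simp add: congr_matrix_def lin_def quad_def matrix_add_ldistrib matrix_add_rdistrib
          matrix_scalar_ac scalar_matrix_assoc[symmetric] power2_eq_square algebra_simps)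
  qed
  have sq: "(norm (congr_matrix (mat 1 + \<tau> *\<^sub>R ?E) X))\<^sup>2 = (norm X)\<^sup>2 + (2 * (X \<bullet> lin X)) * \<tau>
      + (lin X \<bullet> lin X + 2 * (X \<bullet> quad X)) * \<tau>^2 + (2 * (lin X \<bullet> quad X)) * \<tau>^3
      + (quad X \<bullet> quad X) * \<tau>^4" for \<tau> X
    unfolding expand power2_norm_eq_inner
    by (simp add: inner_add_left inner_add_right inner_commute algebra_simps power2_eq_square
        power3_eq_cube power4_eq_xxxx)
  have "0 \<le> (2 * (A \<bullet> lin A) + 2 * (B \<bullet> lin B)) * \<tau>
     + (lin A \<bullet> lin A + 2 * (A \<bullet> quad A) + (lin B \<bullet> lin B + 2 * (B \<bullet> quad B))) * \<tau>^2
     + (2 * (lin A \<bullet> quad A) + 2 * (lin B \<bullet> quad B)) * \<tau>^3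
     + (quad A \<bullet> quad A + quad B \<bullet> quad B) * \<tau>^4" for \<tau>
    using min[OF det[of \<tau>]] unfolding sq by (simp add: algebra_simps)
  then have "2 * (A \<bullet> lin A) + 2 * (B \<bullet> lin B) = 0"
    by (rule quartic_min_linear_coeff_0)
  then show ?thesis
    by (simp add: lin_def inner_add_right inner_rank_one_mult[OF sym(1)] inner_rank_one_mult[OF sym(2)])
qed

lemma det_shear_axis:
  assumes "i \<noteq> j" shows "det (mat 1 + \<tau> *\<^sub>R rank_one (axis i 1) (axis j 1) :: real^'n^'n) = 1"
proof -
  have "mat 1 + \<tau> *\<^sub>R rank_one (axis i 1) (axis j 1) =
     ((\<chi> k. if k = i then row i (mat 1) + \<tau> *s row j (mat 1) else row k (mat 1)) :: real^'n^'n)"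
    using assms by (auto simp: vec_eq_iff rank_one_def row_def mat_def axis_def)
  then show ?thesis using det_row_operation[OF assms, of "mat 1 :: real^'n^'n"] by simp
qed

text \<open>Together with \<open>det_shear_axis\<close> this gives enough directions to see that \<open>A\<^sup>2 + B\<^sup>2\<close> is scalar: the
  shears along two axes kill its off-diagonal entries, and those along \<open>e\<^sub>i + e\<^sub>j\<close>, which are conjugate
  to them, make the diagonal entries equal.\<close>

lemma det_shear_diagonal:
  assumes "i \<noteq> j"
  shows "det (mat 1 + \<tau> *\<^sub>R rank_one (axis i 1 + axis j 1) (axis i 1 - axis j 1) :: real^'n^'n) = 1"
proof -
  define S where "S c = (mat 1 + c *\<^sub>R rank_one (axis j 1) (axis i 1) :: real^'n^'n)" for c
  have ro: "rank_one u v ** rank_one u' v' = (v \<bullet> u') *\<^sub>R rank_one u v'" for u v u' v' :: "real^'n"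
    by (simp add: rank_one_def matrix_matrix_mult_def vec_eq_iff inner_vec_def sum_distrib_left
        sum_distrib_right ac_simps)
  have lin: "rank_one (u + u') v = rank_one u v + rank_one u' v"
      "rank_one u (v - w) = rank_one u v - rank_one u w" for u u' v w :: "real^'n"
    by (simp_all add: rank_one_def vec_eq_iff algebra_simps)
  have ax: "axis i 1 \<bullet> (axis i 1 :: real^'n) = 1" "axis j 1 \<bullet> (axis j 1 :: real^'n) = 1"
      "axis i 1 \<bullet> (axis j 1 :: real^'n) = 0" "axis j 1 \<bullet> (axis i 1 :: real^'n) = 0"
    using assms by (simp_all add: inner_axis_axis)
  have "mat 1 + \<tau> *\<^sub>R rank_one (axis i 1 + axis j 1) (axis i 1 - axis j 1) =
      S 1 ** (mat 1 + (- \<tau>) *\<^sub>R rank_one (axis i 1) (axis j 1)) ** S (-1)"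
    unfolding S_def
    by (simp add: matrix_add_ldistrib matrix_add_rdistrib matrix_scalar_ac
        scalar_matrix_assoc[symmetric] matrix_sub_distrib ro lin ax algebra_simps)
  moreover have "det (S c) = 1" for c unfolding S_def using assms by (intro det_shear_axis) auto
  ultimately show ?thesis using det_shear_axis[OF assms, of "- \<tau>"] by (simp add: det_mul)
qed

lemma norm_matrix_sq_columns:
  fixes A :: "real^'n^'n"
  shows "(norm A)\<^sup>2 = (\<Sum>i\<in>UNIV. (norm (A *v axis i 1))\<^sup>2)"
proof -
  have "(norm A)\<^sup>2 = (\<Sum>i\<in>UNIV. \<Sum>j\<in>UNIV. A $ i $ j * A $ i $ j)"
    by (simp add: power2_norm_eq_inner inner_vec_def)
  also have "\<dots> = (\<Sum>i\<in>UNIV. (norm (A *v axis i 1))\<^sup>2)"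
    by (subst sum.swap) (simp add: power2_norm_eq_inner inner_vec_def matrix_vector_mult_basis column_def)
  finally show ?thesis .
qed

lemma det_scaleR:
  fixes A :: "real^'n^'n" shows "det (r *\<^sub>R A) = r ^ CARD('n) * det A"
proof -
  have "r *\<^sub>R A = mat r ** A"
    by (simp add: matrix_matrix_mult_def mat_def vec_eq_iff if_distrib[where f = "\<lambda>x. x * _"] cong: if_cong)
  then show ?thesis by (simp add: det_mul det_diagonal mat_def)
qed

text \<open>The orbit need not be closed, but its closure is invariant under the group and contains a point
  closest to the origin. Symmetry, the determinants of the pencil and lower bounds for the norm pass
  to the closure; the orthogonality relations of \<open>minimal_pair_orthogonal\<close> turn into the statement
  that \<open>A'\<^sup>2 + B'\<^sup>2\<close> is \<open>k\<close> times the identity.\<close>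

lemma minimal_congruent_pair:
  fixes A B :: "real^'n^'n"
  assumes sym: "transpose A = A" "transpose B = B"
    and ge: "\<And>M. det M = 1 \<Longrightarrow> c \<le> (norm (congr_matrix M A))\<^sup>2 + (norm (congr_matrix M B))\<^sup>2"
  obtains A' B' :: "real^'n^'n" and k where "transpose A' = A'" "transpose B' = B'"
    and "\<And>x. (norm (A' *v x))\<^sup>2 + (norm (B' *v x))\<^sup>2 = k * (norm x)\<^sup>2"
    and "\<And>s t. det (s *\<^sub>R A' + t *\<^sub>R B') = det (s *\<^sub>R A + t *\<^sub>R B)"
    and "c \<le> k * real CARD('n)"
proof -
  define Orb where "Orb = (\<lambda>M. (congr_matrix M A, congr_matrix M B)) ` {M. det M = 1}"
  have "(congr_matrix (mat 1) A, congr_matrix (mat 1) B) \<in> Orb" unfolding Orb_def by (intro imageI) simp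
  then have "closure Orb \<noteq> {}" using closure_subset by blast
  then obtain z where z: "z \<in> closure Orb" "\<And>y. y \<in> closure Orb \<Longrightarrow> dist 0 z \<le> dist 0 y"
    using distance_attains_inf[OF closed_closure] by metis
  obtain A' B' where AB: "z = (A', B')" by (cases z)
  have nrm: "(norm (X, Y))\<^sup>2 = (norm X)\<^sup>2 + (norm Y)\<^sup>2" for X Y :: "real^'n^'n"
    by (simp add: norm_Pair)
  \<comment> \<open>Closed conditions that hold on the orbit hold at \<open>z\<close>.\<close>
  have closedI: "z \<in> F" if "closed F" "Orb \<subseteq> F" for F
    using z(1) closure_minimal[OF that(2,1)] by blast
  have sA: "transpose A' = A'" 
  proof -
    have "z \<in> {w. transpose (fst w) = fst w}"
      by (rule closedI) (auto intro!: closed_Collect_eq continuous_intros simp: Orb_def transpose_congr_matrix sym)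
    then show ?thesis by (simp add: AB)
  qed
  have sB: "transpose B' = B'" 
  proof -
    have "z \<in> {w. transpose (snd w) = snd w}"
      by (rule closedI) (auto intro!: closed_Collect_eq continuous_intros simp: Orb_def transpose_congr_matrix sym)
    then show ?thesis by (simp add: AB)
  qed
  have dt: "det (s *\<^sub>R A' + t *\<^sub>R B') = det (s *\<^sub>R A + t *\<^sub>R B)" for s t
  proof -
    have "z \<in> {w. det (s *\<^sub>R fst w + t *\<^sub>R snd w) = det (s *\<^sub>R A + t *\<^sub>R B)}"
      by (rule closedI) (auto intro!: closed_Collect_eq continuous_intros simp: Orb_def det_congr_matrix_pencil)
    then show ?thesis by (simp add: AB)
  qed
  have cc: "c \<le> (norm A')\<^sup>2 + (norm B')\<^sup>2"
  proof -
    have "z \<in> {w. c \<le> (norm w)\<^sup>2}"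
      by (rule closedI) (auto intro!: closed_Collect_le continuous_intros simp: Orb_def nrm ge)
    then show ?thesis by (simp add: AB nrm)
  qed
  have min: "(norm A')\<^sup>2 + (norm B')\<^sup>2 \<le> (norm (congr_matrix M A'))\<^sup>2 + (norm (congr_matrix M B'))\<^sup>2"
    if M: "det M = 1" for M
  proof -
    have "z \<in> {w. norm z \<le> norm (congr_matrix M (fst w), congr_matrix M (snd w))}"
    proof (rule closedI)
      show "Orb \<subseteq> {w. norm z \<le> norm (congr_matrix M (fst w), congr_matrix M (snd w))}"
      proof
        fix w assume "w \<in> Orb"
        then obtain N where N: "det N = 1" "w = (congr_matrix N A, congr_matrix N B)" by (auto simp: Orb_def)
        have "(congr_matrix M (fst w), congr_matrix M (snd w)) \<in> Orb"
          unfolding Orb_def using N M by (auto simp: congr_matrix_mult det_mul intro!: image_eqI[of _ _ "M ** N"])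
        then show "w \<in> {w. norm z \<le> norm (congr_matrix M (fst w), congr_matrix M (snd w))}"
          using z(2) closure_subset by fastforce
      qed
    qed (intro closed_Collect_le continuous_intros)
    then have "(norm z)\<^sup>2 \<le> (norm (congr_matrix M A', congr_matrix M B'))\<^sup>2" by (simp add: AB)
    then show ?thesis by (simp add: AB nrm)
  qed
  define q where "q u v = (A' *v u) \<bullet> (A' *v v) + (B' *v u) \<bullet> (B' *v v)" for u v
  have orth: "q u v = 0" if "\<And>\<tau>. det (mat 1 + \<tau> *\<^sub>R rank_one u v) = 1" for u v
    unfolding q_def by (rule minimal_pair_orthogonal[OF sA sB min that])
  have q0: "q (axis i 1) (axis j 1) = 0" if "i \<noteq> j" for i j
    using det_shear_axis[OF that] by (intro orth)
  have qe: "q (axis i 1) (axis i 1) = q (axis j 1) (axis j 1)" for i j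
  proof (cases "i = j")
    case False
    have "q (axis i 1 + axis j 1) (axis i 1 - axis j 1) = 0"
      using det_shear_diagonal[OF False] by (intro orth)
    then show ?thesis
      by (simp add: q_def matrix_vector_right_distrib matrix_vector_mult_diff_distrib inner_add_left
          inner_add_right inner_diff_left inner_diff_right inner_commute)
  qed auto
  define k where "k = q (axis undefined 1) (axis undefined 1)"
  have qx: "(norm (A' *v x))\<^sup>2 + (norm (B' *v x))\<^sup>2 = k * (norm x)\<^sup>2" for x
  proof -
    have x: "x = (\<Sum>i\<in>UNIV. x $ i *\<^sub>R axis i 1)"
      by (metis basis_expansion scalar_mult_eq_scaleR)
    have Xx: "X *v x = (\<Sum>i\<in>UNIV. x $ i *\<^sub>R (X *v axis i 1))" for X :: "real^'n^'n"
      by (subst x) (simp add: linear_sum[OF matrix_vector_mul_linear] matrix_vector_mult_scaleR)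
    have "(norm (A' *v x))\<^sup>2 + (norm (B' *v x))\<^sup>2
        = (\<Sum>i\<in>UNIV. \<Sum>j\<in>UNIV. x $ i * (x $ j * q (axis i 1) (axis j 1)))"
      unfolding power2_norm_eq_inner Xx
      by (simp add: inner_sum_left inner_sum_right q_def sum.distrib[symmetric] sum_distrib_left algebra_simps)
         (simp add: inner_commute)
    also have "\<dots> = (\<Sum>i\<in>UNIV. \<Sum>j\<in>UNIV. if i = j then x $ i * (x $ i * k) else 0)"
      using q0 qe by (intro sum.cong refl) (auto simp: k_def)
    also have "\<dots> = k * (norm x)\<^sup>2"
      by (simp add: power2_norm_eq_inner inner_vec_def sum_distrib_left algebra_simps)
    finally show ?thesis .
  qed
  have "(norm A')\<^sup>2 + (norm B')\<^sup>2 = (\<Sum>i\<in>(UNIV::'n set). k)"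
    unfolding norm_matrix_sq_columns sum.distrib[symmetric] qx by simp
  then have "c \<le> k * real CARD('n)" using cc by (simp add: mult.commute)
  with sA sB qx dt show ?thesis by (rule that)
qed

text \<open>The normalised pairs form a compact set, on which the sum is continuous and, by
  \<open>normalised_pencil_nonsingular\<close>, has no zero.\<close>

lemma normalised_pencil_det_lower_bound:
  assumes T: "finite T" "card T > CARD('n)"
  obtains c where "c > 0"
    and "\<And>A B :: real^'n^'n. transpose A = A \<Longrightarrow> transpose B = B
      \<Longrightarrow> (\<And>x. (norm (A *v x))\<^sup>2 + (norm (B *v x))\<^sup>2 = (norm x)\<^sup>2)
      \<Longrightarrow> c \<le> (\<Sum>s\<in>T. \<bar>det (B + s *\<^sub>R A)\<bar>)"
proof -
  define K where "K = {w :: (real^'n^'n) \<times> (real^'n^'n). transpose (fst w) = fst w \<and> transpose (snd w) = snd w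
    \<and> (\<forall>x. (norm (fst w *v x))\<^sup>2 + (norm (snd w *v x))\<^sup>2 = (norm x)\<^sup>2)}"
  have cm: "continuous_on UNIV (\<lambda>w. f w *v x)" if "continuous_on UNIV f"
    for f :: "(real^'n^'n) \<times> (real^'n^'n) \<Rightarrow> real^'n^'n" and x
    unfolding matrix_vector_mult_def using that by (intro continuous_intros)
  have "closed K"
    unfolding K_def
    by (intro closed_Collect_conj closed_Collect_all closed_Collect_eq continuous_intros cm)
  moreover have "bounded K"
  proof -
    have "norm w \<le> sqrt CARD('n)" if "w \<in> K" for w
    proof -
      have "(norm w)\<^sup>2 = (norm (fst w))\<^sup>2 + (norm (snd w))\<^sup>2" by (cases w) (simp add: norm_Pair)
      also have "\<dots> = (\<Sum>i\<in>(UNIV::'n set). 1)"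
        unfolding norm_matrix_sq_columns sum.distrib[symmetric] using that by (simp add: K_def)
      finally show ?thesis by (intro real_le_rsqrt) simp
    qed
    then show ?thesis unfolding bounded_iff by blast
  qed
  ultimately have cK: "compact K" by (simp add: compact_eq_bounded_closed)
  have "(0, mat 1) \<in> K" by (simp add: K_def transpose_mat) (simp add: transpose_def vec_eq_iff)
  then have "K \<noteq> {}" by blast
  define f where "f w = (\<Sum>s\<in>T. \<bar>det (snd w + s *\<^sub>R fst w)\<bar>)" for w :: "(real^'n^'n) \<times> (real^'n^'n)"
  have "continuous_on K f" unfolding f_def by (intro continuous_intros)
  then obtain w where w: "w \<in> K" "\<And>y. y \<in> K \<Longrightarrow> f w \<le> f y"
    using continuous_attains_inf[OF cK \<open>K \<noteq> {}\<close>] by metis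
  have "\<exists>s\<in>T. det (snd w + s *\<^sub>R fst w) \<noteq> 0"
    by (rule normalised_pencil_nonsingular[where k = 1]) (use w(1) T in \<open>auto simp: K_def\<close>)
  then obtain s where "s \<in> T" "det (snd w + s *\<^sub>R fst w) \<noteq> 0" by blast
  then have "f w > 0" unfolding f_def by (intro sum_pos2[of _ s]) (use T in auto)
  then show ?thesis
  proof (rule that)
    fix A B :: "real^'n^'n"
    assume "transpose A = A" "transpose B = B" "\<And>x. (norm (A *v x))\<^sup>2 + (norm (B *v x))\<^sup>2 = (norm x)\<^sup>2"
    then have "(A, B) \<in> K" by (simp add: K_def)
    from w(2)[OF this] show "f w \<le> (\<Sum>s\<in>T. \<bar>det (B + s *\<^sub>R A)\<bar>)" by (simp add: f_def)
  qed
qed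

text \<open>The squared area of the parallelogram spanned by the two vectors, which is the squared norm of
  \<open>A \<and> B\<close>. Unlike the product of the norms it is invariant under \<open>B \<mapsto> B + s A\<close>.\<close>

definition gram_det :: "'a::real_inner \<Rightarrow> 'a \<Rightarrow> real" where
  "gram_det A B = (A \<bullet> A) * (B \<bullet> B) - (A \<bullet> B)\<^sup>2"

lemma gram_det_shear: "gram_det (h *\<^sub>R A) (B + s *\<^sub>R A) = h\<^sup>2 * gram_det A B"
  by (simp add: gram_det_def inner_add_left inner_add_right inner_commute algebra_simps power2_eq_square)

lemma gram_det_le: "2 * sqrt (gram_det A B) \<le> (norm A)\<^sup>2 + (norm B)\<^sup>2"
proof -
  have "sqrt (gram_det A B) \<le> sqrt ((norm A)\<^sup>2 * (norm B)\<^sup>2)"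
    by (simp add: gram_det_def power2_norm_eq_inner)
  also have "\<dots> = norm A * norm B" by (simp add: real_sqrt_mult)
  also have "2 * \<dots> \<le> (norm A)\<^sup>2 + (norm B)\<^sup>2" using sum_squares_bound[of "norm A" "norm B"] by simp
  finally show ?thesis by simp
qed

text \<open>Replacing \<open>(A, B)\<close> by \<open>(h A, B + s A)\<close> multiplies the Gram determinant by \<open>h\<^sup>2\<close>, and turns the pencil
  at \<open>\<sigma>\<close> into the pencil at \<open>s + \<sigma> h\<close>. The minimal pair in the orbit therefore has \<open>k\<close> of order at
  least \<open>h\<close>; after division by \<open>\<surd>k\<close> it is normalised, and the determinants scale by \<open>k\<^bsup>d/2\<^esup>\<close>.\<close>

lemma pencil_det_lower_bound:
  fixes A B :: "real^'n^'n"
  assumes sym: "transpose A = A" "transpose B = B"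
    and c: "c > 0" and ge: "\<And>M. det M = 1 \<Longrightarrow> c \<le> gram_det (congr_matrix M A) (congr_matrix M B)"
    and T: "finite T" "card T > CARD('n)"
  obtains K where "K > 0"
    and "\<And>s h. h > 0 \<Longrightarrow> K * h powr (CARD('n) / 2) \<le> (\<Sum>\<sigma>\<in>T. \<bar>det (B + (s + \<sigma> * h) *\<^sub>R A)\<bar>)"
proof -
  obtain c1 where c1: "c1 > 0" "\<And>A B :: real^'n^'n. transpose A = A \<Longrightarrow> transpose B = B
      \<Longrightarrow> (\<And>x. (norm (A *v x))\<^sup>2 + (norm (B *v x))\<^sup>2 = (norm x)\<^sup>2)
      \<Longrightarrow> c1 \<le> (\<Sum>s\<in>T. \<bar>det (B + s *\<^sub>R A)\<bar>)"
    using normalised_pencil_det_lower_bound[OF T] by metis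
  let ?d = "real CARD('n)"
  define b where "b = 2 * sqrt c / ?d"
  have b: "b > 0" using c by (simp add: b_def)
  show ?thesis
  proof (rule that)
    show "c1 * b powr (?d / 2) > 0" using c1 b by simp
    fix s h :: real assume h: "h > 0"
    have "2 * h * sqrt c \<le> (norm (congr_matrix M (h *\<^sub>R A)))\<^sup>2 + (norm (congr_matrix M (B + s *\<^sub>R A)))\<^sup>2"
      if M: "det M = 1" for M
    proof -
      have e: "congr_matrix M (h *\<^sub>R A) = h *\<^sub>R congr_matrix M A"
        "congr_matrix M (B + s *\<^sub>R A) = congr_matrix M B + s *\<^sub>R congr_matrix M A"
        using congr_matrix_linear[of M h A 0 A] congr_matrix_linear[of M s A 1 B] by (simp_all add: add.commute)
      have "h * sqrt c \<le> h * sqrt (gram_det (congr_matrix M A) (congr_matrix M B))"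
        using ge[OF M] h by simp
      also have "\<dots> = sqrt (gram_det (h *\<^sub>R congr_matrix M A) (congr_matrix M B + s *\<^sub>R congr_matrix M A))"
        using h by (simp add: gram_det_shear real_sqrt_mult)
      finally show ?thesis unfolding e
        using gram_det_le[of "h *\<^sub>R congr_matrix M A" "congr_matrix M B + s *\<^sub>R congr_matrix M A"] by linarith
    qed
    moreover have "transpose (h *\<^sub>R A) = h *\<^sub>R A" "transpose (B + s *\<^sub>R A) = B + s *\<^sub>R A"
      using sym by (simp_all add: transpose_def vec_eq_iff)
    ultimately obtain A' B' :: "real^'n^'n" and k where AB: "transpose A' = A'" "transpose B' = B'"
      "\<And>x. (norm (A' *v x))\<^sup>2 + (norm (B' *v x))\<^sup>2 = k * (norm x)\<^sup>2"
      "\<And>s' t. det (s' *\<^sub>R A' + t *\<^sub>R B') = det (s' *\<^sub>R (h *\<^sub>R A) + t *\<^sub>R (B + s *\<^sub>R A))"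
      "2 * h * sqrt c \<le> k * ?d"
      using minimal_congruent_pair[of "h *\<^sub>R A" "B + s *\<^sub>R A" "2 * h * sqrt c"] by metis
    have kb: "b * h \<le> k" using AB(5) by (simp add: b_def field_simps)
    have k: "k > 0" using kb b h by (meson less_le_trans mult_pos_pos)
    define r where "r = 1 / sqrt k"
    have "c1 \<le> (\<Sum>\<sigma>\<in>T. \<bar>det (r *\<^sub>R B' + \<sigma> *\<^sub>R (r *\<^sub>R A'))\<bar>)"

    proof (rule c1(2))
      show "transpose (r *\<^sub>R A') = r *\<^sub>R A'" "transpose (r *\<^sub>R B') = r *\<^sub>R B'"
        using AB(1,2) by (simp_all add: transpose_def vec_eq_iff)
      fix x
      have "(norm (r *\<^sub>R A' *v x))\<^sup>2 + (norm (r *\<^sub>R B' *v x))\<^sup>2 = r\<^sup>2 * ((norm (A' *v x))\<^sup>2 + (norm (B' *v x))\<^sup>2)"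
        by (simp add: scaleR_matrix_vector_assoc[symmetric] power_mult_distrib algebra_simps)
      then show "(norm (r *\<^sub>R A' *v x))\<^sup>2 + (norm (r *\<^sub>R B' *v x))\<^sup>2 = (norm x)\<^sup>2"
        using k by (simp add: AB(3) r_def power_divide)
    qed
    also have "\<dots> = (\<Sum>\<sigma>\<in>T. \<bar>r ^ CARD('n) * det (B + (s + \<sigma> * h) *\<^sub>R A)\<bar>)"
    proof (intro sum.cong refl)
      fix \<sigma>
      have "r *\<^sub>R B' + \<sigma> *\<^sub>R (r *\<^sub>R A') = r *\<^sub>R (\<sigma> *\<^sub>R A' + 1 *\<^sub>R B')" by (simp add: algebra_simps)
      then have "det (r *\<^sub>R B' + \<sigma> *\<^sub>R (r *\<^sub>R A')) = r ^ CARD('n) * det (\<sigma> *\<^sub>R (h *\<^sub>R A) + 1 *\<^sub>R (B + s *\<^sub>R A))"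
        by (simp only: det_scaleR AB(4))
      also have "\<sigma> *\<^sub>R (h *\<^sub>R A) + 1 *\<^sub>R (B + s *\<^sub>R A) = B + (s + \<sigma> * h) *\<^sub>R A" by (simp add: algebra_simps)
      finally show "\<bar>det (r *\<^sub>R B' + \<sigma> *\<^sub>R (r *\<^sub>R A'))\<bar> = \<bar>r ^ CARD('n) * det (B + (s + \<sigma> * h) *\<^sub>R A)\<bar>" by simp
    qed
    also have "\<dots> = r ^ CARD('n) * (\<Sum>\<sigma>\<in>T. \<bar>det (B + (s + \<sigma> * h) *\<^sub>R A)\<bar>)"
      using k by (simp add: abs_mult sum_distrib_left r_def)
    also have "r ^ CARD('n) = k powr (- ?d / 2)"
      using k by (simp add: r_def powr_half_sqrt[symmetric] powr_minus_divide[symmetric] powr_powr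
          flip: powr_realpow)
    finally have "c1 * k powr (?d / 2) \<le> (\<Sum>\<sigma>\<in>T. \<bar>det (B + (s + \<sigma> * h) *\<^sub>R A)\<bar>)"
      using k by (simp add: powr_minus field_simps)
    moreover have "c1 * b powr (?d / 2) * h powr (?d / 2) \<le> c1 * k powr (?d / 2)"
      using kb b h c1 by (simp add: powr_mult[symmetric] powr_mono2)
    ultimately show "c1 * b powr (?d / 2) * h powr (?d / 2) \<le> (\<Sum>\<sigma>\<in>T. \<bar>det (B + (s + \<sigma> * h) *\<^sub>R A)\<bar>)"
      by linarith
  qed
qed

section \<open>The affine density controls a Gram determinant\<close>

text \<open>The matrix \<open>W\<close> acting on the coordinates in the range of \<open>e\<close>, and the identity on the others. For the
  two injections into a sum type this yields the block matrices \<open>diag(W, I)\<close> and \<open>diag(I, W)\<close>.\<close>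

definition embed_matrix :: "('m \<Rightarrow> 'n) \<Rightarrow> real^'m^'m \<Rightarrow> real^'n^'n" where
  "embed_matrix e W = (\<chi> i j. if i \<in> range e \<and> j \<in> range e then W $ inv e i $ inv e j else of_bool (i = j))"

lemma embed_matrix_range:
  "inj e \<Longrightarrow> embed_matrix e W $ e k $ e l = W $ k $ l"
  "j \<notin> range e \<Longrightarrow> embed_matrix e W $ i $ j = of_bool (i = j)"
  "i \<notin> range e \<Longrightarrow> embed_matrix e W $ i $ j = of_bool (i = j)"
  by (auto simp: embed_matrix_def)

lemma embed_matrix_mult:
  fixes e :: "'m::finite \<Rightarrow> 'n::finite"
  assumes e: "inj e"
  shows "embed_matrix e (V ** W) = embed_matrix e V ** embed_matrix e W"
proof -
  have "embed_matrix e (V ** W) $ i $ j = (embed_matrix e V ** embed_matrix e W) $ i $ j" for i j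
  proof (cases "i \<in> range e")
    case False
    then show ?thesis
      by (simp add: matrix_matrix_mult_def embed_matrix_range(3) of_bool_def if_distrib[where f = "\<lambda>x. x * _"] cong: if_cong)
  next
    case True
    then obtain i' where i: "i = e i'" by blast
    show ?thesis
    proof (cases "j \<in> range e")
      case False
      then show ?thesis
        by (simp add: matrix_matrix_mult_def embed_matrix_range(2) of_bool_def if_distrib[where f = "\<lambda>x. _ * x"] cong: if_cong)
    next
      case True
      then obtain j' where j: "j = e j'" by blast
      have "(embed_matrix e V ** embed_matrix e W) $ i $ j
          = (\<Sum>k\<in>range e. embed_matrix e V $ i $ k * embed_matrix e W $ k $ j)"
        unfolding matrix_matrix_mult_def
        by (simp, rule sum.mono_neutral_right) (auto simp: i embed_matrix_range(2))
      also have "\<dots> = (\<Sum>k\<in>UNIV. V $ i' $ k * W $ k $ j')"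
        by (subst sum.reindex[OF e]) (simp add: i j embed_matrix_range(1)[OF e])
      finally show ?thesis by (simp add: i j embed_matrix_range(1)[OF e] matrix_matrix_mult_def)
    qed
  qed
  then show ?thesis by (simp add: vec_eq_iff)
qed

text \<open>Both sides are multiplicative, so it is enough to compare them on elementary matrices.\<close>

lemma det_embed_matrix:
  fixes e :: "'m::finite \<Rightarrow> 'n::finite" and W :: "real^'m^'m"
  assumes e: "inj e" shows "det (embed_matrix e W) = det W"
proof (induction W rule: induct_matrix_elementary)
  case (1 V W) then show ?case by (simp add: embed_matrix_mult[OF e] det_mul)
next
  case (2 W i)
  have "row (e i) (embed_matrix e W) $ j = 0" for j
    using arg_cong[OF 2, of "\<lambda>v. v $ inv e j"]
    by (cases "j \<in> range e") (auto simp: row_def embed_matrix_range(2) embed_matrix_range(1)[OF e] e)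
  then have "row (e i) (embed_matrix e W) = 0" by (simp add: vec_eq_iff)
  from det_zero_row(1)[OF this] det_zero_row(1)[OF 2] show ?case by simp
next
  case (3 W)
  have "det (embed_matrix e W) = (\<Prod>i\<in>UNIV. embed_matrix e W $ i $ i)"
    by (rule det_diagonal) (use 3 e in \<open>auto simp: embed_matrix_def inj_eq\<close>)
  also have "\<dots> = (\<Prod>i\<in>range e. embed_matrix e W $ i $ i)"
    by (rule prod.mono_neutral_right) (auto simp: embed_matrix_range(3))
  also have "\<dots> = (\<Prod>i\<in>UNIV. W $ i $ i)"
    by (subst prod.reindex[OF e]) (simp add: embed_matrix_range(1)[OF e])
  also have "\<dots> = det W" by (rule det_diagonal[symmetric]) (use 3 in auto)
  finally show ?case .
next
  case (4 m n)
  let ?S = "(\<chi> i j. mat 1 $ i $ Transposition.transpose m n j) :: real^'m^'m"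
  have en: "e m \<noteq> e n" using 4 e by (simp add: inj_eq)
  have "embed_matrix e ?S = (\<chi> i j. mat 1 $ i $ Transposition.transpose (e m) (e n) j)"
    using e by (auto simp: vec_eq_iff embed_matrix_def mat_def Transposition.transpose_def inj_eq)
  then show ?case
    using 4 en det_permute_columns[OF permutes_swap_id[of "e m" UNIV "e n"], of "mat 1 :: real^'n^'n"]
      det_permute_columns[OF permutes_swap_id[of m UNIV n], of "mat 1 :: real^'m^'m"]
    by (simp add: sign_swap_id)
next
  case (5 m n c)
  have en: "e m \<noteq> e n" using 5 e by (simp add: inj_eq)
  have row: "(\<chi> i j. if i = k \<and> j = l then c else of_bool (i = j)) = mat 1 + c *\<^sub>R rank_one (axis k 1) (axis l 1)"
    if "k \<noteq> l" for k l :: "'k::finite"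
    using that by (auto simp: vec_eq_iff mat_def rank_one_def axis_def)
  have "embed_matrix e (\<chi> i j. if i = m \<and> j = n then c else of_bool (i = j))
      = (\<chi> i j. if i = e m \<and> j = e n then c else of_bool (i = j))"
    using e by (auto simp: vec_eq_iff embed_matrix_def inj_eq)
  then show ?case by (simp add: row 5 en det_shear_axis)
qed

text \<open>Conjugation by the matrix that doubles the coordinates in \<open>S\<close> maps \<open>I + N\<close> to
  \<open>I + 2 N = (I + N)\<^sup>2\<close>, so the determinant is equal to its square.\<close>

lemma det_unipotent_block:
  fixes N :: "real^'n^'n"
  assumes N: "\<And>i j. N $ i $ j \<noteq> 0 \<Longrightarrow> i \<in> S \<and> j \<notin> S"
  shows "det (mat 1 + N) = 1"
proof -
  have nil: "N ** N = 0"
    using N by (auto simp: matrix_matrix_mult_def vec_eq_iff intro!: sum.neutral) blast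
  define D where "D c = ((\<chi> i j. if i = j then (if i \<in> S then c else 1) else 0) :: real^'n^'n)" for c :: real
  have "D 2 ** (mat 1 + N) = (mat 1 + N) ** (mat 1 + N) ** D 2"
  proof -
    have "N ** D 2 = N"
      using N by (auto simp: D_def matrix_matrix_mult_def vec_eq_iff if_distrib[where f = "\<lambda>x. _ * x"] cong: if_cong)
    moreover have "D 2 ** N = 2 *\<^sub>R N"
      using N by (auto simp: D_def matrix_matrix_mult_def vec_eq_iff if_distrib[where f = "\<lambda>x. x * _"] cong: if_cong)
    moreover have "(mat 1 + N) ** (mat 1 + N) = mat 1 + 2 *\<^sub>R N"
      by (simp add: matrix_add_ldistrib matrix_add_rdistrib nil scaleR_2)
    ultimately show ?thesis
      by (metis matrix_add_ldistrib matrix_add_rdistrib scalar_matrix_assoc matrix_mul_rid matrix_mul_lid)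
  qed
  then have "det (D 2) * det (mat 1 + N) = det (mat 1 + N) * det (mat 1 + N) * det (D 2)"
    by (metis det_mul)
  moreover have "det (D 2) \<noteq> 0" by (simp add: D_def det_diagonal)
  moreover have "det (mat 1 + N) \<noteq> 0"
  proof -
    have "(mat 1 + N) ** (mat 1 - N) = mat 1"
      by (simp add: matrix_sub_distrib matrix_add_rdistrib nil)
    then have "det (mat 1 + N) * det (mat 1 - N) = 1" by (metis det_mul det_I)
    then show ?thesis by auto
  qed
  ultimately show ?thesis by simp
qed

text \<open>The second derivatives of the parametrisation have no component along \<open>\<real>\<^sup>d\<close>, so the matrix is
  block triangular. It is the product of \<open>diag(I, W)\<close>, a unipotent matrix and \<open>diag(V, I)\<close>.\<close>

lemma det_vectors_vertical:
  fixes v :: "'d::finite \<Rightarrow> (real^'d) \<times> real \<times> real"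
  shows "det_vectors v (0, a, b) (0, a', b') = (a * b' - a' * b) * det (\<chi> l. fst (v l))"
proof -
  define V where "V = (\<chi> l. fst (v l))"
  define W where "W = (\<chi> (i::2) (j::2). if i = 1 then (if j = 1 then a else b) else (if j = 1 then a' else b'))"
  define N where "N = (\<chi> (i::'d + 2) (j::'d + 2). case i of Inl k \<Rightarrow>
     (case j of Inl _ \<Rightarrow> 0 | Inr l \<Rightarrow> if l = 1 then fst (snd (v k)) else snd (snd (v k))) | Inr _ \<Rightarrow> 0)"
  let ?X = "\<chi> (r :: 'd + 2) (c :: 'd + 2).
       coordinate (case r of Inl k \<Rightarrow> v k | Inr j \<Rightarrow> if j = 1 then (0, a, b) else (0, a', b')) c"
  have inl: "inj (Inl :: 'd \<Rightarrow> 'd + 2)" and inr: "inj (Inr :: 2 \<Rightarrow> 'd + 2)" by simp_all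
  have VN: "embed_matrix Inl V + N = (\<chi> i j. case i of Inl k \<Rightarrow> coordinate (v k) j | Inr _ \<Rightarrow> of_bool (i = j))"
    by (auto simp: vec_eq_iff embed_matrix_def N_def V_def coordinate_def split: sum.splits)
  have NV: "(mat 1 + N) ** embed_matrix Inl V = embed_matrix Inl V + N"
  proof -
    have "N ** embed_matrix Inl V = N"
    proof -
      have "N $ i $ k * embed_matrix Inl V $ k $ j = (if k = j then N $ i $ j else 0)" for i j k
        by (auto simp: N_def embed_matrix_def of_bool_def split: sum.splits)
      then show ?thesis by (simp add: matrix_matrix_mult_def vec_eq_iff)
    qed
    then show ?thesis by (simp add: matrix_add_rdistrib)
  qed
  have "?X = embed_matrix Inr W ** (embed_matrix Inl V + N)"
  proof -
    have "?X $ i $ j = (embed_matrix Inr W ** (embed_matrix Inl V + N)) $ i $ j" for i j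
    proof (cases i)
      case (Inl k)
      then have "i \<notin> range Inr" by auto
      then show ?thesis
        unfolding matrix_matrix_mult_def VN
        by (simp add: embed_matrix_range(3) Inl of_bool_def if_distrib[where f = "\<lambda>x. x * _"] cong: if_cong)
    next
      case (Inr k)
      have "(embed_matrix Inr W ** (embed_matrix Inl V + N)) $ i $ j
          = (\<Sum>l\<in>range Inr. embed_matrix Inr W $ i $ l * (embed_matrix Inl V + N) $ l $ j)"
        unfolding matrix_matrix_mult_def
        by (simp, rule sum.mono_neutral_right) (auto simp: Inr embed_matrix_range(2))
      also have "\<dots> = (\<Sum>l\<in>UNIV. W $ k $ l * of_bool (Inr l = j))"
        by (subst sum.reindex[OF inr]) (simp add: Inr embed_matrix_range(1)[OF inr] VN)
      also have "\<dots> = ?X $ i $ j"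
        by (auto simp: Inr coordinate_def W_def of_bool_def if_distrib[where f = "\<lambda>x. _ * x"] split: sum.splits cong: if_cong)
      finally show ?thesis ..
    qed
    then show ?thesis by (simp only: vec_eq_iff) blast
  qed
  then have "det ?X = det W * (det (mat 1 + N) * det V)"
    by (simp only: NV[symmetric] det_mul det_embed_matrix[OF inl] det_embed_matrix[OF inr])
  also have "det (mat 1 + N) = 1"
    by (rule det_unipotent_block[where S = "range Inl"]) (auto simp: N_def split: sum.splits if_splits)
  also have "det W = a * b' - a' * b"
    by (simp add: det_2 W_def)
  finally show ?thesis by (simp add: det_vectors_def V_def)
qed

lemma frame_deriv_eq:
  assumes "(f has_derivative f') (at \<xi>)"
  shows "frame_deriv M i f \<xi> = f' (M $ i)"
proof -
  have lin: "linear f'" using assms has_derivative_linear by blast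
  have "frame_deriv M i f \<xi> = (\<Sum>k\<in>UNIV. M $ i $ k *\<^sub>R f' (axis k 1))"
    unfolding frame_deriv_def partial_deriv_def frechet_derivative_at[OF assms, symmetric] ..
  also have "\<dots> = f' (\<Sum>k\<in>UNIV. M $ i $ k *\<^sub>R axis k 1)"
    by (simp add: linear_sum[OF lin] linear_scale[OF lin])
  also have "(\<Sum>k\<in>UNIV. M $ i $ k *\<^sub>R axis k 1) = M $ i"
    by (metis basis_expansion scalar_mult_eq_scaleR)
  finally show ?thesis .
qed

lemma has_derivative_quadratic_form:
  fixes A :: "real^'n^'n"
  assumes "transpose A = A"
  shows "((\<lambda>x. x \<bullet> (A *v x)) has_derivative (\<lambda>h. 2 * ((A *v x) \<bullet> h))) (at x)"
proof -
  have "((\<lambda>x. A *v x) has_derivative (\<lambda>h. A *v h)) (at x)"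
    by (simp add: bounded_linear_imp_has_derivative matrix_vector_mul_bounded_linear)
  then have "((\<lambda>x. x \<bullet> (A *v x)) has_derivative (\<lambda>h. x \<bullet> (A *v h) + h \<bullet> (A *v x))) (at x)"
    by (intro has_derivative_inner has_derivative_ident)
  moreover have "x \<bullet> (A *v h) + h \<bullet> (A *v x) = 2 * ((A *v x) \<bullet> h)" for h
    using symmetric_matrix_inner[OF assms, of x h] by (simp add: inner_commute)
  ultimately show ?thesis by simp
qed

lemma gradient_quadratic_form:
  fixes A :: "real^'n^'n"
  assumes "transpose A = A"
  shows "gradient (\<lambda>x. x \<bullet> (A *v x)) \<xi> = 2 *\<^sub>R (A *v \<xi>)"
  unfolding gradient_def partial_deriv_def
    frechet_derivative_at[OF has_derivative_quadratic_form[OF assms], symmetric]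
  by (simp add: vec_eq_iff inner_axis)

lemma congr_matrix_entry:
  "congr_matrix M A $ i $ j = (A *v (M $ j)) \<bullet> (M $ i)"
proof -
  have "congr_matrix M A $ i $ j = (M ** (A ** transpose M)) $ i $ j"
    by (simp add: congr_matrix_def matrix_mul_assoc)
  also have "\<dots> = (A *v (M $ j)) \<bullet> (M $ i)"
    by (simp add: matrix_matrix_mult_def matrix_vector_mult_def inner_vec_def transpose_def mult.commute)
  finally show ?thesis .
qed

text \<open>Lagrange's identity, for the entries of two matrices.\<close>

lemma sum_minors_eq_gram_det:
  fixes X Y :: "real^'n^'n"
  shows "(\<Sum>j1\<in>UNIV. \<Sum>j2\<in>UNIV. \<Sum>k1\<in>UNIV. \<Sum>k2\<in>UNIV.
     (X $ j2 $ j1 * Y $ k2 $ k1 - X $ k2 $ k1 * Y $ j2 $ j1)\<^sup>2) = 2 * gram_det X Y"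
proof -
  have inn: "U \<bullet> V = (\<Sum>j1\<in>UNIV. \<Sum>j2\<in>UNIV. U $ j2 $ j1 * V $ j2 $ j1)" for U V :: "real^'n^'n"
    by (simp add: inner_vec_def) (rule sum.swap)
  have "(X $ j2 $ j1 * Y $ k2 $ k1 - X $ k2 $ k1 * Y $ j2 $ j1)\<^sup>2
     = (X $ j2 $ j1 * X $ j2 $ j1) * (Y $ k2 $ k1 * Y $ k2 $ k1)
     + (Y $ j2 $ j1 * Y $ j2 $ j1) * (X $ k2 $ k1 * X $ k2 $ k1)
     - 2 * ((X $ j2 $ j1 * Y $ j2 $ j1) * (X $ k2 $ k1 * Y $ k2 $ k1))" for j1 j2 k1 k2
    by (simp add: power2_eq_square algebra_simps)
  then show ?thesis
    by (simp only: sum.distrib sum_subtractf sum_distrib_left[symmetric]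
        sum_distrib_right[symmetric] inn[symmetric])
       (simp add: gram_det_def power2_eq_square)
qed

text \<open>A selection of rows is a permutation or repeats a row.\<close>

lemma det_select_rows:
  fixes M :: "real^'n^'n" and i :: "'n \<Rightarrow> 'n"
  shows "\<bar>det (\<chi> l. M $ i l)\<bar> \<le> \<bar>det M\<bar>"
proof (cases "inj i")
  case True
  then have "i permutes UNIV"
    by (intro bij_imp_permutes bijI finite_UNIV_inj_surj) auto
  from det_permute_rows[OF this, of M] show ?thesis
    by (simp add: abs_mult sign_def)
next
  case False
  then obtain k l where "k \<noteq> l" "i k = i l" by (auto simp: inj_def)
  then have "det (\<chi> l. M $ i l) = 0"
    by (intro det_identical_rows[of k l]) (auto simp: row_def)
  then show ?thesis by simp
qed

text \<open>The first derivatives contribute at most \<open>1\<close> to each determinant in the density, and the second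
  derivatives a multiple of a \<open>2 \<times> 2\<close> minor of the pair \<open>(M A M\<^sup>T, M B M\<^sup>T)\<close>; so the sum of squares is at most a
  constant times the Gram determinant.\<close>

lemma well_curved_gram_det:
  fixes A B :: "real^'d^'d"
  assumes sym: "transpose A = A" "transpose B = B"
    and wc: "well_curved (\<lambda>x. x \<bullet> (A *v x)) (\<lambda>x. x \<bullet> (B *v x))"
  obtains c where "c > 0" "\<And>M. det M = 1 \<Longrightarrow> c \<le> gram_det (congr_matrix M A) (congr_matrix M B)"
proof -
  define \<phi> where "\<phi> = surface_param (\<lambda>x. x \<bullet> (A *v x)) (\<lambda>x. x \<bullet> (B *v x))"
  have \<phi>: "\<phi> = (\<lambda>\<xi>. (\<xi>, \<xi> \<bullet> (A *v \<xi>), \<xi> \<bullet> (B *v \<xi>)))"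
    by (simp add: \<phi>_def surface_param_def fun_eq_iff)
  have d1: "frame_deriv M i \<phi> \<xi> = (M $ i, 2 * ((A *v \<xi>) \<bullet> (M $ i)), 2 * ((B *v \<xi>) \<bullet> (M $ i)))" for M i \<xi>
    unfolding \<phi> by (rule frame_deriv_eq)
      (intro has_derivative_Pair has_derivative_ident has_derivative_quadratic_form sym)
  have d2: "frame_deriv M i (frame_deriv M j \<phi>) \<xi>
      = (0, 2 * congr_matrix M A $ j $ i, 2 * congr_matrix M B $ j $ i)" for M i j \<xi>
  proof -
    have e: "frame_deriv M j \<phi> = (\<lambda>\<xi>. (M $ j, 2 * ((A *v \<xi>) \<bullet> (M $ j)), 2 * ((B *v \<xi>) \<bullet> (M $ j))))"
      using d1 by (simp add: fun_eq_iff)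
    have m: "((\<lambda>x. X *v x) has_derivative (\<lambda>h. X *v h)) (at \<xi>)" for X :: "real^'d^'d"
      by (simp add: bounded_linear_imp_has_derivative matrix_vector_mul_bounded_linear)
    have "(frame_deriv M j \<phi> has_derivative
        (\<lambda>h. (0, 2 * ((A *v h) \<bullet> (M $ j)), 2 * ((B *v h) \<bullet> (M $ j))))) (at \<xi>)"
      unfolding e
      by (intro has_derivative_Pair has_derivative_const has_derivative_mult_right has_derivative_inner_left m)
    then have "frame_deriv M i (frame_deriv M j \<phi>) \<xi>
      = (0, 2 * ((A *v (M $ i)) \<bullet> (M $ j)), 2 * ((B *v (M $ i)) \<bullet> (M $ j)))"
      by (rule frame_deriv_eq)
    then show ?thesis by (simp add: congr_matrix_entry)
  qed
  define S where "S M = (\<Sum>i\<in>(UNIV :: ('d \<Rightarrow> 'd) set). \<Sum>j1\<in>UNIV. \<Sum>j2\<in>UNIV. \<Sum>k1\<in>UNIV. \<Sum>k2\<in>UNIV.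
           \<bar>det_vectors (\<lambda>l. frame_deriv M (i l) \<phi> 0)
              (frame_deriv M j1 (frame_deriv M j2 \<phi>) 0)
              (frame_deriv M k1 (frame_deriv M k2 \<phi>) 0)\<bar>\<^sup>2)" for M
  define N where "N = real (card (UNIV :: ('d \<Rightarrow> 'd) set))"
  have N: "N > 0" unfolding N_def by (simp add: card_gt_0_iff)
  have S: "S M \<le> 32 * N * gram_det (congr_matrix M A) (congr_matrix M B)" if M: "det M = 1" for M
  proof -
    let ?X = "congr_matrix M A" and ?Y = "congr_matrix M B"
    have t: "\<bar>det_vectors (\<lambda>l. frame_deriv M (i l) \<phi> 0)
              (frame_deriv M j1 (frame_deriv M j2 \<phi>) 0)
              (frame_deriv M k1 (frame_deriv M k2 \<phi>) 0)\<bar>\<^sup>2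
        \<le> 16 * (?X $ j2 $ j1 * ?Y $ k2 $ k1 - ?X $ k2 $ k1 * ?Y $ j2 $ j1)\<^sup>2" for i j1 j2 k1 k2
    proof -
      have "\<bar>det_vectors (\<lambda>l. frame_deriv M (i l) \<phi> 0)
              (frame_deriv M j1 (frame_deriv M j2 \<phi>) 0)
              (frame_deriv M k1 (frame_deriv M k2 \<phi>) 0)\<bar>
         = \<bar>4 * (?X $ j2 $ j1 * ?Y $ k2 $ k1 - ?X $ k2 $ k1 * ?Y $ j2 $ j1)\<bar> * \<bar>det (\<chi> l. M $ i l)\<bar>"
        unfolding d2 det_vectors_vertical by (simp add: d1 abs_mult[symmetric] algebra_simps)
      also have "\<dots> \<le> \<bar>4 * (?X $ j2 $ j1 * ?Y $ k2 $ k1 - ?X $ k2 $ k1 * ?Y $ j2 $ j1)\<bar>"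
        using det_select_rows[of M i] M by (intro mult_right_le_one_le) auto
      finally have "\<bar>det_vectors (\<lambda>l. frame_deriv M (i l) \<phi> 0)
              (frame_deriv M j1 (frame_deriv M j2 \<phi>) 0)
              (frame_deriv M k1 (frame_deriv M k2 \<phi>) 0)\<bar>\<^sup>2
         \<le> \<bar>4 * (?X $ j2 $ j1 * ?Y $ k2 $ k1 - ?X $ k2 $ k1 * ?Y $ j2 $ j1)\<bar>\<^sup>2"
        by (intro power_mono) auto
      then show ?thesis by (simp only: power2_abs power_mult_distrib) simp
    qed
    have "S M \<le> (\<Sum>i\<in>(UNIV :: ('d \<Rightarrow> 'd) set). \<Sum>j1\<in>UNIV. \<Sum>j2\<in>UNIV. \<Sum>k1\<in>UNIV. \<Sum>k2\<in>UNIV.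
        16 * (?X $ j2 $ j1 * ?Y $ k2 $ k1 - ?X $ k2 $ k1 * ?Y $ j2 $ j1)\<^sup>2)"
      unfolding S_def by (intro sum_mono t)
    also have "\<dots> = 32 * N * gram_det ?X ?Y"
      by (simp only: sum_distrib_left[symmetric] sum_minors_eq_gram_det) (simp add: N_def)
    finally show ?thesis .
  qed
  have "0 \<in> (unit_cube :: (real^'d) set)" by (simp add: unit_cube_def)
  then have "affine_density (\<lambda>x. x \<bullet> (A *v x)) (\<lambda>x. x \<bullet> (B *v x)) (0::real^'d) \<noteq> 0"
    using wc by (auto simp: well_curved_def)
  moreover define I where "I = (INF M\<in>{M. det M = 1}. sqrt (S M))"
  ultimately have "I \<noteq> 0"
    unfolding affine_density_def Let_def \<phi>_def[symmetric] S_def[symmetric] by auto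
  have nn: "0 \<le> sqrt (S M)" for M
    unfolding S_def by (intro real_sqrt_ge_zero sum_nonneg) auto
  have bdd: "bdd_below ((\<lambda>M. sqrt (S M)) ` {M. det M = 1})"
    using nn by (intro bdd_belowI[of _ 0]) auto
  have "{M :: real^'d^'d. det M = 1} \<noteq> {}" using det_I by blast
  then have "0 \<le> I" unfolding I_def using nn by (intro cINF_greatest) auto
  then have I: "I > 0" using \<open>I \<noteq> 0\<close> by simp
  show ?thesis
  proof (rule that)
    show "I\<^sup>2 / (32 * N) > 0" using I N by simp
    fix M :: "real^'d^'d" assume M: "det M = 1"
    have "I \<le> sqrt (S M)" unfolding I_def using bdd M by (intro cINF_lower) auto
    then have "I\<^sup>2 \<le> (sqrt (S M))\<^sup>2" using I by (intro power_mono) auto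
    also have "\<dots> = S M" using nn[of M] by simp
    finally show "I\<^sup>2 / (32 * N) \<le> gram_det (congr_matrix M A) (congr_matrix M B)"
      using S[OF M] N by (simp add: field_simps)
  qed
qed

section \<open>Negative powers of the discriminant of the pencil\<close>

text \<open>At a root of order \<open>m\<close> the right-hand side is \<open>O(h\<^sup>m)\<close> as \<open>h\<close> tends to \<open>0\<close>.\<close>

lemma order_le_of_lower_bound:
  fixes P :: "real poly"
  assumes K: "K > 0"
    and bound: "\<And>s h. h > 0 \<Longrightarrow> K * h powr a \<le> (\<Sum>\<sigma>\<in>T. \<bar>poly P (s + \<sigma> * h)\<bar>)"
  shows "P \<noteq> 0" and "real (order x P) \<le> a"
proof -
  show P: "P \<noteq> 0"
    using bound[of 1 0] K by auto
  show "real (order x P) \<le> a"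
  proof (rule ccontr)
    define m where "m = order x P"
    assume "\<not> real (order x P) \<le> a"
    then have am: "real m - a > 0" by (simp add: m_def)
    obtain q where q: "P = [:- x, 1:] ^ m * q" using order_decomp[OF P, of x] m_def by blast
    define G where "G h = (\<Sum>\<sigma>\<in>T. \<bar>\<sigma>\<bar> ^ m * \<bar>poly q (x + \<sigma> * h)\<bar>)" for h
    have "K \<le> h powr (real m - a) * G h" if h: "h > 0" for h
    proof -
      have "K * h powr a \<le> (\<Sum>\<sigma>\<in>T. \<bar>poly P (x + \<sigma> * h)\<bar>)" by (rule bound[OF h])
      also have "\<dots> = h ^ m * G h"
        using h by (simp add: q G_def abs_mult power_abs[symmetric] power_mult_distrib sum_distrib_left algebra_simps)
      also have "h ^ m = h powr (real m - a) * h powr a"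
        using h by (simp add: powr_add[symmetric] powr_realpow)
      finally show ?thesis using h by (simp add: mult.commute mult.left_commute)
    qed
    then have ev: "\<forall>\<^sub>F h in at_right 0. K \<le> h powr (real m - a) * G h"
      by (simp add: eventually_at_filter)
    have "((\<lambda>h. h powr (real m - a) * G h) \<longlongrightarrow> 0 * G 0) (at_right 0)"
    proof (intro tendsto_mult)
      have "((\<lambda>h::real. h powr (real m - a)) \<longlongrightarrow> 0 powr (real m - a)) (at_right 0)"
        by (rule tendsto_powr') (use am in \<open>auto simp: eventually_at_filter intro!: tendsto_ident_at\<close>)
      then show "((\<lambda>h::real. h powr (real m - a)) \<longlongrightarrow> 0) (at_right 0)" by simp
      have "isCont G 0" unfolding G_def by (intro continuous_intros)
      then show "(G \<longlongrightarrow> G 0) (at_right 0)"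
        by (meson isCont_def filterlim_at_split)
    qed
    from tendsto_lowerbound[OF this ev] K show False by simp
  qed
qed

lemma nn_integral_abs_powr_finite:
  fixes a :: real
  assumes a: "a > -1"
  shows "(\<integral>\<^sup>+s. ennreal (\<bar>s - x\<bar> powr a) * indicator {x - c..x + c} s \<partial>lborel) < \<infinity>"
proof -
  define J where "J = (\<integral>\<^sup>+s. ennreal (s powr a) * indicator {0..c} s \<partial>lborel)"
  have J: "J < \<infinity>"
  proof (cases "c \<ge> 0")
    case True
    then obtain I where "((\<lambda>s. s powr a) has_integral I) {0..c}"
      using integrable_on_powr_from_0[OF a] by (auto simp: integrable_on_def)
    then have "J = ennreal I"
      unfolding J_def by (intro nn_integral_has_integral_lebesgue') auto
    then show ?thesis by simp
  qed (simp add: J_def)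
  have "(\<integral>\<^sup>+s. ennreal (\<bar>s - x\<bar> powr a) * indicator {x - c..x + c} s \<partial>lborel)
      \<le> (\<integral>\<^sup>+s. ennreal ((s - x) powr a) * indicator {0..c} (s - x)
           + ennreal ((x - s) powr a) * indicator {0..c} (x - s) \<partial>lborel)"
    by (intro nn_integral_mono) (auto simp: indicator_def abs_if)
  also have "\<dots> = (\<integral>\<^sup>+s. ennreal ((s - x) powr a) * indicator {0..c} (s - x) \<partial>lborel)
           + (\<integral>\<^sup>+s. ennreal ((x - s) powr a) * indicator {0..c} (x - s) \<partial>lborel)"
    by (intro nn_integral_add) auto
  also have "(\<integral>\<^sup>+s. ennreal ((s - x) powr a) * indicator {0..c} (s - x) \<partial>lborel) = J"
    by (subst nn_integral_real_affine[where c = 1 and t = x]) (auto simp: J_def)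
  also have "(\<integral>\<^sup>+s. ennreal ((x - s) powr a) * indicator {0..c} (x - s) \<partial>lborel) = J"
    by (subst nn_integral_real_affine[where c = "-1" and t = x]) (auto simp: J_def)
  also have "J + J < \<infinity>" using J by simp
  finally show ?thesis .
qed

lemma nn_integral_compact_finite:
  fixes f :: "real \<Rightarrow> ennreal"
  assumes S: "compact S" and [measurable]: "f \<in> borel_measurable borel"
    and loc: "\<And>x. x \<in> S \<Longrightarrow> \<exists>U. open U \<and> x \<in> U \<and> (\<integral>\<^sup>+s. f s * indicator U s \<partial>lborel) < \<infinity>"
  shows "(\<integral>\<^sup>+s. f s * indicator S s \<partial>lborel) < \<infinity>"
proof -
  obtain U where U: "\<And>x. x \<in> S \<Longrightarrow> open (U x)" "\<And>x. x \<in> S \<Longrightarrow> x \<in> U x"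
      "\<And>x. x \<in> S \<Longrightarrow> (\<integral>\<^sup>+s. f s * indicator (U x) s \<partial>lborel) < \<infinity>"
    using loc by metis
  obtain C where C: "C \<subseteq> S" "finite C" "S \<subseteq> (\<Union>x\<in>C. U x)"
    using compactE_image[OF S, of S U] U by blast
  have "(\<integral>\<^sup>+s. f s * indicator S s \<partial>lborel) \<le> (\<integral>\<^sup>+s. (\<Sum>x\<in>C. f s * indicator (U x) s) \<partial>lborel)"
  proof (intro nn_integral_mono)
    fix s
    show "f s * indicator S s \<le> (\<Sum>x\<in>C. f s * indicator (U x) s)"
    proof (cases "s \<in> S")
      case True
      then obtain x where x: "x \<in> C" "s \<in> U x" using C by blast
      have "f s * indicator (U x) s \<le> (\<Sum>x\<in>C. f s * indicator (U x) s)"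
        by (rule member_le_sum) (use C x in auto)
      then show ?thesis using True x by simp
    qed simp
  qed
  also have "\<dots> = (\<Sum>x\<in>C. \<integral>\<^sup>+s. f s * indicator (U x) s \<partial>lborel)"
    by (intro nn_integral_sum) (use U C in \<open>auto intro!: borel_measurable_times_ennreal borel_measurable_indicator\<close>)
  also have "\<dots> < \<infinity>"
    using U C by (auto intro!: ennreal_sum_less_top)
  finally show ?thesis .
qed

lemma poly_measurable [measurable]: "(\<lambda>s. poly (P :: real poly) s) \<in> borel_measurable borel"
  by (intro borel_measurable_continuous_onI continuous_intros)

text \<open>Near a point \<open>x\<close> the polynomial is comparable to \<open>\<bar>s - x\<bar>\<close> to the power \<open>order x P\<close>, and
  \<open>g * order x P < 1\<close>; finitely many such neighbourhoods cover the compact set.\<close>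

lemma nn_integral_poly_powr_finite:
  fixes P :: "real poly"
  assumes P: "P \<noteq> 0" and g: "g \<ge> 0" and ord: "\<And>x. g * real (order x P) < 1" and S: "compact S"
  shows "(\<integral>\<^sup>+s. ennreal (\<bar>poly P s\<bar> powr (- g)) * indicator S s \<partial>lborel) < \<infinity>"
proof (rule nn_integral_compact_finite[OF S])
  show "(\<lambda>s. ennreal (\<bar>poly P s\<bar> powr (- g))) \<in> borel_measurable borel" by measurable
  fix x assume "x \<in> S"
  define m where "m = order x P"
  obtain q where q: "P = [:- x, 1:] ^ m * q" "\<not> [:- x, 1:] dvd q"
    using order_decomp[OF P, of x] m_def by blast
  then have qx: "poly q x \<noteq> 0" by (simp add: poly_eq_0_iff_dvd)
  define e where "e = \<bar>poly q x\<bar> / 2"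
  have e: "e > 0" using qx by (simp add: e_def)
  have "isCont (\<lambda>s. \<bar>poly q s\<bar>) x" by (intro continuous_intros)
  then have "((\<lambda>s. \<bar>poly q s\<bar>) \<longlongrightarrow> \<bar>poly q x\<bar>) (nhds x)"
    using tendsto_at_iff_tendsto_nhds[of "\<lambda>s. \<bar>poly q s\<bar>" x] by (simp add: isCont_def)
  moreover have "\<bar>poly q x\<bar> > e" using qx by (simp add: e_def)
  ultimately have "\<forall>\<^sub>F s in nhds x. \<bar>poly q s\<bar> > e"
    by (rule order_tendstoD(1))
  then obtain c where c: "c > 0" "\<And>s. dist s x < c \<Longrightarrow> \<bar>poly q s\<bar> > e"
    unfolding eventually_nhds_metric by blast
  have pointwise: "ennreal (\<bar>poly P s\<bar> powr (- g)) * indicator (ball x c) s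
       \<le> ennreal (e powr (- g)) * (ennreal (\<bar>s - x\<bar> powr (- (g * m))) * indicator {x - c..x + c} s)"
    if sx: "s \<noteq> x" for s
  proof (cases "s \<in> ball x c")
      case True
      then have s: "dist s x < c" by (auto simp: dist_commute)
      have "\<bar>poly P s\<bar> powr (- g) = \<bar>poly q s\<bar> powr (- g) * \<bar>s - x\<bar> powr (- (g * m))"
        using sx by (simp add: q(1) abs_mult powr_mult power_abs powr_powr flip: powr_realpow)
          (simp add: algebra_simps)
      also have "\<dots> \<le> e powr (- g) * \<bar>s - x\<bar> powr (- (g * m))"
        using c(2)[OF s] e g by (intro mult_right_mono powr_mono2') auto
      finally have "\<bar>poly P s\<bar> powr (- g) \<le> e powr (- g) * \<bar>s - x\<bar> powr (- (g * m))" .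
      moreover have "s \<in> {x - c..x + c}" using s by (auto simp: dist_real_def)
      ultimately show ?thesis using True by (simp add: ennreal_mult[symmetric] ennreal_leI)
  qed auto
  have "(\<integral>\<^sup>+s. ennreal (\<bar>poly P s\<bar> powr (- g)) * indicator (ball x c) s \<partial>lborel)
     \<le> (\<integral>\<^sup>+s. ennreal (e powr (- g)) * (ennreal (\<bar>s - x\<bar> powr (- (g * m))) * indicator {x - c..x + c} s) \<partial>lborel)"
    using AE_lborel_singleton[of x] by (intro nn_integral_mono_AE, eventually_elim) (rule pointwise)
  also have "\<dots> = ennreal (e powr (- g)) * (\<integral>\<^sup>+s. ennreal (\<bar>s - x\<bar> powr (- (g * m))) * indicator {x - c..x + c} s \<partial>lborel)"
    by (intro nn_integral_cmult) auto
  also have "\<dots> < \<infinity>"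
    using nn_integral_abs_powr_finite[of "- (g * m)" x c] ord[of x]
    by (simp add: m_def ennreal_mult_less_top)
  finally show "\<exists>U. open U \<and> x \<in> U \<and> (\<integral>\<^sup>+s. ennreal (\<bar>poly P s\<bar> powr (- g)) * indicator U s \<partial>lborel) < \<infinity>"
    using c(1) by (intro exI[of _ "ball x c"]) auto
qed

text \<open>In the sector \<open>\<bar>s\<bar> \<le> \<bar>t\<bar>\<close> the substitution \<open>s = t \<sigma>\<close> separates a function of degree \<open>d\<close> into its
  restriction to the line \<open>t = 1\<close> and the radial factor \<open>\<bar>t\<bar>\<close> to the power \<open>1 - g d\<close>.\<close>

lemma nn_integral_homogeneous_sector_finite:
  fixes F :: "real \<Rightarrow> real \<Rightarrow> real"
  assumes [measurable]: "p \<in> borel_measurable borel" "\<And>t. (\<lambda>s. F s t) \<in> borel_measurable borel"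
    and hom: "\<And>t \<sigma>. t \<noteq> 0 \<Longrightarrow> \<bar>F (t * \<sigma>) t\<bar> = \<bar>t\<bar> powr d * \<bar>p \<sigma>\<bar>"
    and fin: "(\<integral>\<^sup>+\<sigma>. ennreal (\<bar>p \<sigma>\<bar> powr (- g)) * indicator {-1..1} \<sigma> \<partial>lborel) < \<infinity>"
    and gd: "g * d < 2"
  shows "(\<integral>\<^sup>+t. \<integral>\<^sup>+s. ennreal (\<bar>F s t\<bar> powr (- g)) * (indicator {-\<bar>t\<bar>..\<bar>t\<bar>} s * indicator {-R..R} t) \<partial>lborel \<partial>lborel) < \<infinity>"
proof -
  define I where "I = (\<integral>\<^sup>+\<sigma>. ennreal (\<bar>p \<sigma>\<bar> powr (- g)) * indicator {-1..1} \<sigma> \<partial>lborel)"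
  have inner: "(\<integral>\<^sup>+s. ennreal (\<bar>F s t\<bar> powr (- g)) * (indicator {-\<bar>t\<bar>..\<bar>t\<bar>} s * indicator {-R..R} t) \<partial>lborel)
      = (ennreal (\<bar>t - 0\<bar> powr (1 - g * d)) * indicator {0 - R..0 + R} t) * I" if t: "t \<noteq> 0" for t
  proof -
    have "(\<integral>\<^sup>+s. ennreal (\<bar>F s t\<bar> powr (- g)) * (indicator {-\<bar>t\<bar>..\<bar>t\<bar>} s * indicator {-R..R} t) \<partial>lborel)
      = \<bar>t\<bar> * (\<integral>\<^sup>+\<sigma>. ennreal (\<bar>F (0 + t * \<sigma>) t\<bar> powr (- g)) * (indicator {-\<bar>t\<bar>..\<bar>t\<bar>} (0 + t * \<sigma>) * indicator {-R..R} t) \<partial>lborel)"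
      by (rule nn_integral_real_affine[OF _ t]) measurable
    also have "(\<integral>\<^sup>+\<sigma>. ennreal (\<bar>F (0 + t * \<sigma>) t\<bar> powr (- g)) * (indicator {-\<bar>t\<bar>..\<bar>t\<bar>} (0 + t * \<sigma>) * indicator {-R..R} t) \<partial>lborel)
       = (\<integral>\<^sup>+\<sigma>. (ennreal (\<bar>t\<bar> powr (- (g * d))) * indicator {-R..R} t) * (ennreal (\<bar>p \<sigma>\<bar> powr (- g)) * indicator {-1..1} \<sigma>) \<partial>lborel)"
    proof (intro nn_integral_cong)
      fix \<sigma>
      have "indicator {-\<bar>t\<bar>..\<bar>t\<bar>} (t * \<sigma>) = (indicator {-1..1} \<sigma> :: ennreal)"
      proof -
        have "t * \<sigma> \<in> {-\<bar>t\<bar>..\<bar>t\<bar>} \<longleftrightarrow> \<bar>t\<bar> * \<bar>\<sigma>\<bar> \<le> \<bar>t\<bar> * 1" by (auto simp: abs_mult[symmetric] abs_le_iff)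
        also have "\<dots> \<longleftrightarrow> \<sigma> \<in> {-1..1}" using t by (subst mult_le_cancel_left_pos) auto
        finally show ?thesis by (simp add: indicator_def)
      qed
      moreover have "\<bar>F (t * \<sigma>) t\<bar> powr (- g) = \<bar>t\<bar> powr (- (g * d)) * \<bar>p \<sigma>\<bar> powr (- g)"
        by (simp add: hom[OF t] powr_mult powr_powr) (simp add: mult.commute)
      ultimately show "ennreal (\<bar>F (0 + t * \<sigma>) t\<bar> powr (- g)) * (indicator {-\<bar>t\<bar>..\<bar>t\<bar>} (0 + t * \<sigma>) * indicator {-R..R} t)
         = (ennreal (\<bar>t\<bar> powr (- (g * d))) * indicator {-R..R} t) * (ennreal (\<bar>p \<sigma>\<bar> powr (- g)) * indicator {-1..1} \<sigma>)"
        by (simp add: ennreal_mult ac_simps)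
    qed
    also have "\<dots> = (ennreal (\<bar>t\<bar> powr (- (g * d))) * indicator {-R..R} t) * I"
      unfolding I_def by (intro nn_integral_cmult) measurable
    also have "ennreal \<bar>t\<bar> * \<dots> = (ennreal (\<bar>t\<bar> * \<bar>t\<bar> powr (- (g * d))) * indicator {-R..R} t) * I"
      by (simp add: ennreal_mult ac_simps)
    also have "\<bar>t\<bar> * \<bar>t\<bar> powr (- (g * d)) = \<bar>t\<bar> powr (1 - g * d)"
      using t by (simp add: powr_diff powr_minus field_simps)
    finally show ?thesis by simp
  qed
  have "(\<integral>\<^sup>+t. \<integral>\<^sup>+s. ennreal (\<bar>F s t\<bar> powr (- g)) * (indicator {-\<bar>t\<bar>..\<bar>t\<bar>} s * indicator {-R..R} t) \<partial>lborel \<partial>lborel)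
      = (\<integral>\<^sup>+t. (ennreal (\<bar>t - 0\<bar> powr (1 - g * d)) * indicator {0 - R..0 + R} t) * I \<partial>lborel)"
    using AE_lborel_singleton[of 0] by (intro nn_integral_cong_AE, eventually_elim) (rule inner)
  also have "\<dots> = (\<integral>\<^sup>+t. ennreal (\<bar>t - 0\<bar> powr (1 - g * d)) * indicator {0 - R..0 + R} t \<partial>lborel) * I"
    by (intro nn_integral_multc) measurable
  also have "\<dots> < \<infinity>"
    using nn_integral_abs_powr_finite[of "1 - g * d" 0 R] gd fin
    unfolding I_def by (simp add: ennreal_mult_less_top)
  finally show ?thesis .
qed

lemma pencil_det_poly:
  fixes A B :: "real^'n^'n"
  obtains P where "\<And>s. poly P s = det (B + s *\<^sub>R A)"
proof -
  define P where "P = (\<Sum>\<pi> | \<pi> permutes (UNIV :: 'n set). [:of_int (sign \<pi>):] * (\<Prod>i\<in>UNIV. [:B $ i $ \<pi> i, A $ i $ \<pi> i:]))"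
  have "poly P s = det (B + s *\<^sub>R A)" for s
    by (simp add: P_def det_def poly_sum poly_prod)
  then show ?thesis by (rule that)
qed

lemma gram_det_commute: "gram_det A B = gram_det B A"
  by (simp add: gram_det_def inner_commute mult.commute)

lemma nn_integral_pencil_det_line_finite:
  fixes A B :: "real^'n^'n" and g :: real
  assumes sym: "transpose A = A" "transpose B = B"
    and c: "c > 0" and ge: "\<And>M. det M = 1 \<Longrightarrow> c \<le> gram_det (congr_matrix M A) (congr_matrix M B)"
    and g: "0 \<le> g" "g * CARD('n) < 2"
  shows "(\<integral>\<^sup>+s. ennreal (\<bar>det (B + s *\<^sub>R A)\<bar> powr (- g)) * indicator {-1..1} s \<partial>lborel) < \<infinity>"
proof -
  define T :: "real set" where "T = real ` {..CARD('n)}"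
  have T: "finite T" "card T > CARD('n)" by (simp_all add: T_def card_image)
  obtain K where K: "K > 0"
    "\<And>s h. h > 0 \<Longrightarrow> K * h powr (CARD('n) / 2) \<le> (\<Sum>\<sigma>\<in>T. \<bar>det (B + (s + \<sigma> * h) *\<^sub>R A)\<bar>)"
    using pencil_det_lower_bound[OF sym c ge T] by metis
  obtain P where P: "\<And>s. poly P s = det (B + s *\<^sub>R A)" using pencil_det_poly[of B A] by metis
  have lb: "K * h powr (CARD('n) / 2) \<le> (\<Sum>\<sigma>\<in>T. \<bar>poly P (s + \<sigma> * h)\<bar>)" if "h > 0" for s h
    using K(2)[OF that] by (simp only: P)
  note P0 = order_le_of_lower_bound(1)[OF K(1) lb] and ord = order_le_of_lower_bound(2)[OF K(1) lb]
  have "g * real (order x P) < 1" for x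
  proof -
    have "g * real (order x P) \<le> g * (CARD('n) / 2)" by (intro mult_left_mono ord g)
    with g(2) show ?thesis by simp
  qed
  from nn_integral_poly_powr_finite[OF P0 g(1) this, of "{-1..1}"] show ?thesis by (simp add: P)
qed

lemma det_pencil_measurable [measurable]:
  fixes A B :: "real^'n^'n"
  shows "(\<lambda>z::real \<times> real. det (fst z *\<^sub>R A + snd z *\<^sub>R B)) \<in> borel_measurable borel"
  by (intro borel_measurable_continuous_onI continuous_intros)

text \<open>The square is the union of two sectors, which are treated with the polynomials \<open>det (B + s A)\<close> and
  \<open>det (A + s B)\<close>. The second takes care of a root of the binary form at infinity.\<close>

lemma nn_integral_pencil_det_finite:
  fixes A B :: "real^'n^'n" and g :: real
  assumes sym: "transpose A = A" "transpose B = B"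
    and c: "c > 0" and ge: "\<And>M. det M = 1 \<Longrightarrow> c \<le> gram_det (congr_matrix M A) (congr_matrix M B)"
    and g: "0 \<le> g" "g * CARD('n) < 2"
  shows "(\<integral>\<^sup>+z. ennreal (\<bar>det (fst z *\<^sub>R A + snd z *\<^sub>R B)\<bar> powr (- g)) * indicator ({-R..R} \<times> {-R..R}) z \<partial>lborel) < \<infinity>"
proof -
  let ?F = "\<lambda>s t. det (s *\<^sub>R A + t *\<^sub>R B)"
  have F1: "(\<lambda>s. ?F s t) \<in> borel_measurable borel" and F2: "(\<lambda>s. ?F t s) \<in> borel_measurable borel" for t
    by (intro borel_measurable_continuous_onI continuous_intros)+
  let ?h1 = "\<lambda>s t. ennreal (\<bar>?F s t\<bar> powr (- g)) * (indicator {-\<bar>t\<bar>..\<bar>t\<bar>} s * indicator {-R..R} t)"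
  let ?h2 = "\<lambda>s t. ennreal (\<bar>?F s t\<bar> powr (- g)) * (indicator {-\<bar>s\<bar>..\<bar>s\<bar>} t * indicator {-R..R} s)"
  have m1: "(\<lambda>s. det (B + s *\<^sub>R A)) \<in> borel_measurable borel" "(\<lambda>s. det (A + s *\<^sub>R B)) \<in> borel_measurable borel"
    by (intro borel_measurable_continuous_onI continuous_intros)+
  have h1: "\<bar>?F (t * \<sigma>) t\<bar> = \<bar>t\<bar> powr real CARD('n) * \<bar>det (B + \<sigma> *\<^sub>R A)\<bar>" if "t \<noteq> 0" for t \<sigma>
  proof -
    have "(t * \<sigma>) *\<^sub>R A + t *\<^sub>R B = t *\<^sub>R (B + \<sigma> *\<^sub>R A)" by (simp add: algebra_simps)
    then show ?thesis using that by (simp add: det_scaleR abs_mult powr_realpow power_abs)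
  qed
  have h2: "\<bar>?F t (t * \<sigma>)\<bar> = \<bar>t\<bar> powr real CARD('n) * \<bar>det (A + \<sigma> *\<^sub>R B)\<bar>" if "t \<noteq> 0" for t \<sigma>
  proof -
    have "t *\<^sub>R A + (t * \<sigma>) *\<^sub>R B = t *\<^sub>R (A + \<sigma> *\<^sub>R B)" by (simp add: algebra_simps)
    then show ?thesis using that by (simp add: det_scaleR abs_mult powr_realpow power_abs)
  qed
  have fin1: "(\<integral>\<^sup>+t. \<integral>\<^sup>+s. ?h1 s t \<partial>lborel \<partial>lborel) < \<infinity>"
    by (rule nn_integral_homogeneous_sector_finite[OF m1(1) F1 h1 nn_integral_pencil_det_line_finite[OF sym c ge g] g(2)])
  have ge': "c \<le> gram_det (congr_matrix M B) (congr_matrix M A)" if "det M = 1" for M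
    using ge[OF that] by (simp only: gram_det_commute)
  have fin2: "(\<integral>\<^sup>+s. \<integral>\<^sup>+t. ?h2 s t \<partial>lborel \<partial>lborel) < \<infinity>"
    by (rule nn_integral_homogeneous_sector_finite[OF m1(2) F2 h2
          nn_integral_pencil_det_line_finite[OF sym(2,1) c ge' g] g(2)])
  have hm: "(\<lambda>z. ?h1 (fst z) (snd z)) \<in> borel_measurable borel" "(\<lambda>z. ?h2 (fst z) (snd z)) \<in> borel_measurable borel"
  proof -
    have sets: "{z::real \<times> real. \<bar>fst z\<bar> \<le> \<bar>snd z\<bar>} \<in> sets borel" "{z::real \<times> real. \<bar>snd z\<bar> \<le> \<bar>fst z\<bar>} \<in> sets borel"
      by (intro borel_closed closed_Collect_le continuous_intros)+
    have strips: "(UNIV :: real set) \<times> {-R..R} \<in> sets borel" "{-R..R} \<times> (UNIV :: real set) \<in> sets borel"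
      by (intro borel_closed closed_Times; simp)+
    have D: "(\<lambda>z. ennreal (\<bar>?F (fst z) (snd z)\<bar> powr (- g))) \<in> borel_measurable borel"
      by measurable
    have i: "indicator {-\<bar>t\<bar>..\<bar>t\<bar>} s = (indicator {z. \<bar>fst z\<bar> \<le> \<bar>snd z\<bar>} (s, t) :: ennreal)"
       "indicator {-\<bar>s\<bar>..\<bar>s\<bar>} t = (indicator {z. \<bar>snd z\<bar> \<le> \<bar>fst z\<bar>} (s, t) :: ennreal)"
       "indicator (UNIV \<times> {-R..R}) z = (indicator {-R..R} (snd z) :: ennreal)"
       "indicator ({-R..R} \<times> UNIV) z = (indicator {-R..R} (fst z) :: ennreal)" for s t :: real and z :: "real \<times> real"
      by (auto simp add: indicator_def abs_le_iff minus_le_iff mem_Times_iff)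
    have e1: "(\<lambda>z. ?h1 (fst z) (snd z)) = (\<lambda>z. ennreal (\<bar>?F (fst z) (snd z)\<bar> powr (- g))
        * (indicator {z. \<bar>fst z\<bar> \<le> \<bar>snd z\<bar>} z * indicator (UNIV \<times> {-R..R}) z))"
      by (simp only: i(1,3,4) prod.collapse)
    have e2: "(\<lambda>z. ?h2 (fst z) (snd z)) = (\<lambda>z. ennreal (\<bar>?F (fst z) (snd z)\<bar> powr (- g))
        * (indicator {z. \<bar>snd z\<bar> \<le> \<bar>fst z\<bar>} z * indicator ({-R..R} \<times> UNIV) z))"
      by (simp only: i(2,3,4) prod.collapse)
    show "(\<lambda>z. ?h1 (fst z) (snd z)) \<in> borel_measurable borel"
      by (subst e1, rule borel_measurable_times_ennreal[OF D borel_measurable_times_ennreal[OF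
            borel_measurable_indicator[OF sets(1)] borel_measurable_indicator[OF strips(1)]]])
    show "(\<lambda>z. ?h2 (fst z) (snd z)) \<in> borel_measurable borel"
      by (subst e2, rule borel_measurable_times_ennreal[OF D borel_measurable_times_ennreal[OF
            borel_measurable_indicator[OF sets(2)] borel_measurable_indicator[OF strips(2)]]])
  qed
  have "(\<integral>\<^sup>+z. ennreal (\<bar>?F (fst z) (snd z)\<bar> powr (- g)) * indicator ({-R..R} \<times> {-R..R}) z \<partial>lborel)
     \<le> (\<integral>\<^sup>+z. ?h1 (fst z) (snd z) + ?h2 (fst z) (snd z) \<partial>lborel)"
  proof (intro nn_integral_mono)
    fix z :: "real \<times> real"
    show "ennreal (\<bar>?F (fst z) (snd z)\<bar> powr (- g)) * indicator ({-R..R} \<times> {-R..R}) z \<le> ?h1 (fst z) (snd z) + ?h2 (fst z) (snd z)"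
    proof (cases "z \<in> {-R..R} \<times> {-R..R}")
      case True
      then have z: "snd z \<in> {-R..R}" "fst z \<in> {-R..R}" by auto
      show ?thesis
      proof (cases "\<bar>fst z\<bar> \<le> \<bar>snd z\<bar>")
        case True
        then have "fst z \<in> {-\<bar>snd z\<bar>..\<bar>snd z\<bar>}" by (simp add: abs_le_iff minus_le_iff)
        with z \<open>z \<in> _\<close> show ?thesis by simp
      next
        case False
        then have "snd z \<in> {-\<bar>fst z\<bar>..\<bar>fst z\<bar>}" by (auto simp: abs_if split: if_splits)
        with z \<open>z \<in> _\<close> show ?thesis by simp
      qed
    qed simp
  qed
  also have "\<dots> = (\<integral>\<^sup>+z. ?h1 (fst z) (snd z) \<partial>lborel) + (\<integral>\<^sup>+z. ?h2 (fst z) (snd z) \<partial>lborel)"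
    by (rule nn_integral_add; simp only: measurable_lborel1 measurable_lborel2; rule hm)
  also have "(\<integral>\<^sup>+z. ?h1 (fst z) (snd z) \<partial>lborel) = (\<integral>\<^sup>+t. \<integral>\<^sup>+s. ?h1 s t \<partial>lborel \<partial>lborel)"
    using lborel_pair.nn_integral_snd[of "\<lambda>z. ?h1 (fst z) (snd z)"] hm(1)
    by (simp only: lborel_prod fst_conv snd_conv measurable_lborel1 measurable_lborel2)
  also have "(\<integral>\<^sup>+z. ?h2 (fst z) (snd z) \<partial>lborel) = (\<integral>\<^sup>+s. \<integral>\<^sup>+t. ?h2 s t \<partial>lborel \<partial>lborel)"
    using lborel.nn_integral_fst[of "\<lambda>z. ?h2 (fst z) (snd z)" lborel] hm(2)
    by (simp only: lborel_prod fst_conv snd_conv measurable_lborel1 measurable_lborel2)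
  also have "(\<integral>\<^sup>+t. \<integral>\<^sup>+s. ?h1 s t \<partial>lborel \<partial>lborel) + (\<integral>\<^sup>+s. \<integral>\<^sup>+t. ?h2 s t \<partial>lborel \<partial>lborel) < \<infinity>"
    using fin1 fin2 by simp
  finally show ?thesis .
qed

section \<open>Hoelder's inequality for extended nonnegative functions\<close>

lemma ennreal_powr_ennreal: "0 \<le> r \<Longrightarrow> ennreal_powr (ennreal r) a = ennreal (r powr a)"
  by (simp add: ennreal_powr_def)

lemma ennreal_powr_top [simp]: "ennreal_powr \<infinity> a = \<infinity>" "ennreal_powr top a = \<infinity>"
  by (simp_all add: ennreal_powr_def)

lemma ennreal_powr_0 [simp]: "ennreal_powr 0 a = 0"
  by (simp add: ennreal_powr_def)

lemma ennreal_powr_1 [simp]: "ennreal_powr 1 a = 1" "ennreal_powr x 1 = x"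
  by (simp add: ennreal_powr_def, cases x) (simp_all add: ennreal_powr_ennreal)

lemma ennreal_powr_mono:
  assumes "x \<le> y" "0 < a" shows "ennreal_powr x a \<le> ennreal_powr y a"
  using assms by (cases x; cases y) (auto simp: ennreal_powr_ennreal powr_mono2 top_unique intro!: ennreal_leI)

lemma ennreal_powr_mult:
  assumes "0 < a" shows "ennreal_powr (x * y) a = ennreal_powr x a * ennreal_powr y a"
proof (cases x; cases y)
  fix r s :: real assume *: "0 \<le> r" "x = ennreal r" "0 \<le> s" "y = ennreal s"
  then show ?thesis
    by (simp add: ennreal_powr_ennreal powr_mult ennreal_mult[symmetric])
next
  fix r :: real assume *: "0 \<le> r" "x = ennreal r" "y = top"
  then show ?thesis
    by (cases "r = 0") (simp_all add: ennreal_powr_ennreal ennreal_mult_top)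
next
  fix r :: real assume *: "x = top" "0 \<le> r" "y = ennreal r"
  then show ?thesis
    by (cases "r = 0") (simp_all add: ennreal_powr_ennreal ennreal_top_mult)
qed simp

lemma ennreal_powr_powr: "ennreal_powr (ennreal_powr x a) b = ennreal_powr x (a * b)"
  by (cases x) (simp_all add: ennreal_powr_ennreal powr_powr)

lemma ennreal_powr_add: "ennreal_powr x (a + b) = ennreal_powr x a * ennreal_powr x b"
  by (cases x) (simp_all add: ennreal_powr_ennreal powr_add ennreal_mult)

lemma ennreal_powr_le_iff:
  assumes "0 < a" shows "ennreal_powr x a \<le> y \<longleftrightarrow> x \<le> ennreal_powr y (1 / a)"
proof
  assume "ennreal_powr x a \<le> y"
  then have "ennreal_powr (ennreal_powr x a) (1 / a) \<le> ennreal_powr y (1 / a)"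
    using assms by (intro ennreal_powr_mono) auto
  then show "x \<le> ennreal_powr y (1 / a)" using assms by (simp add: ennreal_powr_powr)
next
  assume "x \<le> ennreal_powr y (1 / a)"
  then have "ennreal_powr x a \<le> ennreal_powr (ennreal_powr y (1 / a)) a"
    using assms by (intro ennreal_powr_mono)
  then show "ennreal_powr x a \<le> y" using assms by (simp add: ennreal_powr_powr)
qed

text \<open>For positive exponents the power function is an order isomorphism, so it commutes with suprema; this
  is the half that monotone convergence needs.\<close>

lemma ennreal_powr_SUP:
  assumes "0 < a" shows "ennreal_powr (SUP i\<in>I. f i) a \<le> (SUP i\<in>I. ennreal_powr (f i) a)"
proof -
  have "f i \<le> ennreal_powr (SUP i\<in>I. ennreal_powr (f i) a) (1 / a)" if "i \<in> I" for i
    using that by (subst ennreal_powr_le_iff[OF assms, symmetric]) (rule SUP_upper)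
  then show ?thesis by (subst ennreal_powr_le_iff[OF assms]) (rule SUP_least)
qed

lemma ennreal_powr_measurable [measurable]:
  assumes [measurable]: "f \<in> borel_measurable M"
  shows "(\<lambda>x. ennreal_powr (f x) a) \<in> borel_measurable M"
  unfolding ennreal_powr_def by measurable

lemma ennreal_powr_eq_0_iff [simp]: "ennreal_powr x a = 0 \<longleftrightarrow> x = 0"
  by (cases x) (auto simp: ennreal_powr_ennreal)

lemma ennreal_powr_less_top [simp]: "ennreal_powr x a < top \<longleftrightarrow> x < top"
  by (cases x) (auto simp: ennreal_powr_ennreal)

lemma ennreal_powr_eq_top [simp]: "ennreal_powr x a = top \<longleftrightarrow> x = top"
  by (cases x) (auto simp: ennreal_powr_ennreal)

lemma ennreal_young:
  assumes a: "0 < a" "0 < b" "a + b = 1"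
  shows "ennreal_powr x a * ennreal_powr y b \<le> ennreal a * x + ennreal b * y"
proof (cases x; cases y)
  fix r s :: real assume *: "0 \<le> r" "x = ennreal r" "0 \<le> s" "y = ennreal s"
  have "r powr a * s powr b \<le> a * r + b * s"
  proof (cases "r = 0 \<or> s = 0")
    case False
    then show ?thesis using * a by (intro Youngs_inequality_0) auto
  qed (use * a in auto)
  then show ?thesis
    using * a by (simp add: ennreal_powr_ennreal ennreal_mult[symmetric] ennreal_plus[symmetric] ennreal_leI del: ennreal_plus)
qed (use a in \<open>auto simp: ennreal_mult_top\<close>)

text \<open>Only positive exponents occur, since \<open>ennreal_powr\<close> maps \<open>\<infinity>\<close> to \<open>\<infinity>\<close> and \<open>0\<close> to \<open>0\<close> for every exponent.\<close>

lemma nn_integral_Holder: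
  assumes [measurable]: "f \<in> borel_measurable M" "g \<in> borel_measurable M"
    and a: "0 < a" "0 < b" "a + b = 1"
  shows "(\<integral>\<^sup>+x. ennreal_powr (f x) a * ennreal_powr (g x) b \<partial>M)
     \<le> ennreal_powr (\<integral>\<^sup>+x. f x \<partial>M) a * ennreal_powr (\<integral>\<^sup>+x. g x \<partial>M) b"
proof -
  define F where "F = (\<integral>\<^sup>+x. f x \<partial>M)"
  define G where "G = (\<integral>\<^sup>+x. g x \<partial>M)"
  consider "F = 0" | "G = 0" | "F \<noteq> 0" "G \<noteq> 0" "F = top \<or> G = top"
    | "F \<noteq> 0" "G \<noteq> 0" "F \<noteq> top" "G \<noteq> top" by blast
  then show ?thesis
  proof cases
    case 1
    then have "AE x in M. f x = 0" by (simp add: F_def nn_integral_0_iff_AE)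
    then have "AE x in M. ennreal_powr (f x) a * ennreal_powr (g x) b = 0" by eventually_elim simp
    then have "(\<integral>\<^sup>+x. ennreal_powr (f x) a * ennreal_powr (g x) b \<partial>M) = (\<integral>\<^sup>+x. 0 \<partial>M)"
      by (rule nn_integral_cong_AE)
    then show ?thesis by simp
  next
    case 2
    then have "AE x in M. g x = 0" by (simp add: G_def nn_integral_0_iff_AE)
    then have "AE x in M. ennreal_powr (f x) a * ennreal_powr (g x) b = 0" by eventually_elim simp
    then have "(\<integral>\<^sup>+x. ennreal_powr (f x) a * ennreal_powr (g x) b \<partial>M) = (\<integral>\<^sup>+x. 0 \<partial>M)"
      by (rule nn_integral_cong_AE)
    then show ?thesis by simp
  next
    case 3
    then have "ennreal_powr F a * ennreal_powr G b = top"
      by (auto simp: ennreal_mult_eq_top_iff)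
    then show ?thesis by (simp add: F_def G_def)
  next
    case 4
    define c where "c = ennreal_powr F a * ennreal_powr G b"
    have "(\<integral>\<^sup>+x. ennreal_powr (f x) a * ennreal_powr (g x) b \<partial>M)
        \<le> (\<integral>\<^sup>+x. c * (ennreal a * (f x / F) + ennreal b * (g x / G)) \<partial>M)"
    proof (intro nn_integral_mono)
      fix x
      have "u = U * (u / U)" if "U \<noteq> 0" "U \<noteq> top" for u U :: ennreal
        using that by (metis ennreal_times_divide mult.commute mult_divide_eq_ennreal)
      then have split: "f x = F * (f x / F)" "g x = G * (g x / G)" using 4 by blast+
      have "ennreal_powr (f x) a * ennreal_powr (g x) b
         = ennreal_powr (F * (f x / F)) a * ennreal_powr (G * (g x / G)) b"
        by (simp only: split[symmetric])
      also have "\<dots> = c * (ennreal_powr (f x / F) a * ennreal_powr (g x / G) b)"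
        by (simp only: c_def ennreal_powr_mult[OF a(1)] ennreal_powr_mult[OF a(2)] ac_simps)
      also have "\<dots> \<le> c * (ennreal a * (f x / F) + ennreal b * (g x / G))"
        by (intro mult_left_mono ennreal_young a) auto
      finally show "ennreal_powr (f x) a * ennreal_powr (g x) b
         \<le> c * (ennreal a * (f x / F) + ennreal b * (g x / G))" .
    qed
    also have "\<dots> = c * (ennreal a * (F / F) + ennreal b * (G / G))"
      by (simp add: nn_integral_cmult nn_integral_add nn_integral_divide F_def G_def)
    also have "\<dots> = c * (ennreal a + ennreal b)"
      using 4 by (simp add: ennreal_divide_self less_top)
    also have "ennreal a + ennreal b = 1" using a by (simp add: ennreal_plus[symmetric] del: ennreal_plus)
    finally show ?thesis by (simp add: c_def F_def G_def)
  qed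
qed

lemma nn_integral_Holder3:
  assumes [measurable]: "X \<in> borel_measurable M" "Y \<in> borel_measurable M" "Z \<in> borel_measurable M"
    and a: "0 < a" "0 < b" "2 * a + b = 1"
  shows "(\<integral>\<^sup>+x. ennreal_powr (X x) a * ennreal_powr (Y x) a * ennreal_powr (Z x) b \<partial>M)
     \<le> ennreal_powr (\<integral>\<^sup>+x. X x \<partial>M) a * ennreal_powr (\<integral>\<^sup>+x. Y x \<partial>M) a * ennreal_powr (\<integral>\<^sup>+x. Z x \<partial>M) b"
proof -
  have "(\<integral>\<^sup>+x. ennreal_powr (X x) a * ennreal_powr (Y x) a * ennreal_powr (Z x) b \<partial>M)
     = (\<integral>\<^sup>+x. ennreal_powr (ennreal_powr (X x) (1/2) * ennreal_powr (Y x) (1/2)) (2 * a) * ennreal_powr (Z x) b \<partial>M)"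
    using a by (simp add: ennreal_powr_mult ennreal_powr_powr)
  also have "\<dots> \<le> ennreal_powr (\<integral>\<^sup>+x. ennreal_powr (X x) (1/2) * ennreal_powr (Y x) (1/2) \<partial>M) (2 * a)
      * ennreal_powr (\<integral>\<^sup>+x. Z x \<partial>M) b"
    by (intro nn_integral_Holder) (use a in auto)
  also have "\<dots> \<le> ennreal_powr (ennreal_powr (\<integral>\<^sup>+x. X x \<partial>M) (1/2) * ennreal_powr (\<integral>\<^sup>+x. Y x \<partial>M) (1/2)) (2 * a)
      * ennreal_powr (\<integral>\<^sup>+x. Z x \<partial>M) b"
    by (intro mult_right_mono ennreal_powr_mono nn_integral_Holder) (use a in auto)
  also have "\<dots> = ennreal_powr (\<integral>\<^sup>+x. X x \<partial>M) a * ennreal_powr (\<integral>\<^sup>+x. Y x \<partial>M) a * ennreal_powr (\<integral>\<^sup>+x. Z x \<partial>M) b"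
    using a by (simp add: ennreal_powr_mult ennreal_powr_powr)
  finally show ?thesis .
qed

section \<open>Iterated integrals, linear maps and the zero set of the discriminant\<close>

lemma nn_integral_lborel_Pair:
  fixes f :: "'a::euclidean_space \<times> 'b::euclidean_space \<Rightarrow> ennreal"
  assumes "f \<in> borel_measurable borel"
  shows "(\<integral>\<^sup>+w. f w \<partial>lborel) = (\<integral>\<^sup>+x. \<integral>\<^sup>+y. f (x, y) \<partial>lborel \<partial>lborel)"
  using lborel.nn_integral_fst[of f lborel] assms
  by (simp only: lborel_prod measurable_lborel1 measurable_lborel2)

lemma nn_integral_lborel_swap:
  fixes f :: "'a::euclidean_space \<Rightarrow> 'b::euclidean_space \<Rightarrow> ennreal"
  assumes "(\<lambda>w. f (fst w) (snd w)) \<in> borel_measurable borel"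
  shows "(\<integral>\<^sup>+x. \<integral>\<^sup>+y. f x y \<partial>lborel \<partial>lborel) = (\<integral>\<^sup>+y. \<integral>\<^sup>+x. f x y \<partial>lborel \<partial>lborel)"
  using lborel_pair.Fubini'[of f] assms
  by (simp only: lborel_prod measurable_lborel1 measurable_lborel2 split_beta')

lemma borel_measurable_nn_integral_lborel [measurable]:
  fixes f :: "'a::euclidean_space \<Rightarrow> 'b::euclidean_space \<Rightarrow> ennreal"
  assumes "(\<lambda>w. f (fst w) (snd w)) \<in> borel_measurable borel"
  shows "(\<lambda>x. \<integral>\<^sup>+y. f x y \<partial>lborel) \<in> borel_measurable borel"
  using lborel.borel_measurable_nn_integral_fst[of "\<lambda>w. f (fst w) (snd w)" lborel] assms
  by (simp only: lborel_prod measurable_lborel1 measurable_lborel2 fst_conv snd_conv)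

lemma nn_integral_lborel_translate:
  fixes f :: "'a::euclidean_space \<Rightarrow> ennreal"
  assumes "f \<in> borel_measurable borel"
  shows "(\<integral>\<^sup>+x. f (c + x) \<partial>lborel) = (\<integral>\<^sup>+x. f x \<partial>lborel)"
proof -
  have "(\<integral>\<^sup>+x. f x \<partial>lborel) = (\<integral>\<^sup>+x. f x \<partial>distr lborel borel ((+) c))" by (simp only: lborel_distr_plus)
  also have "\<dots> = (\<integral>\<^sup>+x. f (c + x) \<partial>lborel)" using assms by (subst nn_integral_distr) auto
  finally show ?thesis ..
qed

lemma AE_lborel_translate:
  fixes c :: "'a::euclidean_space"
  assumes "AE x in lborel. P x" and "{x. P x} \<in> sets borel"
  shows "AE x in lborel. P (c + x)"
proof -
  have "AE x in distr lborel borel ((+) c). P x" using assms(1) by (simp only: lborel_distr_plus)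
  then show ?thesis using assms(2) by (subst (asm) AE_distr_iff) auto
qed

lemma matrix_vector_mult_measurable [measurable]:
  fixes M :: "real^'n^'m" shows "(\<lambda>x. M *v x) \<in> borel_measurable borel"
  by (intro borel_measurable_continuous_onI matrix_vector_mult_linear_continuous_on)

text \<open>Shifting \<open>x\<close> along \<open>e\<^sub>m\<close> by \<open>t\<close> does not change the integral, so it may be averaged over \<open>t\<close> in the unit
  interval. For fixed \<open>x\<close> the shear is absorbed by a translation of \<open>t\<close>, and a second translation of \<open>x\<close>
  removes \<open>t\<close> from the argument of \<open>f\<close>.\<close>

lemma nn_integral_lborel_shear:
  fixes f :: "real^'n \<Rightarrow> ennreal"
  assumes f [measurable]: "f \<in> borel_measurable borel" and mn: "m \<noteq> n"
  shows "(\<integral>\<^sup>+x. f (x + (c * x $ n) *\<^sub>R axis m 1) \<partial>lborel) = (\<integral>\<^sup>+x. f x \<partial>lborel)"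
proof -
  let ?e = "axis m 1 :: real^'n"
  have fm: "(\<lambda>x. f (g x)) \<in> borel_measurable borel" if "continuous_on UNIV g" for g :: "'b::topological_space \<Rightarrow> real^'n"
    using measurable_compose[OF borel_measurable_continuous_onI[OF that] f] .
  have gm: "(\<lambda>x. indicator {0..1::real} (g x) :: ennreal) \<in> borel_measurable borel" if "continuous_on UNIV g" for g :: "'b::topological_space \<Rightarrow> real"
    by (rule measurable_compose[OF borel_measurable_continuous_onI[OF that] borel_measurable_indicator]) simp
  have one: "(\<integral>\<^sup>+t. indicator {0..1::real} (t - a) \<partial>lborel) = (1::ennreal)" for a :: real
  proof -
    have "(\<integral>\<^sup>+t. indicator {0..1::real} (t - a) \<partial>lborel) = (\<integral>\<^sup>+t. indicator {0..1::real} (a + t - a) \<partial>lborel :: ennreal)"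
      by (rule nn_integral_lborel_translate[symmetric, of "\<lambda>t. indicator {0..1::real} (t - a)"])
        (intro gm continuous_intros)
    also have "\<dots> = 1" by simp
    finally show ?thesis .
  qed
  have "(\<integral>\<^sup>+x. f (x + (c * x $ n) *\<^sub>R ?e) \<partial>lborel)
      = (\<integral>\<^sup>+t. indicator {0..1::real} (t - 0) \<partial>lborel) * (\<integral>\<^sup>+x. f (x + (c * x $ n) *\<^sub>R ?e) \<partial>lborel)"
    by (simp only: one mult_1)
  also have "\<dots> = (\<integral>\<^sup>+t. indicator {0..1::real} t * (\<integral>\<^sup>+x. f (x + (c * x $ n) *\<^sub>R ?e) \<partial>lborel) \<partial>lborel)"
    by (subst nn_integral_multc) auto
  also have "\<dots> = (\<integral>\<^sup>+t. \<integral>\<^sup>+x. indicator {0..1::real} t * f (x + (c * x $ n + t) *\<^sub>R ?e) \<partial>lborel \<partial>lborel)"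
  proof (rule nn_integral_cong)
    fix t :: real
    have "(\<integral>\<^sup>+x. f (x + (c * x $ n) *\<^sub>R ?e) \<partial>lborel)
       = (\<integral>\<^sup>+x. f ((t *\<^sub>R ?e + x) + (c * (t *\<^sub>R ?e + x) $ n) *\<^sub>R ?e) \<partial>lborel)"
      by (rule nn_integral_lborel_translate[symmetric, of "\<lambda>x. f (x + (c * x $ n) *\<^sub>R ?e)"])
        (intro fm continuous_intros)
    also have "\<dots> = (\<integral>\<^sup>+x. f (x + (c * x $ n + t) *\<^sub>R ?e) \<partial>lborel)"
      using mn by (simp add: axis_def algebra_simps)
    finally show "indicator {0..1::real} t * (\<integral>\<^sup>+x. f (x + (c * x $ n) *\<^sub>R ?e) \<partial>lborel)
       = (\<integral>\<^sup>+x. indicator {0..1::real} t * f (x + (c * x $ n + t) *\<^sub>R ?e) \<partial>lborel)"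
      by (subst nn_integral_cmult) (auto intro!: fm continuous_intros)
  qed
  also have "\<dots> = (\<integral>\<^sup>+x. \<integral>\<^sup>+t. indicator {0..1::real} t * f (x + (c * x $ n + t) *\<^sub>R ?e) \<partial>lborel \<partial>lborel)"
    by (rule nn_integral_lborel_swap) (intro borel_measurable_times_ennreal fm gm continuous_intros)
  also have "\<dots> = (\<integral>\<^sup>+x. \<integral>\<^sup>+t. indicator {0..1::real} (t - c * x $ n) * f (x + t *\<^sub>R ?e) \<partial>lborel \<partial>lborel)"
  proof (rule nn_integral_cong)
    fix x :: "real^'n"
    have "(\<integral>\<^sup>+t. indicator {0..1::real} (t - c * x $ n) * f (x + t *\<^sub>R ?e) \<partial>lborel)
      = (\<integral>\<^sup>+t. indicator {0..1::real} ((c * x $ n + t) - c * x $ n) * f (x + (c * x $ n + t) *\<^sub>R ?e) \<partial>lborel)"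
      by (rule nn_integral_lborel_translate[symmetric, of "\<lambda>t. indicator {0..1::real} (t - c * x $ n) * f (x + t *\<^sub>R ?e)"])
        (intro borel_measurable_times_ennreal fm gm continuous_intros)
    then show "(\<integral>\<^sup>+t. indicator {0..1::real} t * f (x + (c * x $ n + t) *\<^sub>R ?e) \<partial>lborel)
      = (\<integral>\<^sup>+t. indicator {0..1::real} (t - c * x $ n) * f (x + t *\<^sub>R ?e) \<partial>lborel)" by simp
  qed
  also have "\<dots> = (\<integral>\<^sup>+t. \<integral>\<^sup>+x. indicator {0..1::real} (t - c * x $ n) * f (x + t *\<^sub>R ?e) \<partial>lborel \<partial>lborel)"
    by (rule nn_integral_lborel_swap) (intro borel_measurable_times_ennreal fm gm continuous_intros)
  also have "\<dots> = (\<integral>\<^sup>+t. \<integral>\<^sup>+x. indicator {0..1::real} (t - c * x $ n) * f x \<partial>lborel \<partial>lborel)"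
  proof (rule nn_integral_cong)
    fix t :: real
    have "(\<integral>\<^sup>+x. indicator {0..1::real} (t - c * x $ n) * f (x + t *\<^sub>R ?e) \<partial>lborel)
      = (\<integral>\<^sup>+x. indicator {0..1::real} (t - c * ((- t) *\<^sub>R ?e + x) $ n) * f (((- t) *\<^sub>R ?e + x) + t *\<^sub>R ?e) \<partial>lborel)"
      by (rule nn_integral_lborel_translate[symmetric, of "\<lambda>x. indicator {0..1::real} (t - c * x $ n) * f (x + t *\<^sub>R ?e)"])
        (intro borel_measurable_times_ennreal fm gm continuous_intros)
    then show "(\<integral>\<^sup>+x. indicator {0..1::real} (t - c * x $ n) * f (x + t *\<^sub>R ?e) \<partial>lborel)
      = (\<integral>\<^sup>+x. indicator {0..1::real} (t - c * x $ n) * f x \<partial>lborel)"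
      using mn by (simp add: axis_def)
  qed
  also have "\<dots> = (\<integral>\<^sup>+x. \<integral>\<^sup>+t. indicator {0..1::real} (t - c * x $ n) * f x \<partial>lborel \<partial>lborel)"
    by (rule nn_integral_lborel_swap) (intro borel_measurable_times_ennreal fm gm continuous_intros)
  also have "\<dots> = (\<integral>\<^sup>+x. f x \<partial>lborel)"
    by (subst nn_integral_multc) (auto simp: one intro!: gm continuous_intros)
  finally show ?thesis .
qed

lemma nn_integral_lborel_diagonal:
  fixes f :: "real^'n \<Rightarrow> ennreal" and W :: "real^'n^'n"
  assumes f [measurable]: "f \<in> borel_measurable borel"
    and W: "\<And>i j. i \<noteq> j \<Longrightarrow> W $ i $ j = 0" and nz: "det W \<noteq> 0"
  shows "ennreal \<bar>det W\<bar> * (\<integral>\<^sup>+x. f (W *v x) \<partial>lborel) = (\<integral>\<^sup>+x. f x \<partial>lborel)"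
proof -
  have dW: "det W = (\<Prod>i\<in>UNIV. W $ i $ i)" by (rule det_diagonal) (rule W)
  have Wx: "(W *v x) $ i = W $ i $ i * x $ i" for x i
  proof -
    have "(W *v x) $ i = (\<Sum>j\<in>UNIV. W $ i $ j * x $ j)" by (simp add: matrix_vector_mult_def)
    also have "\<dots> = (\<Sum>j\<in>UNIV. if j = i then W $ i $ i * x $ i else 0)"
      by (rule sum.cong[OF refl]) (auto simp: W)
    finally show ?thesis by simp
  qed
  define c where "c j = j \<bullet> (W *v j)" for j
  have ca: "c (axis i 1) = W $ i $ i" for i
    by (simp add: c_def inner_axis' Wx)
  have B: "Basis = range (\<lambda>i. axis i 1 :: real^'n)" by (auto simp: Basis_vec_def)
  have inj: "inj (\<lambda>i. axis i 1 :: real^'n)" by (simp add: inj_def axis_eq_axis)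
  have c0: "c j \<noteq> 0" if "j \<in> Basis" for j
    using that nz by (auto simp: B ca dW)
  have T: "0 + (\<Sum>j\<in>Basis. (c j * (x \<bullet> j)) *\<^sub>R j) = W *v x" for x
    unfolding B sum.reindex[OF inj]
    by (simp add: vec_eq_iff Wx ca inner_axis) (simp add: axis_def if_distrib[where f = "\<lambda>x. _ * x"] cong: if_cong)
  have p: "(\<Prod>j\<in>Basis. \<bar>c j\<bar>) = \<bar>det W\<bar>"
    unfolding B prod.reindex[OF inj] by (simp add: ca dW abs_prod)
  have eq: "lborel = density (distr lborel borel (\<lambda>x. W *v x)) (\<lambda>_. ennreal \<bar>det W\<bar>)"
    using lborel_affine_euclidean[of c 0, OF c0] by (simp only: T p)
  have "(\<integral>\<^sup>+x. f x \<partial>lborel) = (\<integral>\<^sup>+x. f x \<partial>density (distr lborel borel (\<lambda>x. W *v x)) (\<lambda>_. ennreal \<bar>det W\<bar>))"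
    by (subst eq) simp
  also have "\<dots> = ennreal \<bar>det W\<bar> * (\<integral>\<^sup>+x. f (W *v x) \<partial>lborel)"
    by (simp add: nn_integral_density nn_integral_distr nn_integral_cmult)
  finally show ?thesis ..
qed

text \<open>By induction over elementary matrices; a transposition of coordinates is a product of three shears
  and a reflection.\<close>

lemma nn_integral_lborel_linear:
  fixes f :: "real^'n \<Rightarrow> ennreal" and M :: "real^'n^'n"
  assumes f: "f \<in> borel_measurable borel" and nz: "det M \<noteq> 0"
  shows "ennreal \<bar>det M\<bar> * (\<integral>\<^sup>+x. f (M *v x) \<partial>lborel) = (\<integral>\<^sup>+x. f x \<partial>lborel)"
  using nz f
proof (induction M arbitrary: f rule: induct_matrix_elementary)
  case (1 A B)
  have dA: "det A \<noteq> 0" and dB: "det B \<noteq> 0" using 1(3) by (auto simp: det_mul)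
  have fA: "(\<lambda>x. f (A *v x)) \<in> borel_measurable borel" using 1(4) by measurable
  have "ennreal \<bar>det (A ** B)\<bar> * (\<integral>\<^sup>+x. f ((A ** B) *v x) \<partial>lborel)
     = ennreal \<bar>det A\<bar> * (ennreal \<bar>det B\<bar> * (\<integral>\<^sup>+x. f (A *v (B *v x)) \<partial>lborel))"
    by (simp add: det_mul abs_mult ennreal_mult matrix_vector_mul_assoc mult.assoc)
  also have "\<dots> = (\<integral>\<^sup>+x. f x \<partial>lborel)"
    by (simp only: 1(2)[OF dB fA] 1(1)[OF dA 1(4)])
  finally show ?case .
next
  case (2 A i) then show ?case using det_zero_row(1) by blast
next
  case (3 A) then show ?case by (intro nn_integral_lborel_diagonal) auto
next
  case (4 m n)
  note f [measurable] = 4(3)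
  define W where "W = ((\<chi> i j. if i = j then (if i = n then - 1 else 1) else 0) :: real^'n^'n)"
  have W: "i \<noteq> j \<Longrightarrow> W $ i $ j = 0" for i j :: 'n by (simp add: W_def)
  have dW: "det W = (\<Prod>i\<in>UNIV. if i = n then - 1 else 1)"
    by (subst det_diagonal) (simp_all add: W_def)
  then have dW: "\<bar>det W\<bar> = 1" by (simp add: prod.If_cases)
  have Wx: "W *v x = (\<chi> i. if i = n then - x $ i else x $ i)" for x
    by (auto simp: W_def matrix_vector_mult_def vec_eq_iff if_distrib[where f = "\<lambda>x. x * _"] cong: if_cong)
  define sh where "sh k l c x = x + (c * x $ l) *\<^sub>R axis k 1" for k l :: 'n and c :: real and x :: "real^'n"
  have shI: "(\<integral>\<^sup>+x. g (sh k l c x) \<partial>lborel) = (\<integral>\<^sup>+x. g x \<partial>lborel)" if "k \<noteq> l" "g \<in> borel_measurable borel" for g k l c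
    unfolding sh_def using that by (intro nn_integral_lborel_shear)
  have [measurable]: "sh k l c \<in> borel_measurable borel" for k l c
    unfolding sh_def by (intro borel_measurable_continuous_onI continuous_intros)
  let ?S = "(\<chi> i j. mat 1 $ i $ Transposition.transpose m n j) :: real^'n^'n"
  have S: "?S *v x = W *v sh m n 1 (sh n m (- 1) (sh m n 1 x))" for x
  proof -
    have "(?S *v x) $ i = x $ Transposition.transpose m n i" for i
    proof -
      have "mat 1 $ i $ Transposition.transpose m n j * x $ j
          = (if j = Transposition.transpose m n i then x $ j else 0)" for j
        by (auto simp: mat_def Transposition.transpose_def)
      then show ?thesis by (simp add: matrix_vector_mult_def)
    qed
    then show ?thesis using 4(1)
      by (auto simp: Wx sh_def vec_eq_iff axis_def Transposition.transpose_def)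
  qed
  have dS: "\<bar>det ?S\<bar> = 1"
    using 4(1) det_permute_columns[OF permutes_swap_id[of m UNIV n], of "mat 1 :: real^'n^'n"]
    by (simp add: sign_swap_id)
  have "ennreal \<bar>det ?S\<bar> * (\<integral>\<^sup>+x. f (?S *v x) \<partial>lborel)
      = (\<integral>\<^sup>+x. f (W *v sh m n 1 (sh n m (- 1) (sh m n 1 x))) \<partial>lborel)"
    by (simp only: S dS) simp
  also have "\<dots> = (\<integral>\<^sup>+x. f (W *v x) \<partial>lborel)"
    using 4(1) shI[of m n "\<lambda>x. f (W *v sh m n 1 (sh n m (- 1) x))" 1]
      shI[of n m "\<lambda>x. f (W *v sh m n 1 x)" "- 1"] shI[of m n "\<lambda>x. f (W *v x)" 1]
    by simp
  also have "\<dots> = (\<integral>\<^sup>+x. f x \<partial>lborel)"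
    using nn_integral_lborel_diagonal[OF f W] dW by force
  finally show ?case .
next
  case (5 m n c)
  let ?S = "(\<chi> i j. if i = m \<and> j = n then c else of_bool (i = j)) :: real^'n^'n"
  have eq: "?S = mat 1 + c *\<^sub>R rank_one (axis m 1) (axis n 1)"
    using 5(1) by (auto simp: vec_eq_iff mat_def rank_one_def axis_def)
  have r: "rank_one (axis m 1) (axis n 1) *v x = x $ n *\<^sub>R axis m 1" for x :: "real^'n"
    by (auto simp: rank_one_def matrix_vector_mult_def vec_eq_iff axis_def if_distrib[where f = "\<lambda>x. x * _"] cong: if_cong)
  have "?S *v x = x + (c * x $ n) *\<^sub>R axis m 1" for x
    by (simp only: eq matrix_vector_mult_add_rdistrib scaleR_matrix_vector_assoc[symmetric] r matrix_vector_mul_lid scaleR_scaleR)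
  moreover have "det ?S = 1" unfolding eq by (rule det_shear_axis[OF 5(1)])
  ultimately show ?case using nn_integral_lborel_shear[OF 5(3,1), of c] by simp
qed

text \<open>A line \<open>t = const \<noteq> 0\<close> meets the zero set of the determinant in finitely many points.\<close>

lemma AE_pencil_det_nonzero:
  fixes A B :: "real^'n^'n"
  assumes sym: "transpose A = A" "transpose B = B"
    and c: "c > 0" and ge: "\<And>M. det M = 1 \<Longrightarrow> c \<le> gram_det (congr_matrix M A) (congr_matrix M B)"
  shows "AE z in lborel. det (fst z *\<^sub>R A + snd z *\<^sub>R B) \<noteq> 0"
proof -
  define T :: "real set" where "T = real ` {..CARD('n)}"
  have T: "finite T" "card T > CARD('n)" by (simp_all add: T_def card_image)
  obtain K where K: "K > 0"
    "\<And>s h. h > 0 \<Longrightarrow> K * h powr (CARD('n) / 2) \<le> (\<Sum>\<sigma>\<in>T. \<bar>det (B + (s + \<sigma> * h) *\<^sub>R A)\<bar>)"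
    using pencil_det_lower_bound[OF sym c ge T] by metis
  obtain P where P: "\<And>s. poly P s = det (B + s *\<^sub>R A)" using pencil_det_poly[of B A] by metis
  have lb: "K * h powr (CARD('n) / 2) \<le> (\<Sum>\<sigma>\<in>T. \<bar>poly P (s + \<sigma> * h)\<bar>)" if "h > 0" for s h
    using K(2)[OF that] by (simp only: P)
  have fin: "finite {s. poly P s = 0}" using order_le_of_lower_bound(1)[OF K(1) lb] by (rule poly_roots_finite)
  define Z where "Z = {z::real \<times> real. det (fst z *\<^sub>R A + snd z *\<^sub>R B) = 0}"
  have Zb: "Z \<in> sets borel" unfolding Z_def by (intro borel_closed closed_Collect_eq continuous_intros)
  have Zm: "(\<lambda>z. indicator Z z :: ennreal) \<in> borel_measurable borel" using Zb by simp
  have slice: "(\<integral>\<^sup>+s. indicator Z (s, t) \<partial>lborel) = (0::ennreal)" if t: "t \<noteq> 0" for t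
  proof -
    have "{s. (s, t) \<in> Z} \<subseteq> (\<lambda>\<sigma>. t * \<sigma>) ` {s. poly P s = 0}"
    proof
      fix s assume "s \<in> {s. (s, t) \<in> Z}"
      then have "det (s *\<^sub>R A + t *\<^sub>R B) = 0" by (simp add: Z_def)
      moreover have "s *\<^sub>R A + t *\<^sub>R B = t *\<^sub>R (B + (s / t) *\<^sub>R A)" using t by (simp add: algebra_simps)
      ultimately have "poly P (s / t) = 0" using t by (simp add: P det_scaleR)
      then show "s \<in> (\<lambda>\<sigma>. t * \<sigma>) ` {s. poly P s = 0}" using t by (intro image_eqI[of _ _ "s / t"]) auto
    qed
    then have "finite {s. (s, t) \<in> Z}" using fin finite_subset by blast
    then have "emeasure lborel {s. (s, t) \<in> Z} = 0" by (intro emeasure_lborel_countable countable_finite)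
    moreover have "indicator Z (s, t) = (indicator {s. (s, t) \<in> Z} s :: ennreal)" for s by (simp add: indicator_def)
    ultimately show ?thesis
      using \<open>finite {s. (s, t) \<in> Z}\<close> by (simp add: finite_imp_closed borel_closed)
  qed
  have "emeasure lborel Z = (\<integral>\<^sup>+z. indicator Z z \<partial>lborel)" using Zb by simp
  also have "\<dots> = (\<integral>\<^sup>+s. \<integral>\<^sup>+t. indicator Z (s, t) \<partial>lborel \<partial>lborel)" by (rule nn_integral_lborel_Pair[OF Zm])
  also have "\<dots> = (\<integral>\<^sup>+t. \<integral>\<^sup>+s. indicator Z (s, t) \<partial>lborel \<partial>lborel)"
    using Zm by (intro nn_integral_lborel_swap) simp
  also have "\<dots> = (\<integral>\<^sup>+(t::real). 0 \<partial>lborel)"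
    using AE_lborel_singleton[of "0::real"] by (intro nn_integral_cong_AE, eventually_elim) (rule slice)
  finally have "emeasure lborel Z = 0" by simp
  then have "Z \<in> null_sets lborel" using Zb by (simp add: null_sets_def)
  then show ?thesis by (rule AE_I') (auto simp: Z_def)
qed

section \<open>The estimate from L^p to L^(2p)\<close>

lemma borel_measurable_compose_continuous:
  assumes "f \<in> borel_measurable borel" "continuous_on UNIV g"
  shows "(\<lambda>w. f (g w)) \<in> borel_measurable borel"
  using measurable_compose[OF borel_measurable_continuous_onI[OF assms(2)] assms(1)] .

text \<open>Integration over all incident pairs of a point and a plane, in two orders.\<close>

lemma nn_integral_incidence:
  fixes g :: "real^'n \<Rightarrow> ennreal" and k :: "(real^'n) \<times> (real^'n) \<Rightarrow> ennreal" and V :: "real^'n^'n"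
  assumes g: "g \<in> borel_measurable borel" and k: "k \<in> borel_measurable borel"
  shows "(\<integral>\<^sup>+v. g (fst v - V *v snd v) * k v \<partial>lborel) = (\<integral>\<^sup>+y. g y * (\<integral>\<^sup>+\<xi>. k (y + V *v \<xi>, \<xi>) \<partial>lborel) \<partial>lborel)"
proof -
  note c = continuous_intros bounded_linear.continuous_on[OF matrix_vector_mul_bounded_linear]
  have "(\<integral>\<^sup>+v. g (fst v - V *v snd v) * k v \<partial>lborel)
      = (\<integral>\<^sup>+x. \<integral>\<^sup>+\<xi>. g (x - V *v \<xi>) * k (x, \<xi>) \<partial>lborel \<partial>lborel)"
    using nn_integral_lborel_Pair[of "\<lambda>v. g (fst v - V *v snd v) * k v"]
    by (simp add: borel_measurable_times_ennreal borel_measurable_compose_continuous[OF g] k c)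
  also have "\<dots> = (\<integral>\<^sup>+\<xi>. \<integral>\<^sup>+x. g (x - V *v \<xi>) * k (x, \<xi>) \<partial>lborel \<partial>lborel)"
    by (rule nn_integral_lborel_swap)
      (intro borel_measurable_times_ennreal borel_measurable_compose_continuous[OF g]
        borel_measurable_compose_continuous[OF k] c)
  also have "\<dots> = (\<integral>\<^sup>+\<xi>. \<integral>\<^sup>+y. g y * k (y + V *v \<xi>, \<xi>) \<partial>lborel \<partial>lborel)"
  proof (rule nn_integral_cong)
    fix \<xi> :: "real^'n"
    have "(\<integral>\<^sup>+x. g (x - V *v \<xi>) * k (x, \<xi>) \<partial>lborel)
        = (\<integral>\<^sup>+y. g ((V *v \<xi> + y) - V *v \<xi>) * k (V *v \<xi> + y, \<xi>) \<partial>lborel)"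
      by (rule nn_integral_lborel_translate[symmetric])
        (intro borel_measurable_times_ennreal borel_measurable_compose_continuous[OF g]
          borel_measurable_compose_continuous[OF k] c)
    then show "(\<integral>\<^sup>+x. g (x - V *v \<xi>) * k (x, \<xi>) \<partial>lborel)
       = (\<integral>\<^sup>+y. g y * k (y + V *v \<xi>, \<xi>) \<partial>lborel)" by (simp add: add.commute)
  qed
  also have "\<dots> = (\<integral>\<^sup>+y. \<integral>\<^sup>+\<xi>. g y * k (y + V *v \<xi>, \<xi>) \<partial>lborel \<partial>lborel)"
    by (rule nn_integral_lborel_swap)
      (intro borel_measurable_times_ennreal borel_measurable_compose_continuous[OF g]
        borel_measurable_compose_continuous[OF k] c)
  also have "\<dots> = (\<integral>\<^sup>+y. g y * (\<integral>\<^sup>+\<xi>. k (y + V *v \<xi>, \<xi>) \<partial>lborel) \<partial>lborel)"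
    by (intro nn_integral_cong nn_integral_cmult)
      (simp, intro borel_measurable_compose_continuous[OF k] c)
  finally show ?thesis .
qed

text \<open>For fixed parameters \<open>z\<close> and \<open>z'\<close> the map \<open>(x, \<xi>) \<mapsto> (x - V \<xi>, x - V' \<xi>)\<close> is linear with Jacobian
  \<open>\<bar>det (V - V')\<bar>\<close>. Equality holds unless this vanishes.\<close>

lemma nn_integral_two_planes_le:
  fixes g g' :: "real^'n \<Rightarrow> ennreal" and V V' :: "real^'n^'n"
  assumes g: "g \<in> borel_measurable borel" and g': "g' \<in> borel_measurable borel"
  shows "ennreal \<bar>det (V - V')\<bar> * (\<integral>\<^sup>+v. g (fst v - V *v snd v) * g' (fst v - V' *v snd v) \<partial>lborel)
     \<le> (\<integral>\<^sup>+y. g y \<partial>lborel) * (\<integral>\<^sup>+y. g' y \<partial>lborel)"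
proof (cases "det (V - V') = 0")
  case False
  note c = continuous_intros bounded_linear.continuous_on[OF matrix_vector_mul_bounded_linear]
  have k: "(\<lambda>v. g' (fst v - V' *v snd v)) \<in> borel_measurable borel"
    by (intro borel_measurable_compose_continuous[OF g'] c)
  have inner: "ennreal \<bar>det (V - V')\<bar> * (\<integral>\<^sup>+\<xi>. g' (y + V *v \<xi> - V' *v \<xi>) \<partial>lborel) = (\<integral>\<^sup>+y. g' y \<partial>lborel)" for y
  proof -
    have m: "(\<lambda>x. g' (y + x)) \<in> borel_measurable borel"
      by (intro borel_measurable_compose_continuous[OF g'] c)
    have "(\<integral>\<^sup>+\<xi>. g' (y + V *v \<xi> - V' *v \<xi>) \<partial>lborel) = (\<integral>\<^sup>+\<xi>. g' (y + (V - V') *v \<xi>) \<partial>lborel)"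
      by (simp add: matrix_vector_mult_diff_rdistrib add_diff_eq)
    then have "ennreal \<bar>det (V - V')\<bar> * (\<integral>\<^sup>+\<xi>. g' (y + V *v \<xi> - V' *v \<xi>) \<partial>lborel) = (\<integral>\<^sup>+x. g' (y + x) \<partial>lborel)"
      using nn_integral_lborel_linear[OF m False] by simp
    also have "\<dots> = (\<integral>\<^sup>+y. g' y \<partial>lborel)" by (rule nn_integral_lborel_translate[OF g'])
    finally show ?thesis .
  qed
  have mi: "(\<lambda>y. \<integral>\<^sup>+\<xi>. g' (y + V *v \<xi> - V' *v \<xi>) \<partial>lborel) \<in> borel_measurable borel"
    by (rule borel_measurable_nn_integral_lborel) (intro borel_measurable_compose_continuous[OF g'] c)
  have "ennreal \<bar>det (V - V')\<bar> * (\<integral>\<^sup>+v. g (fst v - V *v snd v) * g' (fst v - V' *v snd v) \<partial>lborel)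
     = ennreal \<bar>det (V - V')\<bar> * (\<integral>\<^sup>+y. g y * (\<integral>\<^sup>+\<xi>. g' (y + V *v \<xi> - V' *v \<xi>) \<partial>lborel) \<partial>lborel)"
    using nn_integral_incidence[OF g k, of V] by simp
  also have "\<dots> = (\<integral>\<^sup>+y. ennreal \<bar>det (V - V')\<bar> * (g y * (\<integral>\<^sup>+\<xi>. g' (y + V *v \<xi> - V' *v \<xi>) \<partial>lborel)) \<partial>lborel)"
    by (rule nn_integral_cmult[symmetric]) (simp, intro borel_measurable_times_ennreal g mi)
  also have "\<dots> = (\<integral>\<^sup>+y. g y * (\<integral>\<^sup>+y. g' y \<partial>lborel) \<partial>lborel)"
    by (simp only: mult.left_commute[of _ "g _"] inner)
  also have "\<dots> = (\<integral>\<^sup>+y. g y \<partial>lborel) * (\<integral>\<^sup>+y. g' y \<partial>lborel)"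
    using g by (intro nn_integral_multc) simp
  finally show ?thesis by simp
qed simp

abbreviation square :: "(real \<times> real) set" where "square \<equiv> {-1..1} \<times> {-1..1}"

definition plane_integral :: "(real \<times> real \<Rightarrow> real^'d^'d) \<Rightarrow> ((real^'d) \<times> real \<times> real \<Rightarrow> ennreal)
    \<Rightarrow> real^'d \<Rightarrow> real^'d \<Rightarrow> ennreal" where
  "plane_integral L f x \<xi> = (\<integral>\<^sup>+z. f (x - L z *v \<xi>, z) * indicator square z \<partial>lborel)"

lemma square_borel [measurable, simp]: "square \<in> sets borel"
  by (intro borel_closed closed_Times) auto

lemma emeasure_square: "emeasure lborel square = 4"
proof -
  have "emeasure lborel square = emeasure lborel {-1..1::real} * emeasure lborel {-1..1::real}"
    by (subst lborel_prod[symmetric], rule lborel.emeasure_pair_measure_Times) auto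
  then show ?thesis by (simp add: ennreal_mult[symmetric] del: ennreal_numeral) simp
qed

text \<open>In terms of the conjugate exponents \<open>1 / a\<close> and \<open>u\<close>, Hoelder's inequality below has weights \<open>a\<close>, \<open>a\<close>, \<open>b\<close>.\<close>

lemma powr_exponents:
  fixes p :: real
  assumes p: "p > 1"
  defines "a \<equiv> (p - 1) / (2 * p - 1)" and "b \<equiv> 1 / (2 * p - 1)" and "u \<equiv> (2 * p - 1) / p"
  shows "0 < a" "0 < b" "2 * a + b = 1" "u * a + u * b = 1" "(p - 1) / p * b = a / p"
    "(2 * p - 1) * a = p - 1" "b = 2 * a * (1 / (2 * (p - 1)))" "u = 1 + (p - 1) / p" "1 / p + (p - 1) / p = 1"
    "2 * a * (2 * p - 1) = 2 * (p - 1)"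
  using p unfolding a_def b_def u_def by (auto simp: field_simps)

text \<open>The algebra behind the choice of weights: in the product of the three factors the functions \<open>S\<close> and
  \<open>\<kappa>\<close> cancel. Here \<open>f1\<close>, \<open>f2\<close> stand for the values of \<open>f\<close> at two points of a plane, \<open>S1\<close>, \<open>S2\<close> for the
  values of the weight there, \<open>\<phi>\<close> for the value of the transform at the plane, and \<open>\<kappa>\<close> for the Jacobian.\<close>

lemma holder_weights_identity:
  fixes p :: real
  assumes p: "p > 1"
  defines "a \<equiv> (p - 1) / (2 * p - 1)" and "b \<equiv> 1 / (2 * p - 1)" and "u \<equiv> (2 * p - 1) / p" and "g \<equiv> 1 / (2 * (p - 1))"
  assumes nn: "0 \<le> f1" "0 \<le> f2" "0 \<le> \<phi>" and pos: "0 < S1" "0 < S2" "0 < \<kappa>"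
  shows "(f1 powr u * S1 powr (- (1 / p)) * (\<phi> powr (2 * p - 1)) * \<kappa> powr (- g)) powr a
      * (f2 powr u * S2 powr (- (1 / p)) * (\<phi> powr (2 * p - 1)) * \<kappa> powr (- g)) powr a
      * ((f1 powr u * S1 powr ((p - 1) / p)) * (f2 powr u * S2 powr ((p - 1) / p)) * \<kappa>) powr b
    = f1 * f2 * \<phi> powr (2 * p - 2)"
proof (cases "f1 = 0 \<or> f2 = 0 \<or> \<phi> = 0")
  case False
  note e = powr_exponents[OF p, folded a_def b_def u_def g_def]
  define x1 x2 s1 s2 y k where "x1 = ln f1" and "x2 = ln f2" and "s1 = ln S1" and "s2 = ln S2" and "y = ln \<phi>" and "k = ln \<kappa>"
  have ex: "f1 = exp x1" "f2 = exp x2" "S1 = exp s1" "S2 = exp s2" "\<phi> = exp y" "\<kappa> = exp k"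
    using False nn pos by (simp_all add: x1_def x2_def s1_def s2_def y_def k_def)
  have pw: "exp r powr q = exp (q * r)" for r q :: real by (simp add: powr_def)
  have "a * (u * x1 + - (1 / p) * s1 + (2 * p - 1) * y + - g * k) + a * (u * x2 + - (1 / p) * s2 + (2 * p - 1) * y + - g * k)
      + b * ((u * x1 + (p - 1) / p * s1) + (u * x2 + (p - 1) / p * s2) + k)
    = (u * a + u * b) * x1 + (u * a + u * b) * x2 + ((p - 1) / p * b - a / p) * (s1 + s2)
      + 2 * ((2 * p - 1) * a) * y + (b - 2 * a * g) * k"
    by (simp add: algebra_simps add_divide_distrib diff_divide_distrib)
  also have "\<dots> = x1 + x2 + (2 * p - 2) * y"
    unfolding e(4) e(5) e(6) e(7)[symmetric] by (simp add: algebra_simps)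
  finally show ?thesis
    unfolding ex pw exp_add[symmetric] by (simp only:)
qed (use p in auto)

text \<open>Insert the bound for \<open>j\<close> into the first inequality and solve for \<open>n\<close>: its exponent on the right is
  \<open>2 a = 1 - b < 1\<close>.\<close>

lemma holder_weights_conclusion:
  fixes p :: real
  assumes p: "p > 1"
  defines "a \<equiv> (p - 1) / (2 * p - 1)" and "b \<equiv> 1 / (2 * p - 1)"
  assumes nn: "0 < n" "0 \<le> D" "0 \<le> F" "0 \<le> j"
    and nj: "n \<le> (D * j) powr a * (D * j) powr a * (j * j) powr b"
    and jF: "j \<le> F powr (1 / p) * (2 * n) powr ((p - 1) / p)"
  shows "n \<le> (2 * D) powr (2 * (p - 1)) * F\<^sup>2"
proof -
  have D: "D > 0" and j: "j > 0" using nj nn by (auto simp: less_le)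
  have F: "F > 0" using jF j nn by (auto simp: less_le)
  have "ln n \<le> ln ((D * j) powr a * (D * j) powr a * (j * j) powr b)"
    using nj nn D j by (simp add: ln_le_cancel_iff)
  also have "\<dots> = 2 * a * ln D + (2 * a + 2 * b) * ln j"
    using D j by (simp add: ln_mult ln_powr algebra_simps)
  finally have 1: "ln n \<le> 2 * a * ln D + (2 * a + 2 * b) * ln j" .
  have "ln j \<le> ln (F powr (1 / p) * (2 * n) powr ((p - 1) / p))"
    using jF j F nn by (simp add: ln_le_cancel_iff)
  also have "\<dots> = 1 / p * ln F + (p - 1) / p * ln (2 * n)"
    using F nn by (simp add: ln_mult ln_powr)
  finally have "(2 * a + 2 * b) * ln j \<le> (2 * a + 2 * b) * (1 / p * ln F + (p - 1) / p * ln (2 * n))"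
    using p by (intro mult_left_mono) (auto simp: a_def b_def)
  also have "\<dots> = 2 * b * ln F + 2 * a * ln (2 * n)"
  proof -
    have ab: "a = (p - 1) * b" by (simp add: a_def b_def)
    have "(2 * a + 2 * b) * (1 / p) = 2 * b" "(2 * a + 2 * b) * ((p - 1) / p) = 2 * a"
      using p by (simp_all add: ab field_simps)
    then show ?thesis by (simp only: distrib_left mult.assoc[symmetric])
  qed
  finally have "ln n \<le> 2 * a * ln D + 2 * b * ln F + 2 * a * ln (2 * n)" using 1 by linarith
  then have "(2 * p - 1) * ln n \<le> (2 * p - 1) * (2 * a * ln D + 2 * b * ln F + 2 * a * ln (2 * n))"
    using p by (intro mult_left_mono) auto
  also have "\<dots> = 2 * ((2 * p - 1) * a) * ln D + 2 * ((2 * p - 1) * b) * ln F + 2 * ((2 * p - 1) * a) * ln (2 * n)"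
    by (simp only: distrib_left mult.assoc mult.left_commute)
  finally have "(2 * p - 1) * ln n \<le> 2 * (p - 1) * ln D + 2 * ln F + 2 * (p - 1) * ln (2 * n)"
    using p by (simp add: a_def b_def)
  then have "ln n \<le> 2 * (p - 1) * ln (2 * D) + 2 * ln F"
    using nn D by (simp add: ln_mult algebra_simps)
  also have "\<dots> = ln ((2 * D) powr (2 * (p - 1)) * F\<^sup>2)"
    using D F by (simp add: ln_mult ln_powr ln_realpow)
  finally show ?thesis using nn D F by (simp add: ln_le_cancel_iff)
qed

lemma nn_integral_const_ball_Times_finite:
  fixes E :: "'b::euclidean_space set"
  assumes "bounded E" "E \<in> sets borel"
  shows "(\<integral>\<^sup>+v. ennreal k * indicator (ball (0::'a::euclidean_space) r \<times> E) v \<partial>lborel) < top"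
proof -
  have "emeasure lborel (ball (0::'a) r \<times> E) = emeasure lborel (ball (0::'a) r) * emeasure lborel E"
    using assms by (subst lborel_prod[symmetric], intro lborel.emeasure_pair_measure_Times) auto
  also have "\<dots> < top"
    using emeasure_bounded_finite[OF assms(1)] emeasure_bounded_finite[OF bounded_ball, of "0::'a" r]
    by (simp add: ennreal_mult_less_top)
  finally have "emeasure lborel (ball (0::'a) r \<times> E) < top" .
  moreover have "ball (0::'a) r \<times> E \<in> sets lborel"
    using assms(2) by (auto simp: borel_prod[symmetric])
  ultimately show ?thesis
    by (subst nn_integral_cmult_indicator) (auto simp: ennreal_mult_less_top)
qed

text \<open>Planes \<open>{(x - L z \<xi>, z)}\<close> in \<open>\<real>\<^bsup>d+2\<^esup>\<close> with a linear map \<open>L\<close>. From here on the pencil enters only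
  through the linearity of \<open>L\<close> and the size of \<open>det (L z)\<close>.\<close>

locale plane_family =
  fixes L :: "real \<times> real \<Rightarrow> real^'d^'d"
  assumes linear: "linear L"
begin

lemma continuous_on_shift [continuous_intros]:
  assumes "continuous_on S b" "continuous_on S c"
  shows "continuous_on S (\<lambda>w. L (b w) *v c w)"
proof -
  have "continuous_on S (\<lambda>w. L (b w))"
    using assms(1) linear by (simp add: linear_linear bounded_linear.continuous_on)
  then show ?thesis unfolding matrix_vector_mult_def using assms(2) by (intro continuous_intros)
qed

lemma continuous_on_L [continuous_intros]:
  "continuous_on S b \<Longrightarrow> continuous_on S (\<lambda>w. L (b w))"
  using linear by (simp add: linear_linear bounded_linear.continuous_on)

lemma plane_integral_measurable:
  assumes f: "f \<in> borel_measurable borel"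
  shows "(\<lambda>v. plane_integral L f (fst v) (snd v)) \<in> borel_measurable borel"
  unfolding plane_integral_def
  by (intro borel_measurable_nn_integral_lborel borel_measurable_times_ennreal
      borel_measurable_compose_continuous[OF f]
      borel_measurable_compose_continuous[OF borel_measurable_indicator[OF square_borel]] continuous_intros)

lemma shift_bounded:
  assumes "bounded E"
  obtains R where "R > 0" "\<And>z \<xi>. z \<in> square \<Longrightarrow> \<xi> \<in> E \<Longrightarrow> norm (L z *v \<xi>) \<le> R"
proof -
  have "compact (square \<times> closure E)"
    using assms by (intro compact_Times) (auto simp: compact_closure)
  moreover have "continuous_on (square \<times> closure E) (\<lambda>w. L (fst w) *v snd w)"
    by (intro continuous_intros)
  ultimately have "bounded ((\<lambda>w. L (fst w) *v snd w) ` (square \<times> closure E))"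
    by (intro compact_imp_bounded compact_continuous_image)
  then obtain R where R: "R > 0" "\<forall>y\<in>(\<lambda>w. L (fst w) *v snd w) ` (square \<times> closure E). norm y \<le> R"
    unfolding bounded_pos by blast
  show ?thesis
  proof (rule that[OF R(1)])
    fix z \<xi> assume "z \<in> square" "\<xi> \<in> E"
    then have "(z, \<xi>) \<in> square \<times> closure E" using closure_subset by blast
    then show "norm (L z *v \<xi>) \<le> R" using R(2) by force
  qed
qed

lemma plane_integral_le:
  assumes "\<And>w. f w \<le> c"
  shows "plane_integral L f x \<xi> \<le> 4 * c"
proof -
  have "plane_integral L f x \<xi> \<le> (\<integral>\<^sup>+z. c * indicator square z \<partial>lborel)"
    unfolding plane_integral_def by (intro nn_integral_mono mult_right_mono assms) auto
  also have "\<dots> = c * emeasure lborel square" by (simp add: nn_integral_cmult_indicator)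
  also have "emeasure lborel square = 4" by (rule emeasure_square)
  finally show ?thesis by (simp add: mult.commute)
qed

lemma plane_integral_eq_0:
  assumes supp: "\<And>y z. norm y \<ge> C \<Longrightarrow> f (y, z) = 0"
    and R: "\<And>z. z \<in> square \<Longrightarrow> norm (L z *v \<xi>) \<le> R" and x: "norm x \<ge> C + R"
  shows "plane_integral L f x \<xi> = 0"
proof -
  have "f (x - L z *v \<xi>, z) * indicator square z = 0" for z
  proof (cases "z \<in> square")
    case True
    then have "norm (x - L z *v \<xi>) \<ge> C"
      using R[OF True] x norm_triangle_ineq2[of x "L z *v \<xi>"] by linarith
    then show ?thesis using supp by simp
  qed simp
  then show ?thesis unfolding plane_integral_def by (simp only: nn_integral_const mult_zero_left)
qed


text \<open>Boundedness and bounded support make all quantities finite, which is needed to solve the final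
  inequality for \<open>N\<close>. The weight \<open>S\<close> is the adjoint transform of \<open>\<Phi>\<^bsup>2p-1\<^esup>\<close>, increased by a constant \<open>\<epsilon>\<close>
  so that it can appear with a negative exponent; \<open>X\<close> is chosen such that integrating \<open>\<Phi>\<^bsup>2p-1\<^esup>\<close> over
  the planes through a point turns \<open>X\<close> into at most \<open>h = X S\<close>, the same function that appears in the third factor.\<close>

lemma plane_integral_bounded_estimate:
  fixes f :: "(real^'d) \<times> real \<times> real \<Rightarrow> real"
  assumes f [measurable]: "f \<in> borel_measurable borel" and f0: "\<And>w. 0 \<le> f w" and fc: "\<And>w. f w \<le> c"
    and supp: "\<And>y z. norm y \<ge> C \<Longrightarrow> f (y, z) = 0" "\<And>y z. z \<notin> square \<Longrightarrow> f (y, z) = 0"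
    and E [measurable]: "E \<in> sets borel" and bE: "bounded E"
    and p: "p > 1" and D0: "0 \<le> D"
    and D: "(\<integral>\<^sup>+z. ennreal (\<bar>det (L z)\<bar> powr (- (1 / (2 * (p - 1))))) * indicator ({-2..2} \<times> {-2..2}) z \<partial>lborel) \<le> ennreal D"
    and nz: "AE z in lborel. det (L z) \<noteq> 0"
  shows "(\<integral>\<^sup>+v. ennreal_powr (plane_integral L f (fst v) (snd v)) (2 * p) * indicator E (snd v) \<partial>lborel)
     \<le> ennreal ((2 * D) powr (2 * (p - 1))) * (\<integral>\<^sup>+w. ennreal (f w powr p) \<partial>lborel)\<^sup>2"
proof -
  define a where "a = (p - 1) / (2 * p - 1)"
  define b where "b = 1 / (2 * p - 1)"
  define u where "u = (2 * p - 1) / p"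
  define g where "g = 1 / (2 * (p - 1))"
  note e = powr_exponents[OF p, folded a_def b_def u_def g_def]
  have c0: "0 \<le> c" using f0 fc order_trans by blast
  obtain R where R: "R > 0" "\<And>z \<xi>. z \<in> square \<Longrightarrow> \<xi> \<in> E \<Longrightarrow> norm (L z *v \<xi>) \<le> R"
    using shift_bounded[OF bE] by blast
  have fm: "(\<lambda>w. ennreal (f w)) \<in> borel_measurable borel" by measurable
  define \<Phi> where "\<Phi> v = enn2real (plane_integral L (\<lambda>w. ennreal (f w)) (fst v) (snd v))" for v
  have Pc: "plane_integral L (\<lambda>w. ennreal (f w)) x \<xi> \<le> ennreal (4 * c)" for x \<xi>
    using plane_integral_le[of "\<lambda>w. ennreal (f w)" "ennreal c"] fc c0
    by (simp add: ennreal_leI ennreal_mult)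
  have P\<Phi>: "plane_integral L (\<lambda>w. ennreal (f w)) (fst v) (snd v) = ennreal (\<Phi> v)" for v
    using Pc[of "fst v" "snd v"] by (simp add: \<Phi>_def ennreal_enn2real_if) (metis ennreal_neq_top top_unique)
  have \<Phi>0: "0 \<le> \<Phi> v" for v by (simp add: \<Phi>_def)
  have \<Phi>c: "\<Phi> v \<le> 4 * c" for v
    using Pc[of "fst v" "snd v"] c0 unfolding P\<Phi> by (simp add: ennreal_le_iff)
  have \<Phi>m [measurable]: "\<Phi> \<in> borel_measurable borel"
    unfolding \<Phi>_def using plane_integral_measurable[OF fm] by measurable
  have \<Phi>supp: "\<Phi> v = 0" if "norm (fst v) \<ge> C + R" "snd v \<in> E" for v
    using plane_integral_eq_0[of C "\<lambda>w. ennreal (f w)" "snd v" R "fst v"] supp(1) R(2) that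
    by (simp add: \<Phi>_def)
  define P where "P e v = ennreal (\<Phi> v powr e) * indicator E (snd v)" for e v
  have iE: "(\<lambda>v. indicator E (snd v) :: ennreal) \<in> borel_measurable borel"
    by (rule borel_measurable_compose_continuous[OF borel_measurable_indicator[OF E]]) (intro continuous_intros)
  have Pm: "P e \<in> borel_measurable borel" for e
    unfolding P_def by (intro borel_measurable_times_ennreal iE) measurable
  define N where "N = (\<integral>\<^sup>+v. P (2 * p) v \<partial>lborel)"
  have Nfin: "N < top"
  proof -
    have "N \<le> (\<integral>\<^sup>+v. ennreal ((4 * c) powr (2 * p)) * indicator (ball (0::real^'d) (C + R) \<times> E) v \<partial>lborel)"
      unfolding N_def
    proof (rule nn_integral_mono)
      fix v :: "(real^'d) \<times> (real^'d)"
      show "P (2 * p) v \<le> ennreal ((4 * c) powr (2 * p)) * indicator (ball (0::real^'d) (C + R) \<times> E) v"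
      proof (cases "v \<in> ball (0::real^'d) (C + R) \<times> E")
        case True
        then show ?thesis using \<Phi>0[of v] \<Phi>c[of v] p
          by (auto simp: P_def mem_Times_iff intro!: ennreal_leI powr_mono2)
      next
        case False
        then have "snd v \<notin> E \<or> \<Phi> v = 0" using \<Phi>supp[of v] by (auto simp: mem_Times_iff)
        then show ?thesis by (auto simp: P_def)
      qed
    qed
    also have "\<dots> < top" by (rule nn_integral_const_ball_Times_finite[OF bE E])
    finally show ?thesis .
  qed
  have ffin: "(\<integral>\<^sup>+w. ennreal (f w powr k) \<partial>lborel) < top" if "k > 0" for k
  proof -
    have "(\<integral>\<^sup>+w. ennreal (f w powr k) \<partial>lborel) \<le> (\<integral>\<^sup>+w. ennreal (c powr k) * indicator (ball (0::real^'d) C \<times> square) w \<partial>lborel)"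
    proof (rule nn_integral_mono)
      fix w :: "(real^'d) \<times> real \<times> real"
      show "ennreal (f w powr k) \<le> ennreal (c powr k) * indicator (ball (0::real^'d) C \<times> square) w"
      proof (cases "w \<in> ball 0 C \<times> square")
        case True
        then show ?thesis using f0[of w] fc[of w] that by (simp add: ennreal_leI powr_mono2)
      next
        case False
        then have "f w = 0" using supp(1)[of "fst w" "snd w"] supp(2)[of "snd w" "fst w"] by (cases "norm (fst w) < C") (auto simp: mem_Times_iff simp del: mem_Sigma_iff)
        then show ?thesis by simp
      qed
    qed
    also have "\<dots> < top" by (rule nn_integral_const_ball_Times_finite) (auto intro: bounded_Times)
    finally show ?thesis .
  qed
  define m where "m = enn2real (\<integral>\<^sup>+w. ennreal (f w) \<partial>lborel)"
  have m: "(\<integral>\<^sup>+w. ennreal (f w) \<partial>lborel) = ennreal m" "0 \<le> m"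
    using ffin[of 1] f0 by (simp_all add: m_def)
  define Fp where "Fp = enn2real (\<integral>\<^sup>+w. ennreal (f w powr p) \<partial>lborel)"
  have Fp: "(\<integral>\<^sup>+w. ennreal (f w powr p) \<partial>lborel) = ennreal Fp" "0 \<le> Fp"
    using ffin[of p] p by (simp_all add: Fp_def)
  define n where "n = enn2real N"
  have n: "N = ennreal n" "0 \<le> n" using Nfin by (simp_all add: n_def)
  have goal: "n \<le> (2 * D) powr (2 * (p - 1)) * Fp\<^sup>2"
  proof (cases "n = 0")
    case True then show ?thesis by simp
  next
    case False
    then have n0: "n > 0" using n by simp
    \<comment> \<open>Small enough that the constant contributes at most \<open>n\<close> to the integral of \<open>f S\<close> (see \<open>fS\<close>).\<close>
    define \<epsilon> where "\<epsilon> = n / (m + 1)"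
    have \<epsilon>: "\<epsilon> > 0" "\<epsilon> * m \<le> n" using n0 m by (simp_all add: \<epsilon>_def field_simps)
    define Q where "Q w = (\<integral>\<^sup>+\<xi>. P (2 * p - 1) (fst w + L (snd w) *v \<xi>, \<xi>) \<partial>lborel)" for w
    have Qm: "Q \<in> borel_measurable borel"
      unfolding Q_def
      by (intro borel_measurable_nn_integral_lborel borel_measurable_compose_continuous[OF Pm] continuous_intros)
    have Qfin: "Q w < top" for w
    proof -
      have "Q w \<le> (\<integral>\<^sup>+\<xi>. ennreal ((4 * c) powr (2 * p - 1)) * indicator E \<xi> \<partial>lborel)"
        unfolding Q_def P_def snd_conv using p
        by (intro nn_integral_mono mult_right_mono ennreal_leI powr_mono2 \<Phi>0 \<Phi>c) simp_all
      also have "\<dots> < top"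
        using emeasure_bounded_finite[OF bE] by (subst nn_integral_cmult_indicator) (auto simp: ennreal_mult_less_top)
      finally show ?thesis .
    qed
    define S where "S w = enn2real (Q w) + \<epsilon>" for w
    have S0: "S w > 0" for w using \<epsilon> by (simp add: S_def add_nonneg_pos)
    have QS: "Q w \<le> ennreal (S w)" "ennreal (S w) = Q w + ennreal \<epsilon>" for w
      using Qfin[of w] \<epsilon> by (simp_all add: S_def ennreal_plus)
    have Sm [measurable]: "S \<in> borel_measurable borel" unfolding S_def using Qm by measurable
    define h where "h w = ennreal (f w powr u * S w powr ((p - 1) / p))" for w
    define X where "X w = ennreal (f w powr u * S w powr (- (1 / p)))" for w
    have hm: "h \<in> borel_measurable borel" and Xm: "X \<in> borel_measurable borel"
      unfolding h_def X_def by measurable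
    have XS: "X w * ennreal (S w) = h w" for w
    proof -
      have q: "(p - 1) / p = - (1 / p) + 1" using p by (simp add: field_simps)
      have "S w powr ((p - 1) / p) = S w powr (- (1 / p)) * S w"
        unfolding q powr_add using S0[of w] by simp
      then show ?thesis using S0[of w] f0[of w] unfolding X_def h_def
        by (simp add: ennreal_mult[symmetric] mult.assoc)
    qed
    define J where "J = (\<integral>\<^sup>+w. h w \<partial>lborel)"
    have Ln: "det (L z - L z') = det (L (z - z'))" for z z' using linear by (simp add: linear_diff)
    have dsym: "\<bar>det (L z' - L z)\<bar> = \<bar>det (L z - L z')\<bar>" for z z'
    proof -
      have "det ((- 1) *\<^sub>R (L z - L z')) = (- 1) ^ CARD('d) * det (L z - L z')" by (rule det_scaleR)
      then show ?thesis by (simp add: abs_mult power_abs)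
    qed
    define K where "K z z' = ennreal (\<bar>det (L z - L z')\<bar> powr (- g)) * indicator square z * indicator square z'" for z z'
    define sh1 where "sh1 t = (fst (fst t) - L (fst (snd t)) *v snd (fst t), fst (snd t))" for t :: "((real^'d) \<times> (real^'d)) \<times> (real \<times> real) \<times> (real \<times> real)"
    define sh2 where "sh2 t = (fst (fst t) - L (snd (snd t)) *v snd (fst t), snd (snd t))" for t :: "((real^'d) \<times> (real^'d)) \<times> (real \<times> real) \<times> (real \<times> real)"
    \<comment> \<open>\<open>G\<close> is the integrand of \<open>N\<close> after writing out two of the factors \<open>\<Phi>\<close>. The pairs with a singular
      difference are removed, since \<open>\<bar>0\<bar>\<close> to a negative power is \<open>0\<close> and would spoil the pointwise
      factorisation; they form a null set.\<close>
    define U where "U = {t :: ((real^'d) \<times> (real^'d)) \<times> (real \<times> real) \<times> (real \<times> real). det (L (fst (snd t)) - L (snd (snd t))) \<noteq> 0}"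
    \<comment> \<open>The three factors of Hoelder's inequality, with weights \<open>a\<close>, \<open>a\<close>, \<open>b\<close>.\<close>
    define A1 where "A1 t = X (sh1 t) * P (2 * p - 1) (fst t) * K (fst (snd t)) (snd (snd t))" for t
    define A2 where "A2 t = X (sh2 t) * P (2 * p - 1) (fst t) * K (snd (snd t)) (fst (snd t))" for t
    define A3 where "A3 t = h (sh1 t) * h (sh2 t) * ennreal \<bar>det (L (fst (snd t)) - L (snd (snd t)))\<bar>" for t
    define G where "G t = ennreal (f (sh1 t)) * ennreal (f (sh2 t)) * P (2 * p - 2) (fst t) * indicator U t" for t
    have shc: "continuous_on UNIV sh1" "continuous_on UNIV sh2"
      unfolding sh1_def sh2_def by (intro continuous_intros)+
    have Ub: "U \<in> sets borel"
      unfolding U_def by (intro borel_open open_Collect_neq continuous_intros)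
    have Km: "(\<lambda>t. K (q t) (r t)) \<in> borel_measurable borel"
      if q: "continuous_on UNIV q" "continuous_on UNIV r" for q r :: "'b::topological_space \<Rightarrow> real \<times> real"
    proof -
      have "(\<lambda>t. \<bar>det (L (q t) - L (r t))\<bar>) \<in> borel_measurable borel"
        by (intro borel_measurable_continuous_onI continuous_intros q)
      then have "(\<lambda>t. ennreal (\<bar>det (L (q t) - L (r t))\<bar> powr (- g))) \<in> borel_measurable borel"
        by measurable
      then show ?thesis unfolding K_def
        by (intro borel_measurable_times_ennreal borel_measurable_compose_continuous[OF borel_measurable_indicator[OF square_borel]] q)
    qed
    have dm: "(\<lambda>t. ennreal \<bar>det (L (q t) - L (r t))\<bar>) \<in> borel_measurable borel"
      if q: "continuous_on UNIV q" "continuous_on UNIV r" for q r :: "'b::topological_space \<Rightarrow> real \<times> real"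
      by (intro measurable_compose[OF _ measurable_ennreal] borel_measurable_continuous_onI continuous_intros q)
    note bc = borel_measurable_compose_continuous
    have A1m: "A1 \<in> borel_measurable borel" and A2m: "A2 \<in> borel_measurable borel"
      unfolding A1_def A2_def
      by (intro borel_measurable_times_ennreal bc[OF Xm] bc[OF Pm] Km shc continuous_intros)+
    have A3m: "A3 \<in> borel_measurable borel"
      unfolding A3_def by (intro borel_measurable_times_ennreal bc[OF hm] dm shc continuous_intros)
    have Gm: "G \<in> borel_measurable borel"
      unfolding G_def
      by (intro borel_measurable_times_ennreal bc[OF fm] bc[OF Pm] shc continuous_intros borel_measurable_indicator Ub)
    have T2: "(\<integral>\<^sup>+t. F t \<partial>lborel) = (\<integral>\<^sup>+v. \<integral>\<^sup>+z. \<integral>\<^sup>+z'. F (v, z, z') \<partial>lborel \<partial>lborel \<partial>lborel)"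
      and T1: "(\<integral>\<^sup>+t. F t \<partial>lborel) = (\<integral>\<^sup>+z. \<integral>\<^sup>+z'. \<integral>\<^sup>+v. F (v, z, z') \<partial>lborel \<partial>lborel \<partial>lborel)"
      if F: "F \<in> borel_measurable borel" for F :: "((real^'d) \<times> (real^'d)) \<times> (real \<times> real) \<times> (real \<times> real) \<Rightarrow> ennreal"
    proof -
      have "(\<integral>\<^sup>+y. F (v, y) \<partial>lborel) = (\<integral>\<^sup>+z. \<integral>\<^sup>+z'. F (v, z, z') \<partial>lborel \<partial>lborel)" for v
        by (rule nn_integral_lborel_Pair) (intro bc[OF F] continuous_intros)
      then show "(\<integral>\<^sup>+t. F t \<partial>lborel) = (\<integral>\<^sup>+v. \<integral>\<^sup>+z. \<integral>\<^sup>+z'. F (v, z, z') \<partial>lborel \<partial>lborel \<partial>lborel)"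
        using nn_integral_lborel_Pair[OF F] by simp
      have "(\<integral>\<^sup>+t. F t \<partial>lborel) = (\<integral>\<^sup>+y. \<integral>\<^sup>+v. F (v, y) \<partial>lborel \<partial>lborel)"
        unfolding nn_integral_lborel_Pair[OF F]
        by (rule nn_integral_lborel_swap) (intro bc[OF F] continuous_intros)
      also have "\<dots> = (\<integral>\<^sup>+z. \<integral>\<^sup>+z'. \<integral>\<^sup>+v. F (v, z, z') \<partial>lborel \<partial>lborel \<partial>lborel)"
        by (rule nn_integral_lborel_Pair)
          (intro borel_measurable_nn_integral_lborel bc[OF F] continuous_intros)
      finally show "(\<integral>\<^sup>+t. F t \<partial>lborel) = (\<integral>\<^sup>+z. \<integral>\<^sup>+z'. \<integral>\<^sup>+v. F (v, z, z') \<partial>lborel \<partial>lborel \<partial>lborel)" .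
    qed
    have zint: "(\<integral>\<^sup>+z. ennreal (f (fst v - L z *v snd v, z)) \<partial>lborel) = ennreal (\<Phi> v)" for v
    proof -
      have "ennreal (f (fst v - L z *v snd v, z)) = ennreal (f (fst v - L z *v snd v, z)) * indicator square z" for z
        using supp(2)[of z] by (cases "z \<in> square") simp_all
      then show ?thesis unfolding P\<Phi>[symmetric] plane_integral_def by simp
    qed
    have fvm: "(\<lambda>z. ennreal (f (fst v - L z *v snd v, z))) \<in> borel_measurable borel" for v
      by (intro bc[OF fm] continuous_intros)
    have NG: "N = (\<integral>\<^sup>+t. G t \<partial>lborel)"
    proof -
      have AEz: "AE z' in lborel. det (L z - L z') \<noteq> 0" for z
      proof -
        have "AE z' in lborel. det (L (- z + z')) \<noteq> 0"
          by (rule AE_lborel_translate[OF nz]) (intro borel_open open_Collect_neq continuous_intros)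
        then show ?thesis
        proof eventually_elim
          case (elim z')
          then have "\<bar>det (L z' - L z)\<bar> \<noteq> 0" using Ln[of z' z] by simp
          then show ?case using dsym[of z' z] by auto
        qed
      qed
      have i: "(\<integral>\<^sup>+z'. ennreal (f (fst v - L z' *v snd v, z')) * indicator U (v, z, z') \<partial>lborel) = ennreal (\<Phi> v)" for v z
      proof -
        have "(\<integral>\<^sup>+z'. ennreal (f (fst v - L z' *v snd v, z')) * indicator U (v, z, z') \<partial>lborel)
            = (\<integral>\<^sup>+z'. ennreal (f (fst v - L z' *v snd v, z')) \<partial>lborel)"
          using AEz[of z] by (intro nn_integral_cong_AE, eventually_elim) (simp add: U_def)
        then show ?thesis by (simp only: zint)
      qed
      have im: "(\<lambda>z'. ennreal (f (fst v - L z' *v snd v, z')) * indicator U (v, z, z')) \<in> borel_measurable borel" for v z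
        by (intro borel_measurable_times_ennreal fvm bc[OF borel_measurable_indicator[OF Ub]] continuous_intros)
      have "(\<integral>\<^sup>+z. \<integral>\<^sup>+z'. G (v, z, z') \<partial>lborel \<partial>lborel) = P (2 * p) v" for v
      proof -
        have "(\<integral>\<^sup>+z'. G (v, z, z') \<partial>lborel) = (P (2 * p - 2) v * ennreal (\<Phi> v)) * ennreal (f (fst v - L z *v snd v, z))" for z
        proof -
          have "(\<integral>\<^sup>+z'. G (v, z, z') \<partial>lborel) = (\<integral>\<^sup>+z'. (ennreal (f (fst v - L z *v snd v, z)) * P (2 * p - 2) v)
             * (ennreal (f (fst v - L z' *v snd v, z')) * indicator U (v, z, z')) \<partial>lborel)"
            by (simp add: G_def sh1_def sh2_def ac_simps)
          also have "\<dots> = (ennreal (f (fst v - L z *v snd v, z)) * P (2 * p - 2) v) * ennreal (\<Phi> v)"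
            unfolding i[symmetric, of v z] using im by (intro nn_integral_cmult) simp
          finally show ?thesis by (simp add: ac_simps)
        qed
        then have "(\<integral>\<^sup>+z. \<integral>\<^sup>+z'. G (v, z, z') \<partial>lborel \<partial>lborel)
           = (\<integral>\<^sup>+z. (P (2 * p - 2) v * ennreal (\<Phi> v)) * ennreal (f (fst v - L z *v snd v, z)) \<partial>lborel)" by simp
        also have "\<dots> = P (2 * p - 2) v * ennreal (\<Phi> v) * ennreal (\<Phi> v)"
          unfolding zint[symmetric] using fvm by (intro nn_integral_cmult) simp
        also have "\<dots> = P (2 * p) v"
        proof -
          have "\<Phi> v powr (2 * p - 2) * \<Phi> v * \<Phi> v = \<Phi> v powr (2 * p)"
          proof (cases "\<Phi> v = 0")
            case False
            then have "\<Phi> v powr (2 * p) = \<Phi> v powr (2 * p - 2) * \<Phi> v powr 1 * \<Phi> v powr 1"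
              unfolding powr_add[symmetric] by simp
            then show ?thesis using False \<Phi>0[of v] by simp
          qed simp
          then show ?thesis using \<Phi>0[of v]
            by (cases "snd v \<in> E") (simp_all add: P_def ennreal_mult[symmetric])
        qed
        finally show ?thesis .
      qed
      then show ?thesis unfolding N_def T2[OF Gm] by simp
    qed
    have Jz: "J = (\<integral>\<^sup>+z. \<integral>\<^sup>+y. h (y, z) \<partial>lborel \<partial>lborel)"
      unfolding J_def nn_integral_lborel_Pair[OF hm]
      by (rule nn_integral_lborel_swap) (intro bc[OF hm] continuous_intros)
    have hzm: "(\<lambda>y. h (y, z)) \<in> borel_measurable borel" "(\<lambda>z. \<integral>\<^sup>+y. h (y, z) \<partial>lborel) \<in> borel_measurable borel" for z
      by (intro borel_measurable_nn_integral_lborel bc[OF hm] continuous_intros)+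
    have A1J: "(\<integral>\<^sup>+t. A1 t \<partial>lborel) \<le> ennreal D * J"
    proof -
      have i: "(\<integral>\<^sup>+v. A1 (v, z, z') \<partial>lborel) \<le> (\<integral>\<^sup>+y. h (y, z) \<partial>lborel) * K z z'" for z z'
      proof -
        have Xz: "(\<lambda>y. X (y, z)) \<in> borel_measurable borel" by (intro bc[OF Xm] continuous_intros)
        have "(\<integral>\<^sup>+v. A1 (v, z, z') \<partial>lborel)
            = (\<integral>\<^sup>+v. X (fst v - L z *v snd v, z) * P (2 * p - 1) v \<partial>lborel) * K z z'"
          unfolding A1_def sh1_def fst_conv snd_conv
          by (rule nn_integral_multc) (simp, intro borel_measurable_times_ennreal bc[OF Xm] Pm continuous_intros)
        also have "(\<integral>\<^sup>+v. X (fst v - L z *v snd v, z) * P (2 * p - 1) v \<partial>lborel) = (\<integral>\<^sup>+y. X (y, z) * Q (y, z) \<partial>lborel)"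
          using nn_integral_incidence[OF Xz Pm, of "L z"] by (simp add: Q_def)
        also have "\<dots> \<le> (\<integral>\<^sup>+y. h (y, z) \<partial>lborel)"
          unfolding XS[symmetric] by (intro nn_integral_mono mult_left_mono QS) simp
        finally show ?thesis by (simp add: mult_right_mono)
      qed
      have Kz: "(\<integral>\<^sup>+z'. K z z' \<partial>lborel) \<le> ennreal D" for z
      proof -
        let ?k = "\<lambda>w. ennreal (\<bar>det (L w)\<bar> powr (- g)) * indicator ({-2..2} \<times> {-2..2}) w"
        have km: "?k \<in> borel_measurable borel"
        proof -
          have "(\<lambda>w. \<bar>det (L w)\<bar>) \<in> borel_measurable borel"
            by (intro borel_measurable_continuous_onI continuous_intros)
          then have "(\<lambda>w. ennreal (\<bar>det (L w)\<bar> powr (- g))) \<in> borel_measurable borel" by measurable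
          then show ?thesis
            by (intro borel_measurable_times_ennreal borel_measurable_indicator) (auto intro!: borel_closed closed_Times)
        qed
        have "(\<integral>\<^sup>+z'. K z z' \<partial>lborel) \<le> (\<integral>\<^sup>+z'. ?k (- z + z') \<partial>lborel)"
        proof (rule nn_integral_mono)
          fix z' :: "real \<times> real"
          have "\<bar>det (L (- z + z'))\<bar> = \<bar>det (L z - L z')\<bar>"
            using dsym[of z' z] Ln[of z' z] by simp
          moreover have "- z + z' \<in> {-2..2} \<times> {-2..2}" if "z \<in> square" "z' \<in> square"
            using that by (cases z; cases z') auto
          ultimately show "K z z' \<le> ?k (- z + z')"
            unfolding K_def by (cases "z \<in> square \<and> z' \<in> square") auto
        qed
        also have "\<dots> = (\<integral>\<^sup>+w. ?k w \<partial>lborel)" by (rule nn_integral_lborel_translate[OF km])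
        also have "\<dots> \<le> ennreal D" using D by (simp only: g_def)
        finally show ?thesis .
      qed
      have Kzm: "(\<lambda>z'. K z z') \<in> borel_measurable borel" for z by (intro Km continuous_intros)
      have "(\<integral>\<^sup>+t. A1 t \<partial>lborel) \<le> (\<integral>\<^sup>+z. \<integral>\<^sup>+z'. (\<integral>\<^sup>+y. h (y, z) \<partial>lborel) * K z z' \<partial>lborel \<partial>lborel)"
        unfolding T1[OF A1m] by (intro nn_integral_mono i)
      also have "\<dots> = (\<integral>\<^sup>+z. (\<integral>\<^sup>+y. h (y, z) \<partial>lborel) * (\<integral>\<^sup>+z'. K z z' \<partial>lborel) \<partial>lborel)"
        using Kzm by (intro nn_integral_cong nn_integral_cmult) simp
      also have "\<dots> \<le> (\<integral>\<^sup>+z. (\<integral>\<^sup>+y. h (y, z) \<partial>lborel) * ennreal D \<partial>lborel)"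
        by (intro nn_integral_mono mult_left_mono Kz) simp
      also have "\<dots> = J * ennreal D" unfolding Jz using hzm by (intro nn_integral_multc) simp
      finally show ?thesis by (simp add: mult.commute)
    qed
    have A2J: "(\<integral>\<^sup>+t. A2 t \<partial>lborel) \<le> ennreal D * J"
    proof -
      have "(\<integral>\<^sup>+t. A2 t \<partial>lborel) = (\<integral>\<^sup>+z. \<integral>\<^sup>+z'. \<integral>\<^sup>+v. A1 (v, z', z) \<partial>lborel \<partial>lborel \<partial>lborel)"
        unfolding T1[OF A2m] by (simp add: A1_def A2_def sh1_def sh2_def)
      also have "\<dots> = (\<integral>\<^sup>+z'. \<integral>\<^sup>+z. \<integral>\<^sup>+v. A1 (v, z', z) \<partial>lborel \<partial>lborel \<partial>lborel)"
        by (rule nn_integral_lborel_swap)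
          (intro borel_measurable_nn_integral_lborel bc[OF A1m] continuous_intros)
      also have "\<dots> = (\<integral>\<^sup>+t. A1 t \<partial>lborel)" by (simp only: T1[OF A1m])
      finally show ?thesis using A1J by simp
    qed
    have A3J: "(\<integral>\<^sup>+t. A3 t \<partial>lborel) \<le> J * J"
    proof -
      have i: "(\<integral>\<^sup>+v. A3 (v, z, z') \<partial>lborel) \<le> (\<integral>\<^sup>+y. h (y, z) \<partial>lborel) * (\<integral>\<^sup>+y. h (y, z') \<partial>lborel)" for z z'
      proof -
        have "(\<integral>\<^sup>+v. A3 (v, z, z') \<partial>lborel)
          = (\<integral>\<^sup>+v. h (fst v - L z *v snd v, z) * h (fst v - L z' *v snd v, z') \<partial>lborel) * ennreal \<bar>det (L z - L z')\<bar>"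
          unfolding A3_def sh1_def sh2_def fst_conv snd_conv
          by (rule nn_integral_multc) (simp, intro borel_measurable_times_ennreal bc[OF hm] continuous_intros)
        also have "\<dots> \<le> (\<integral>\<^sup>+y. h (y, z) \<partial>lborel) * (\<integral>\<^sup>+y. h (y, z') \<partial>lborel)"
          using nn_integral_two_planes_le[OF hzm(1) hzm(1), of "L z" "L z'" z z'] by (simp only: mult.commute)
        finally show ?thesis .
      qed
      have "(\<integral>\<^sup>+t. A3 t \<partial>lborel) \<le> (\<integral>\<^sup>+z. \<integral>\<^sup>+z'. (\<integral>\<^sup>+y. h (y, z) \<partial>lborel) * (\<integral>\<^sup>+y. h (y, z') \<partial>lborel) \<partial>lborel \<partial>lborel)"
        unfolding T1[OF A3m] by (intro nn_integral_mono i)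
      also have "\<dots> = (\<integral>\<^sup>+z. (\<integral>\<^sup>+y. h (y, z) \<partial>lborel) * J \<partial>lborel)"
        unfolding Jz using hzm by (intro nn_integral_cong nn_integral_cmult) simp
      also have "\<dots> = J * J" 
        using hzm by (subst (2) Jz) (intro nn_integral_multc, simp)
      finally show ?thesis .
    qed
    have pointwise: "G t \<le> ennreal_powr (A1 t) a * ennreal_powr (A2 t) a * ennreal_powr (A3 t) b" for t
    proof -
      define v z z' where "v = fst t" and "z = fst (snd t)" and "z' = snd (snd t)"
      note vz = v_def[symmetric] z_def[symmetric] z'_def[symmetric]
      have sh: "sh1 t = (fst v - L z *v snd v, z)" "sh2 t = (fst v - L z' *v snd v, z')"
        by (simp_all add: sh1_def sh2_def vz)
      consider "snd v \<notin> E" | "z \<notin> square" | "z' \<notin> square" | "t \<notin> U"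
        | "snd v \<in> E" "z \<in> square" "z' \<in> square" "t \<in> U" by blast
      then show ?thesis
      proof cases
        case 1 then show ?thesis by (simp add: G_def P_def vz)
      next
        case 2 then show ?thesis using supp(2)[OF 2] by (simp add: G_def sh)
      next
        case 3 then show ?thesis using supp(2)[OF 3] by (simp add: G_def sh)
      next
        case 4 then show ?thesis by (simp add: G_def)
      next
        case 5
        define \<kappa> where "\<kappa> = \<bar>det (L z - L z')\<bar>"
        have \<kappa>: "\<kappa> > 0" using 5(4) by (simp add: \<kappa>_def U_def vz)
        have \<kappa>': "\<bar>det (L z' - L z)\<bar> = \<kappa>" by (simp only: \<kappa>_def dsym[of z' z])
        let ?a1 = "f (sh1 t) powr u * S (sh1 t) powr (- (1 / p)) * (\<Phi> v powr (2 * p - 1)) * \<kappa> powr (- g)"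
        let ?a2 = "f (sh2 t) powr u * S (sh2 t) powr (- (1 / p)) * (\<Phi> v powr (2 * p - 1)) * \<kappa> powr (- g)"
        let ?a3 = "(f (sh1 t) powr u * S (sh1 t) powr ((p - 1) / p)) * (f (sh2 t) powr u * S (sh2 t) powr ((p - 1) / p)) * \<kappa>"
        have "A1 t = ennreal ?a1"
          unfolding A1_def vz K_def \<kappa>_def[symmetric] using 5 by (simp add: X_def P_def ennreal_mult)
        moreover have "A2 t = ennreal ?a2"
          unfolding A2_def vz K_def \<kappa>' using 5 by (simp add: X_def P_def ennreal_mult)
        moreover have "A3 t = ennreal ?a3"
          unfolding A3_def vz \<kappa>_def[symmetric] using \<kappa> by (simp add: h_def ennreal_mult)
        ultimately have "ennreal_powr (A1 t) a * ennreal_powr (A2 t) a * ennreal_powr (A3 t) b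
            = ennreal (?a1 powr a) * ennreal (?a2 powr a) * ennreal (?a3 powr b)"
          using \<kappa> by (simp add: ennreal_powr_ennreal)
        also have "\<dots> = ennreal (?a1 powr a * ?a2 powr a * ?a3 powr b)"
          by (simp only: ennreal_mult powr_ge_zero mult_nonneg_nonneg)
        also have "?a1 powr a * ?a2 powr a * ?a3 powr b = f (sh1 t) * f (sh2 t) * \<Phi> v powr (2 * p - 2)"
          using holder_weights_identity[OF p f0[of "sh1 t"] f0[of "sh2 t"] \<Phi>0[of v] S0[of "sh1 t"] S0[of "sh2 t"] \<kappa>]
          unfolding a_def b_def u_def g_def .
        also have "ennreal (f (sh1 t) * f (sh2 t) * \<Phi> v powr (2 * p - 2)) = G t"
          using 5 f0 by (simp add: G_def P_def vz ennreal_mult)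
        finally show ?thesis by simp
      qed
    qed
    have "N \<le> (\<integral>\<^sup>+t. ennreal_powr (A1 t) a * ennreal_powr (A2 t) a * ennreal_powr (A3 t) b \<partial>lborel)"
      unfolding NG by (intro nn_integral_mono pointwise)
    also have "\<dots> \<le> ennreal_powr (\<integral>\<^sup>+t. A1 t \<partial>lborel) a * ennreal_powr (\<integral>\<^sup>+t. A2 t \<partial>lborel) a * ennreal_powr (\<integral>\<^sup>+t. A3 t \<partial>lborel) b"
      by (rule nn_integral_Holder3[OF _ _ _ e(1,2,3)]) (simp_all only: measurable_lborel2 A1m A2m A3m)
    also have "\<dots> \<le> ennreal_powr (ennreal D * J) a * ennreal_powr (ennreal D * J) a * ennreal_powr (J * J) b"
      by (intro mult_mono ennreal_powr_mono A1J A2J A3J e(1,2)) simp_all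
    finally have NJ: "N \<le> ennreal_powr (ennreal D * J) a * ennreal_powr (ennreal D * J) a * ennreal_powr (J * J) b" .
    have fS: "(\<integral>\<^sup>+w. ennreal (f w) * ennreal (S w) \<partial>lborel) \<le> ennreal (2 * n)"
    proof -
      have "(\<integral>\<^sup>+w. ennreal (f w) * Q w \<partial>lborel) = N"
      proof -
        have fz: "(\<lambda>y. ennreal (f (y, z))) \<in> borel_measurable borel" for z by (intro bc[OF fm] continuous_intros)
        have "(\<integral>\<^sup>+w. ennreal (f w) * Q w \<partial>lborel) = (\<integral>\<^sup>+y. \<integral>\<^sup>+z. ennreal (f (y, z)) * Q (y, z) \<partial>lborel \<partial>lborel)"
          by (rule nn_integral_lborel_Pair) (intro borel_measurable_times_ennreal fm Qm)
        also have "\<dots> = (\<integral>\<^sup>+z. \<integral>\<^sup>+y. ennreal (f (y, z)) * Q (y, z) \<partial>lborel \<partial>lborel)"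
          by (rule nn_integral_lborel_swap) (intro borel_measurable_times_ennreal bc[OF fm] bc[OF Qm] continuous_intros)
        also have "\<dots> = (\<integral>\<^sup>+z. \<integral>\<^sup>+v. ennreal (f (fst v - L z *v snd v, z)) * P (2 * p - 1) v \<partial>lborel \<partial>lborel)"
        proof (rule nn_integral_cong)
          fix z :: "real \<times> real"
          show "(\<integral>\<^sup>+y. ennreal (f (y, z)) * Q (y, z) \<partial>lborel)
             = (\<integral>\<^sup>+v. ennreal (f (fst v - L z *v snd v, z)) * P (2 * p - 1) v \<partial>lborel)"
            using nn_integral_incidence[OF fz[of z] Pm, of "L z"] by (simp add: Q_def)
        qed
        also have "\<dots> = (\<integral>\<^sup>+v. \<integral>\<^sup>+z. ennreal (f (fst v - L z *v snd v, z)) * P (2 * p - 1) v \<partial>lborel \<partial>lborel)"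
          by (rule nn_integral_lborel_swap) (intro borel_measurable_times_ennreal bc[OF fm] bc[OF Pm] continuous_intros)
        also have "\<dots> = (\<integral>\<^sup>+v. P (2 * p) v \<partial>lborel)"
        proof (rule nn_integral_cong)
          fix v :: "(real^'d) \<times> (real^'d)"
          have "(\<integral>\<^sup>+z. ennreal (f (fst v - L z *v snd v, z)) * P (2 * p - 1) v \<partial>lborel)
             = ennreal (\<Phi> v) * P (2 * p - 1) v"
            unfolding zint[symmetric] using fvm by (intro nn_integral_multc) simp
          also have "\<dots> = P (2 * p) v"
          proof -
            have "\<Phi> v * \<Phi> v powr (2 * p - 1) = \<Phi> v powr (2 * p)"
              using \<Phi>0[of v] by (simp add: powr_mult_base)
            then show ?thesis using \<Phi>0[of v]
              by (cases "snd v \<in> E") (simp_all add: P_def ennreal_mult[symmetric])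
          qed
          finally show "(\<integral>\<^sup>+z. ennreal (f (fst v - L z *v snd v, z)) * P (2 * p - 1) v \<partial>lborel) = P (2 * p) v" .
        qed
        finally show ?thesis by (simp only: N_def)
      qed
      moreover have "(\<integral>\<^sup>+w. ennreal (f w) * ennreal (S w) \<partial>lborel)
          = (\<integral>\<^sup>+w. ennreal (f w) * Q w \<partial>lborel) + (\<integral>\<^sup>+w. ennreal (f w) * ennreal \<epsilon> \<partial>lborel)"
        unfolding QS(2) distrib_left
        by (rule nn_integral_add) (simp_all only: measurable_lborel2 borel_measurable_times_ennreal fm Qm borel_measurable_const)
      moreover have "(\<integral>\<^sup>+w. ennreal (f w) * ennreal \<epsilon> \<partial>lborel) = ennreal m * ennreal \<epsilon>"
        unfolding m(1)[symmetric] using fm by (intro nn_integral_multc) simp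
      ultimately have "(\<integral>\<^sup>+w. ennreal (f w) * ennreal (S w) \<partial>lborel) = ennreal (n + \<epsilon> * m)"
        using n m \<epsilon> by (simp add: ennreal_mult[symmetric] ennreal_plus[symmetric] mult.commute del: ennreal_plus)
      also have "\<dots> \<le> ennreal (2 * n)" using \<epsilon> by (intro ennreal_leI) simp
      finally show ?thesis .
    qed
    have JF: "J \<le> ennreal_powr (ennreal Fp) (1 / p) * ennreal_powr (ennreal (2 * n)) ((p - 1) / p)"
    proof -
      have hw: "h w = ennreal_powr (ennreal (f w powr p)) (1 / p) * ennreal_powr (ennreal (f w) * ennreal (S w)) ((p - 1) / p)" for w
      proof -
        have "ennreal_powr (ennreal (f w) * ennreal (S w)) ((p - 1) / p) = ennreal ((f w * S w) powr ((p - 1) / p))"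
          using f0[of w] S0[of w] by (simp add: ennreal_mult[symmetric] ennreal_powr_ennreal)
        moreover have "ennreal_powr (ennreal (f w powr p)) (1 / p) = ennreal (f w)"
          using f0[of w] p by (simp add: ennreal_powr_ennreal powr_powr)
        moreover have "f w powr u * S w powr ((p - 1) / p) = f w * (f w * S w) powr ((p - 1) / p)"
          using f0[of w] S0[of w] unfolding e(8) by (simp add: powr_mult powr_mult_base mult.assoc[symmetric])
        ultimately show ?thesis using f0[of w] by (simp add: h_def ennreal_mult)
      qed
      have "J \<le> ennreal_powr (\<integral>\<^sup>+w. ennreal (f w powr p) \<partial>lborel) (1 / p)
          * ennreal_powr (\<integral>\<^sup>+w. ennreal (f w) * ennreal (S w) \<partial>lborel) ((p - 1) / p)"
      proof -
        have m1: "(\<lambda>w. ennreal (f w powr p)) \<in> borel_measurable lborel" by measurable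
        have m2: "(\<lambda>w. ennreal (f w) * ennreal (S w)) \<in> borel_measurable lborel" by measurable
        show ?thesis unfolding J_def hw by (rule nn_integral_Holder[OF m1 m2 _ _ e(9)]) (use p in simp_all)
      qed
      also have "\<dots> \<le> ennreal_powr (ennreal Fp) (1 / p) * ennreal_powr (ennreal (2 * n)) ((p - 1) / p)"
        unfolding Fp(1) using p fS by (intro mult_mono ennreal_powr_mono) simp_all
      finally show ?thesis .
    qed
    define j where "j = enn2real J"
    have "J \<le> ennreal (Fp powr (1 / p) * (2 * n) powr ((p - 1) / p))"
      using JF Fp(2) n0 by (simp add: ennreal_powr_ennreal ennreal_mult[symmetric])
    then have "J < top" by (rule le_less_trans) simp
    then have J: "J = ennreal j" "0 \<le> j" by (simp_all add: j_def)
    show ?thesis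
    proof (rule holder_weights_conclusion[OF p n0 D0 Fp(2) J(2)])
      have "ennreal n \<le> ennreal ((D * j) powr a * (D * j) powr a * (j * j) powr b)"
        using NJ J(2) D0 unfolding J(1) n(1) by (simp add: ennreal_mult[symmetric] ennreal_powr_ennreal)
      then show "n \<le> (D * j) powr ((p - 1) / (2 * p - 1)) * (D * j) powr ((p - 1) / (2 * p - 1)) * (j * j) powr (1 / (2 * p - 1))"
        by (simp add: a_def b_def ennreal_le_iff)
      have "ennreal j \<le> ennreal (Fp powr (1 / p) * (2 * n) powr ((p - 1) / p))"
        using JF Fp(2) n0 unfolding J(1) by (simp add: ennreal_mult[symmetric] ennreal_powr_ennreal)
      then show "j \<le> Fp powr (1 / p) * (2 * n) powr ((p - 1) / p)"
        by (simp add: ennreal_le_iff)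
    qed
  qed
  have "(\<integral>\<^sup>+v. ennreal_powr (plane_integral L f (fst v) (snd v)) (2 * p) * indicator E (snd v) \<partial>lborel) = N"
    unfolding N_def P_def P\<Phi> using \<Phi>0 by (simp add: ennreal_powr_ennreal)
  also have "\<dots> \<le> ennreal ((2 * D) powr (2 * (p - 1)) * Fp\<^sup>2)"
    unfolding n(1) by (rule ennreal_leI[OF goal])
  also have "\<dots> = ennreal ((2 * D) powr (2 * (p - 1))) * (\<integral>\<^sup>+w. ennreal (f w powr p) \<partial>lborel)\<^sup>2"
    unfolding Fp(1) using Fp(2) by (simp add: ennreal_mult ennreal_power)
  finally show ?thesis .
qed

end

section \<open>Interpolation with the trivial estimate\<close>

context plane_family
begin

text \<open>Monotone convergence removes the boundedness of \<open>f\<close>.\<close>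

lemma plane_integral_estimate:
  fixes f :: "(real^'d) \<times> real \<times> real \<Rightarrow> real"
  assumes f [measurable]: "f \<in> borel_measurable borel" and f0: "\<And>w. 0 \<le> f w"
    and supp: "\<And>y z. norm y \<ge> C \<Longrightarrow> f (y, z) = 0" "\<And>y z. z \<notin> square \<Longrightarrow> f (y, z) = 0"
    and E: "E \<in> sets borel" and bE: "bounded E"
    and p: "p > 1" and D0: "0 \<le> D"
    and D: "(\<integral>\<^sup>+z. ennreal (\<bar>det (L z)\<bar> powr (- (1 / (2 * (p - 1))))) * indicator ({-2..2} \<times> {-2..2}) z \<partial>lborel) \<le> ennreal D"
    and nz: "AE z in lborel. det (L z) \<noteq> 0"
  shows "(\<integral>\<^sup>+v. ennreal_powr (plane_integral L f (fst v) (snd v)) (2 * p) * indicator E (snd v) \<partial>lborel)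
     \<le> ennreal ((2 * D) powr (2 * (p - 1))) * (\<integral>\<^sup>+w. ennreal (f w powr p) \<partial>lborel)\<^sup>2"
proof -
  define fn where "fn i w = min (f w) (real i)" for i w
  have fnm: "(\<lambda>w. ennreal (fn i w)) \<in> borel_measurable borel" "fn i \<in> borel_measurable borel" for i
    unfolding fn_def by measurable
  have inc: "fn i w \<le> fn j w" if "i \<le> j" for i j w using that by (simp add: fn_def)
  have supf: "(SUP i. ennreal (fn i w)) = ennreal (f w)" for w
  proof (rule antisym)
    show "(SUP i. ennreal (fn i w)) \<le> ennreal (f w)"
      by (intro SUP_least ennreal_leI) (simp add: fn_def)
    have "f w = fn (nat \<lceil>f w\<rceil>) w" by (simp add: fn_def min_def) linarith
    then show "ennreal (f w) \<le> (SUP i. ennreal (fn i w))" by (metis SUP_upper UNIV_I)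
  qed
  let ?T = "\<lambda>i x \<xi>. plane_integral L (\<lambda>w. ennreal (fn i w)) x \<xi>"
  have T: "plane_integral L f x \<xi> = (SUP i. ?T i x \<xi>)" for x \<xi>
  proof -
    have "plane_integral L f x \<xi> = (\<integral>\<^sup>+z. (SUP i. ennreal (fn i (x - L z *v \<xi>, z)) * indicator square z) \<partial>lborel)"
      unfolding plane_integral_def
    proof (rule nn_integral_cong)
      fix z
      show "ennreal (f (x - L z *v \<xi>, z)) * indicator square z
          = (SUP i. ennreal (fn i (x - L z *v \<xi>, z)) * indicator square z)"
        using supf[of "(x - L z *v \<xi>, z)"] by (cases "z \<in> square") (simp_all del: mem_Sigma_iff)
    qed
    also have "\<dots> = (SUP i. ?T i x \<xi>)"
      unfolding plane_integral_def
    proof (rule nn_integral_monotone_convergence_SUP)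
      show "incseq (\<lambda>i z. ennreal (fn i (x - L z *v \<xi>, z)) * indicator square z)"
        by (intro incseq_SucI le_funI mult_right_mono ennreal_leI inc) auto
      show "(\<lambda>z. ennreal (fn i (x - L z *v \<xi>, z)) * indicator square z) \<in> borel_measurable lborel" for i
        unfolding measurable_lborel2
        by (intro borel_measurable_times_ennreal borel_measurable_compose_continuous[OF fnm(1)]
            borel_measurable_indicator continuous_intros square_borel)
    qed
    finally show ?thesis .
  qed
  let ?V = "\<lambda>i v. ennreal_powr (?T i (fst v) (snd v)) (2 * p) * indicator E (snd v)"
  have Vm: "?V i \<in> borel_measurable borel" for i
    by (intro borel_measurable_times_ennreal ennreal_powr_measurable plane_integral_measurable[OF fnm(1)]
        borel_measurable_compose_continuous[OF borel_measurable_indicator[OF E]] continuous_intros)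
  have Tmono: "?T i x \<xi> \<le> ?T j x \<xi>" if "i \<le> j" for i j x \<xi>
    unfolding plane_integral_def by (intro nn_integral_mono mult_right_mono ennreal_leI inc that) simp
  have "(\<integral>\<^sup>+v. ennreal_powr (plane_integral L f (fst v) (snd v)) (2 * p) * indicator E (snd v) \<partial>lborel)
     \<le> (\<integral>\<^sup>+v. (SUP i. ?V i v) \<partial>lborel)"
  proof (rule nn_integral_mono)
    fix v :: "(real^'d) \<times> (real^'d)"
    have "ennreal_powr (plane_integral L f (fst v) (snd v)) (2 * p) \<le> (SUP i. ennreal_powr (?T i (fst v) (snd v)) (2 * p))"
      unfolding T using p by (intro ennreal_powr_SUP) simp
    then show "ennreal_powr (plane_integral L f (fst v) (snd v)) (2 * p) * indicator E (snd v) \<le> (SUP i. ?V i v)"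
      by (cases "snd v \<in> E") simp_all
  qed
  also have "\<dots> = (SUP i. \<integral>\<^sup>+v. ?V i v \<partial>lborel)"
  proof (rule nn_integral_monotone_convergence_SUP)
    show "incseq ?V"
      using p by (intro incseq_SucI le_funI mult_right_mono ennreal_powr_mono Tmono) auto
  qed (simp only: measurable_lborel2 Vm)
  also have "\<dots> \<le> ennreal ((2 * D) powr (2 * (p - 1))) * (\<integral>\<^sup>+w. ennreal (f w powr p) \<partial>lborel)\<^sup>2"
  proof (rule SUP_least)
    fix i
    have "(\<integral>\<^sup>+v. ?V i v \<partial>lborel) \<le> ennreal ((2 * D) powr (2 * (p - 1))) * (\<integral>\<^sup>+w. ennreal (fn i w powr p) \<partial>lborel)\<^sup>2"
      by (rule plane_integral_bounded_estimate[where c = "real i" and C = C, OF fnm(2) _ _ _ _ E bE p D0 D nz])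
        (use f0 supp in \<open>auto simp: fn_def\<close>)
    also have "\<dots> \<le> ennreal ((2 * D) powr (2 * (p - 1))) * (\<integral>\<^sup>+w. ennreal (f w powr p) \<partial>lborel)\<^sup>2"
      using f0 p by (intro mult_left_mono power_mono nn_integral_mono ennreal_leI powr_mono2) (auto simp: fn_def)
    finally show "(\<integral>\<^sup>+v. ?V i v \<partial>lborel) \<le> ennreal ((2 * D) powr (2 * (p - 1))) * (\<integral>\<^sup>+w. ennreal (f w powr p) \<partial>lborel)\<^sup>2" .
  qed
  finally show ?thesis .
qed

lemma plane_integrand_measurable:
  assumes k: "k \<in> borel_measurable borel"
  shows "(\<lambda>z. k (x - L z *v \<xi>, z) * indicator square z :: ennreal) \<in> borel_measurable borel"
  by (intro borel_measurable_times_ennreal borel_measurable_compose_continuous[OF k]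
      borel_measurable_indicator continuous_intros square_borel)

lemma nn_integral_plane_integral_le:
  assumes k: "k \<in> borel_measurable borel"
  shows "(\<integral>\<^sup>+x. plane_integral L k x \<xi> \<partial>lborel) \<le> (\<integral>\<^sup>+w. k w \<partial>lborel)"
proof -
  have "(\<integral>\<^sup>+x. plane_integral L k x \<xi> \<partial>lborel)
      \<le> (\<integral>\<^sup>+x. \<integral>\<^sup>+z. k (x - L z *v \<xi>, z) \<partial>lborel \<partial>lborel)"
    unfolding plane_integral_def by (intro nn_integral_mono) (simp add: indicator_def)
  also have "\<dots> = (\<integral>\<^sup>+z. \<integral>\<^sup>+x. k (x - L z *v \<xi>, z) \<partial>lborel \<partial>lborel)"
    by (rule nn_integral_lborel_swap) (intro borel_measurable_compose_continuous[OF k] continuous_intros)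
  also have "\<dots> = (\<integral>\<^sup>+z. \<integral>\<^sup>+y. k (y, z) \<partial>lborel \<partial>lborel)"
  proof (rule nn_integral_cong)
    fix z
    have "(\<integral>\<^sup>+y. k (y, z) \<partial>lborel) = (\<integral>\<^sup>+y. k (- (L z *v \<xi>) + y, z) \<partial>lborel)"
      by (rule nn_integral_lborel_translate[symmetric]) (intro borel_measurable_compose_continuous[OF k] continuous_intros)
    then show "(\<integral>\<^sup>+x. k (x - L z *v \<xi>, z) \<partial>lborel) = (\<integral>\<^sup>+y. k (y, z) \<partial>lborel)" by simp
  qed
  also have "\<dots> = (\<integral>\<^sup>+y. \<integral>\<^sup>+z. k (y, z) \<partial>lborel \<partial>lborel)"
    by (rule nn_integral_lborel_swap) (intro borel_measurable_compose_continuous[OF k] continuous_intros)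
  also have "\<dots> = (\<integral>\<^sup>+w. k w \<partial>lborel)" by (rule nn_integral_lborel_Pair[OF k, symmetric])
  finally show ?thesis .
qed

lemma plane_integral_Holder:
  assumes k: "k \<in> borel_measurable borel" "k' \<in> borel_measurable borel"
    and a: "0 < a" "0 < b" "a + b = 1"
  shows "plane_integral L (\<lambda>w. ennreal_powr (k w) a * ennreal_powr (k' w) b) x \<xi>
     \<le> ennreal_powr (plane_integral L k x \<xi>) a * ennreal_powr (plane_integral L k' x \<xi>) b"
proof -
  have "plane_integral L (\<lambda>w. ennreal_powr (k w) a * ennreal_powr (k' w) b) x \<xi>
     = (\<integral>\<^sup>+z. ennreal_powr (k (x - L z *v \<xi>, z) * indicator square z) a
          * ennreal_powr (k' (x - L z *v \<xi>, z) * indicator square z) b \<partial>lborel)"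
    unfolding plane_integral_def by (intro nn_integral_cong) (simp add: indicator_def)
  also have "\<dots> \<le> ennreal_powr (plane_integral L k x \<xi>) a * ennreal_powr (plane_integral L k' x \<xi>) b"
    unfolding plane_integral_def
    by (rule nn_integral_Holder[OF _ _ a]) (simp_all only: measurable_lborel2 plane_integrand_measurable k)
  finally show ?thesis .
qed

text \<open>The trivial bound from \<open>L\<^sup>p\<close> to \<open>L\<^sup>\<infinity>(L\<^sup>p)\<close>; the constant comes from the area \<open>4\<close> of the square.\<close>

lemma nn_integral_plane_integral_power_le:
  assumes k: "k \<in> borel_measurable borel" and p: "p > 1"
  shows "(\<integral>\<^sup>+x. ennreal_powr (plane_integral L k x \<xi>) p \<partial>lborel)
     \<le> ennreal (4 powr (p - 1)) * (\<integral>\<^sup>+w. ennreal_powr (k w) p \<partial>lborel)"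
proof -
  have kp: "(\<lambda>w. ennreal_powr (k w) p) \<in> borel_measurable borel" using k by measurable
  have "ennreal_powr (plane_integral L k x \<xi>) p
      \<le> ennreal (4 powr (p - 1)) * plane_integral L (\<lambda>w. ennreal_powr (k w) p) x \<xi>" for x
  proof -
    have "plane_integral L k x \<xi>
       = plane_integral L (\<lambda>w. ennreal_powr (ennreal_powr (k w) p) (1 / p) * ennreal_powr 1 (1 - 1 / p)) x \<xi>"
      using p by (simp add: ennreal_powr_powr)
    also have "\<dots> \<le> ennreal_powr (plane_integral L (\<lambda>w. ennreal_powr (k w) p) x \<xi>) (1 / p)
        * ennreal_powr (plane_integral L (\<lambda>w. 1) x \<xi>) (1 - 1 / p)"
      using p by (intro plane_integral_Holder kp) auto
    also have "plane_integral L (\<lambda>w. 1) x \<xi> = ennreal 4"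
      by (simp add: plane_integral_def emeasure_square)
    finally have "ennreal_powr (plane_integral L k x \<xi>) p
       \<le> ennreal_powr (ennreal_powr (plane_integral L (\<lambda>w. ennreal_powr (k w) p) x \<xi>) (1 / p)
        * ennreal_powr (ennreal 4) (1 - 1 / p)) p"
      using p by (intro ennreal_powr_mono) auto
    also have "\<dots> = plane_integral L (\<lambda>w. ennreal_powr (k w) p) x \<xi> * ennreal (4 powr (p - 1))"
    proof -
      have "(4 powr (1 - 1 / p)) powr p = (4::real) powr (p - 1)"
        using p by (simp add: powr_powr left_diff_distrib)
      then show ?thesis
        using p by (simp add: ennreal_powr_mult ennreal_powr_powr ennreal_powr_ennreal del: ennreal_numeral)
    qed
    finally show ?thesis by (simp add: mult.commute)
  qed
  then have "(\<integral>\<^sup>+x. ennreal_powr (plane_integral L k x \<xi>) p \<partial>lborel)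
     \<le> (\<integral>\<^sup>+x. ennreal (4 powr (p - 1)) * plane_integral L (\<lambda>w. ennreal_powr (k w) p) x \<xi> \<partial>lborel)"
    by (intro nn_integral_mono)
  also have "\<dots> = ennreal (4 powr (p - 1)) * (\<integral>\<^sup>+x. plane_integral L (\<lambda>w. ennreal_powr (k w) p) x \<xi> \<partial>lborel)"
    using borel_measurable_compose_continuous[OF plane_integral_measurable[OF kp], of "\<lambda>x. (x, \<xi>)"]
    by (intro nn_integral_cmult) (simp add: continuous_intros)
  also have "\<dots> \<le> ennreal (4 powr (p - 1)) * (\<integral>\<^sup>+w. ennreal_powr (k w) p \<partial>lborel)"
    by (intro mult_left_mono nn_integral_plane_integral_le kp) simp
  finally show ?thesis .
qed

text \<open>In the plane of the pairs \<open>(1/p, 1/r)\<close> the point lies on the segment from \<open>(1, 1)\<close> to \<open>(1/s, 1/(2s))\<close>,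
  which determines \<open>s\<close>, and \<open>\<theta>\<close> is the weight of \<open>(1, 1)\<close>. Correspondingly \<open>f\<close> is the product of powers of
  \<open>f\<^sup>p\<close>, to which the trivial bound applies for each \<open>\<xi>\<close>, and of \<open>f\<^bsup>p/s\<^esup>\<close>, to which the estimate from
  \<open>L\<^sup>s\<close> to \<open>L\<^bsup>2s\<^esup>\<close> applies.\<close>

lemma plane_integral_interpolated:
  fixes f :: "(real^'d) \<times> real \<times> real \<Rightarrow> real"
  assumes f [measurable]: "f \<in> borel_measurable borel" and f0: "\<And>w. 0 \<le> f w"
    and supp: "\<And>y z. norm y \<ge> C \<Longrightarrow> f (y, z) = 0" "\<And>y z. z \<notin> square \<Longrightarrow> f (y, z) = 0"
    and E [measurable]: "E \<in> sets borel" and bE: "bounded E"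
    and p: "1 < p" "p < r" "r \<le> 2 * p" and s: "s = (1 - 2 / r + 1 / p) / (2 * (1 / p - 1 / r))"
    and D0: "0 \<le> D"
    and D: "(\<integral>\<^sup>+z. ennreal (\<bar>det (L z)\<bar> powr (- (1 / (2 * (s - 1))))) * indicator ({-2..2} \<times> {-2..2}) z \<partial>lborel) \<le> ennreal D"
    and nz: "AE z in lborel. det (L z) \<noteq> 0"
    and q: "q = 1 / (1 / p - 1 / r)"
  shows "(\<integral>\<^sup>+\<xi>. ennreal_powr (\<integral>\<^sup>+x. ennreal_powr (plane_integral L f x \<xi>) r \<partial>lborel) (q / r) * indicator E \<xi> \<partial>lborel)
     \<le> ennreal ((2 * D) powr (2 * (s - 1))) * ennreal_powr (\<integral>\<^sup>+w. ennreal (f w powr p) \<partial>lborel) (q / p)"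
proof -
  define \<alpha> where "\<alpha> = 2 - r / p"
  define \<theta> where "\<theta> = 2 / r - 1 / p"
  have r: "r > 1" using p by simp
  have rp: "1 / p - 1 / r > 0" using p by (simp add: divide_strict_left_mono)
  have q0: "q > 0" using rp by (simp add: q)
  have s1: "s > 1"
  proof -
    have "2 * (1 / p - 1 / r) < 1 - 2 / r + 1 / p" using p by (simp add: field_simps)
    then show ?thesis using rp by (simp add: s)
  qed
  define F where "F = (\<integral>\<^sup>+w. ennreal (f w powr p) \<partial>lborel)"
  define f3 where "f3 w = f w powr (p / s)" for w
  have fp: "(\<lambda>w. ennreal (f w powr p)) \<in> borel_measurable borel"
    and f3m: "f3 \<in> borel_measurable borel" "(\<lambda>w. ennreal (f3 w)) \<in> borel_measurable borel"
    and fm: "(\<lambda>w. ennreal (f w)) \<in> borel_measurable borel"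
    unfolding f3_def by measurable
  let ?T3 = "plane_integral L (\<lambda>w. ennreal (f3 w))"
  have T3m: "(\<lambda>v. ennreal_powr (?T3 (fst v) (snd v)) (2 * s)) \<in> borel_measurable borel"
    by (intro ennreal_powr_measurable plane_integral_measurable f3m)
  have f3s: "f3 w powr s = f w powr p" for w using s1 by (simp add: f3_def powr_powr)
  have key: "(\<integral>\<^sup>+\<xi>. (\<integral>\<^sup>+x. ennreal_powr (?T3 x \<xi>) (2 * s) \<partial>lborel) * indicator E \<xi> \<partial>lborel)
      \<le> ennreal ((2 * D) powr (2 * (s - 1))) * F\<^sup>2"
  proof -
    have iE: "(\<lambda>v. indicator E (snd v) :: ennreal) \<in> borel_measurable borel"
      by (rule borel_measurable_compose_continuous[OF borel_measurable_indicator[OF E]]) (intro continuous_intros)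
    have Wm: "(\<lambda>v. ennreal_powr (?T3 (fst v) (snd v)) (2 * s) * indicator E (snd v)) \<in> borel_measurable borel"
      by (intro borel_measurable_times_ennreal T3m iE)
    have "(\<integral>\<^sup>+\<xi>. (\<integral>\<^sup>+x. ennreal_powr (?T3 x \<xi>) (2 * s) \<partial>lborel) * indicator E \<xi> \<partial>lborel)
       = (\<integral>\<^sup>+\<xi>. \<integral>\<^sup>+x. ennreal_powr (?T3 x \<xi>) (2 * s) * indicator E \<xi> \<partial>lborel \<partial>lborel)"
    proof (rule nn_integral_cong)
      fix \<xi>
      show "(\<integral>\<^sup>+x. ennreal_powr (?T3 x \<xi>) (2 * s) \<partial>lborel) * indicator E \<xi>
          = (\<integral>\<^sup>+x. ennreal_powr (?T3 x \<xi>) (2 * s) * indicator E \<xi> \<partial>lborel)"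
        using borel_measurable_compose_continuous[OF T3m, of "\<lambda>x. (x, \<xi>)"]
        by (intro nn_integral_multc[symmetric]) (simp add: continuous_intros)
    qed
    also have "\<dots> = (\<integral>\<^sup>+x. \<integral>\<^sup>+\<xi>. ennreal_powr (?T3 x \<xi>) (2 * s) * indicator E \<xi> \<partial>lborel \<partial>lborel)"
      using Wm by (intro nn_integral_lborel_swap[symmetric])
    also have "\<dots> = (\<integral>\<^sup>+v. ennreal_powr (?T3 (fst v) (snd v)) (2 * s) * indicator E (snd v) \<partial>lborel)"
      using nn_integral_lborel_Pair[OF Wm] by simp
    also have "\<dots> \<le> ennreal ((2 * D) powr (2 * (s - 1))) * (\<integral>\<^sup>+w. ennreal (f3 w powr s) \<partial>lborel)\<^sup>2"
      by (rule plane_integral_estimate[where C = C, OF f3m(1) _ _ _ E bE s1 D0 D nz])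
        (use supp in \<open>auto simp: f3_def\<close>)
    finally show ?thesis by (simp add: f3s F_def)
  qed
  have inner: "ennreal_powr (\<integral>\<^sup>+x. ennreal_powr (plane_integral L f x \<xi>) r \<partial>lborel) (q / r)
      \<le> (if \<theta> = 0 then 1 else ennreal_powr F (\<theta> * q)) * (\<integral>\<^sup>+x. ennreal_powr (?T3 x \<xi>) (2 * s) \<partial>lborel)" for \<xi>
  proof (cases "\<theta> = 0")
    \<comment> \<open>This end point of the segment is set apart because \<open>ennreal_powr x 0\<close> is not \<open>1\<close> at \<open>x = 0\<close> and \<open>x = \<infinity>\<close>.\<close>
    case True
    then have r2: "r = 2 * p" using p by (simp add: \<theta>_def field_simps)
    have "s = p" "q = 2 * p" using p by (simp_all add: s q r2 field_simps)
    then show ?thesis using True p f0 by (simp add: f3_def r2)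
  next
    case False
    have "\<theta> \<ge> 0" using p r by (simp add: \<theta>_def field_simps)
    moreover have "1 / r < 1" using r by simp
    ultimately have \<theta>: "\<theta> > 0" "1 - \<theta> > 0" using False rp by (simp_all add: \<theta>_def)
    have \<theta>s: "(1 - \<theta>) = 2 * s * (1 / p - 1 / r)"
    proof -
      have "2 * (x / (2 * y)) * y = x" if "y > 0" for x y :: real using that by simp
      from this[OF rp, of "1 - 2 / r + 1 / p"] have "2 * s * (1 / p - 1 / r) = 1 - 2 / r + 1 / p"
        unfolding s .
      then show ?thesis by (simp add: \<theta>_def)
    qed
    have rq: "r / q = r * (1 / p - 1 / r)" by (simp add: q)
    have rq': "r / q = r / p - 1" unfolding rq using r by (simp add: right_diff_distrib)
    have \<theta>r: "\<theta> * r = 2 - r / p" using r by (simp add: \<theta>_def left_diff_distrib)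
    have ab: "\<theta> * r > 0" "r / q > 0" "\<theta> * r + r / q = 1" "r / q * (q / r) = 1"
    proof -
      show "\<theta> * r > 0" "r / q > 0" using \<theta> r q0 by simp_all
      show "\<theta> * r + r / q = 1" by (simp add: rq' \<theta>r)
      show "r / q * (q / r) = 1" using r q0 by simp
    qed
    have "2 * s * (r / q) = (1 - \<theta>) * r"
      unfolding rq \<theta>s by simp
    then have ab5: "(1 - \<theta>) * r = 2 * s * r / q" by simp
    let ?T2 = "plane_integral L (\<lambda>w. ennreal (f w powr p))"
    have ff: "ennreal (f w) = ennreal_powr (ennreal (f w powr p)) \<theta> * ennreal_powr (ennreal (f3 w)) (1 - \<theta>)" for w
    proof -
      have "p * \<theta> + p / s * (1 - \<theta>) = 1"
        unfolding \<theta>s using p s1 by (simp add: \<theta>_def field_simps)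
      then have "f w = f w powr (p * \<theta>) * f w powr (p / s * (1 - \<theta>))"
        using f0[of w] by (simp add: powr_add[symmetric])
      then show ?thesis
        by (simp add: ennreal_powr_ennreal f3_def powr_powr ennreal_mult[symmetric])
    qed
    have "plane_integral L f x \<xi> \<le> ennreal_powr (?T2 x \<xi>) \<theta> * ennreal_powr (?T3 x \<xi>) (1 - \<theta>)" for x
      unfolding ff using \<theta> by (intro plane_integral_Holder fp f3m) auto
    then have "ennreal_powr (plane_integral L f x \<xi>) r \<le> ennreal_powr (ennreal_powr (?T2 x \<xi>) \<theta> * ennreal_powr (?T3 x \<xi>) (1 - \<theta>)) r" for x
      using r by (intro ennreal_powr_mono) auto
    then have "ennreal_powr (plane_integral L f x \<xi>) r
        \<le> ennreal_powr (?T2 x \<xi>) (\<theta> * r) * ennreal_powr (ennreal_powr (?T3 x \<xi>) (2 * s)) (r / q)" for x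
      using r by (simp add: ennreal_powr_mult ennreal_powr_powr ab5)
    then have "(\<integral>\<^sup>+x. ennreal_powr (plane_integral L f x \<xi>) r \<partial>lborel)
      \<le> (\<integral>\<^sup>+x. ennreal_powr (?T2 x \<xi>) (\<theta> * r) * ennreal_powr (ennreal_powr (?T3 x \<xi>) (2 * s)) (r / q) \<partial>lborel)"
      by (intro nn_integral_mono)
    also have "\<dots> \<le> ennreal_powr (\<integral>\<^sup>+x. ?T2 x \<xi> \<partial>lborel) (\<theta> * r)
        * ennreal_powr (\<integral>\<^sup>+x. ennreal_powr (?T3 x \<xi>) (2 * s) \<partial>lborel) (r / q)"
      using borel_measurable_compose_continuous[OF plane_integral_measurable[OF fp], of "\<lambda>x. (x, \<xi>)"]
        borel_measurable_compose_continuous[OF T3m, of "\<lambda>x. (x, \<xi>)"]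
      by (intro nn_integral_Holder ab) (simp_all add: continuous_intros)
    also have "\<dots> \<le> ennreal_powr F (\<theta> * r)
        * ennreal_powr (\<integral>\<^sup>+x. ennreal_powr (?T3 x \<xi>) (2 * s) \<partial>lborel) (r / q)"
      unfolding F_def by (intro mult_right_mono ennreal_powr_mono nn_integral_plane_integral_le fp ab) auto
    finally have "ennreal_powr (\<integral>\<^sup>+x. ennreal_powr (plane_integral L f x \<xi>) r \<partial>lborel) (q / r)
       \<le> ennreal_powr (ennreal_powr F (\<theta> * r)
        * ennreal_powr (\<integral>\<^sup>+x. ennreal_powr (?T3 x \<xi>) (2 * s) \<partial>lborel) (r / q)) (q / r)"
      using r q0 by (intro ennreal_powr_mono) auto
    also have "\<dots> = ennreal_powr F (\<theta> * q) * (\<integral>\<^sup>+x. ennreal_powr (?T3 x \<xi>) (2 * s) \<partial>lborel)"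
      using r q0 ab(4) by (simp add: ennreal_powr_mult ennreal_powr_powr)
    finally show ?thesis using False by simp
  qed
  have m3: "(\<lambda>\<xi>. (\<integral>\<^sup>+x. ennreal_powr (?T3 x \<xi>) (2 * s) \<partial>lborel) * indicator E \<xi>) \<in> borel_measurable borel"
  proof -
    have "(\<lambda>v. ennreal_powr (?T3 (snd v) (fst v)) (2 * s)) \<in> borel_measurable borel"
      using borel_measurable_compose_continuous[OF T3m, of "\<lambda>v. (snd v, fst v)"] by (simp add: continuous_intros)
    then show ?thesis
      by (intro borel_measurable_times_ennreal borel_measurable_nn_integral_lborel borel_measurable_indicator E)
  qed
  define c where "c = (if \<theta> = 0 then 1 else ennreal_powr F (\<theta> * q))"
  have "(\<integral>\<^sup>+\<xi>. ennreal_powr (\<integral>\<^sup>+x. ennreal_powr (plane_integral L f x \<xi>) r \<partial>lborel) (q / r) * indicator E \<xi> \<partial>lborel)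
     \<le> (\<integral>\<^sup>+\<xi>. c * ((\<integral>\<^sup>+x. ennreal_powr (?T3 x \<xi>) (2 * s) \<partial>lborel) * indicator E \<xi>) \<partial>lborel)"
    unfolding mult.assoc[symmetric] c_def by (intro nn_integral_mono mult_right_mono inner) simp
  also have "\<dots> = c * (\<integral>\<^sup>+\<xi>. (\<integral>\<^sup>+x. ennreal_powr (?T3 x \<xi>) (2 * s) \<partial>lborel) * indicator E \<xi> \<partial>lborel)"
    using m3 by (intro nn_integral_cmult) simp
  also have "\<dots> \<le> c * (ennreal ((2 * D) powr (2 * (s - 1))) * F\<^sup>2)"
    by (intro mult_left_mono key) simp
  also have "\<dots> = ennreal ((2 * D) powr (2 * (s - 1))) * ennreal_powr F (q / p)"
  proof -
    have qd: "q * (1 / p - 1 / r) = 1" using rp p unfolding q by simp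
    have "\<theta> * q = q / p - 2 * (q * (1 / p - 1 / r))" by (simp add: \<theta>_def algebra_simps)
    then have qp: "q / p = \<theta> * q + 2" unfolding qd by simp
    have F2: "F\<^sup>2 = ennreal_powr F 2"
      by (cases F) (simp_all add: ennreal_powr_ennreal ennreal_power power_eq_top_ennreal)
    show ?thesis
    proof (cases "\<theta> = 0")
      case True
      then show ?thesis using qp by (simp add: c_def F2)
    next
      case False
      then show ?thesis unfolding qp ennreal_powr_add by (simp add: c_def F2 ac_simps)
    qed
  qed
  finally show ?thesis unfolding F_def .
qed

end

section \<open>Lebesgue norms\<close>

lemma Lp_norm_real: "p = ennreal P \<Longrightarrow> P \<ge> 1
  \<Longrightarrow> Lp_norm p M g = ennreal_powr (\<integral>\<^sup>+x. ennreal_powr (g x) P \<partial>M) (1 / P)"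
  by (simp add: Lp_norm_def)

lemma exponent_cases:
  fixes p :: ennreal
  assumes "1 \<le> p"
  obtains "p = \<infinity>" | P where "p = ennreal P" "1 \<le> P"
proof (cases p)
  case (real P)
  then show ?thesis using assms that(2)[of P] by (metis ennreal_1 ennreal_le_iff)
qed (use that in auto)

text \<open>The factor is a multiple of a power of the measure of \<open>A\<close>; it depends on neither \<open>g\<close> nor \<open>c\<close>.\<close>

lemma Lp_norm_le_const:
  fixes M :: "'a measure"
  assumes p: "1 \<le> p" and A: "A \<in> sets M" "emeasure M A < \<infinity>"
  obtains K where "K \<ge> 0" and "\<And>g c. g \<in> borel_measurable M \<Longrightarrow> AE x in M. g x \<le> c * indicator A x
     \<Longrightarrow> Lp_norm p M g \<le> ennreal K * c"
  using p
proof (cases rule: exponent_cases)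
  case 1
  show ?thesis
  proof (rule that[of 1])
    fix g :: "'a \<Rightarrow> ennreal" and c assume g: "g \<in> borel_measurable M" "AE x in M. g x \<le> c * indicator A x"
    have "AE x in M. g x \<le> c" using g(2)
    proof eventually_elim
      case (elim x) then show ?case by (cases "x \<in> A") auto
    qed
    then show "Lp_norm p M g \<le> ennreal 1 * c" using g(1) by (simp add: Lp_norm_def 1 esssup_I)
  qed simp
next
  case (2 P)
  define K where "K = enn2real (ennreal_powr (emeasure M A) (1 / P))"
  have K: "ennreal K = ennreal_powr (emeasure M A) (1 / P)"
    using A(2) by (simp add: K_def less_top[symmetric])
  show ?thesis
  proof (rule that[of K])
    fix g :: "'a \<Rightarrow> ennreal" and c assume g: "g \<in> borel_measurable M" "AE x in M. g x \<le> c * indicator A x"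
    have "(\<integral>\<^sup>+x. ennreal_powr (g x) P \<partial>M) \<le> (\<integral>\<^sup>+x. ennreal_powr c P * indicator A x \<partial>M)"
    proof (rule nn_integral_mono_AE)
      show "AE x in M. ennreal_powr (g x) P \<le> ennreal_powr c P * indicator A x"
        using g(2)
      proof eventually_elim
        case (elim x)
        then have "ennreal_powr (g x) P \<le> ennreal_powr (c * indicator A x) P" using 2 by (intro ennreal_powr_mono) auto
        then show ?case by (auto simp: indicator_def split: if_splits)
      qed
    qed
    also have "\<dots> = ennreal_powr c P * emeasure M A" using A(1) by (simp add: nn_integral_cmult_indicator)
    finally have "Lp_norm p M g \<le> ennreal_powr (ennreal_powr c P * emeasure M A) (1 / P)"
      using 2 by (simp add: Lp_norm_real ennreal_powr_mono)
    also have "\<dots> = ennreal K * c" using 2 by (simp add: ennreal_powr_mult K ennreal_powr_powr mult.commute)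
    finally show "Lp_norm p M g \<le> ennreal K * c" .
  qed (simp add: K_def)
qed

lemma Lp_norm_exponent_mono:
  assumes s: "1 \<le> s" "s \<le> q" "q < \<infinity>" and A: "A \<in> sets M" "emeasure M A < \<infinity>"
  obtains K where "K \<ge> 0" and "\<And>g. g \<in> borel_measurable M \<Longrightarrow> (\<And>x. x \<in> space M - A \<Longrightarrow> g x = 0)
     \<Longrightarrow> Lp_norm s M g \<le> ennreal K * Lp_norm q M g"
proof -
  have "1 \<le> q" "s < \<infinity>" using s by auto
  obtain Q where Q: "q = ennreal Q" "1 \<le> Q" using \<open>1 \<le> q\<close> s(3) by (cases rule: exponent_cases) auto
  obtain S where S: "s = ennreal S" "1 \<le> S" using s(1) \<open>s < \<infinity>\<close> by (cases rule: exponent_cases) auto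
  have "S \<le> Q" using s(2) Q S by (simp add: ennreal_le_iff)
  note SQ = S Q this
  show ?thesis
  proof (cases "S = Q")
    case True
    then show ?thesis using SQ by (intro that[of 1]) auto
  next
    case False
    then have SQ': "S < Q" using SQ by simp
    define b where "b = 1 - S / Q"
    have b: "0 < S / Q" "0 < b" "S / Q + b = 1" using SQ SQ' by (simp_all add: b_def)
    define K where "K = enn2real (ennreal_powr (emeasure M A) (b / S))"
    have K: "ennreal K = ennreal_powr (emeasure M A) (b / S)"
      using A(2) by (simp add: K_def less_top[symmetric])
    show ?thesis
    proof (rule that[of K])
      fix g :: "'a \<Rightarrow> ennreal" assume g [measurable]: "g \<in> borel_measurable M" and supp: "\<And>x. x \<in> space M - A \<Longrightarrow> g x = 0"
      have "(\<integral>\<^sup>+x. ennreal_powr (g x) S \<partial>M)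
          = (\<integral>\<^sup>+x. ennreal_powr (ennreal_powr (g x) Q) (S / Q) * ennreal_powr (indicator A x) b \<partial>M)"
      proof (rule nn_integral_cong)
        fix x assume "x \<in> space M"
        then show "ennreal_powr (g x) S = ennreal_powr (ennreal_powr (g x) Q) (S / Q) * ennreal_powr (indicator A x) b"
          using supp[of x] SQ by (cases "x \<in> A") (simp_all add: ennreal_powr_powr)
      qed
      also have "\<dots> \<le> ennreal_powr (\<integral>\<^sup>+x. ennreal_powr (g x) Q \<partial>M) (S / Q) * ennreal_powr (\<integral>\<^sup>+x. indicator A x \<partial>M) b"
        using A(1) by (intro nn_integral_Holder b) auto
      finally have "ennreal_powr (\<integral>\<^sup>+x. ennreal_powr (g x) S \<partial>M) (1 / S)
         \<le> ennreal_powr (ennreal_powr (\<integral>\<^sup>+x. ennreal_powr (g x) Q \<partial>M) (S / Q) * ennreal_powr (emeasure M A) b) (1 / S)"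
        using SQ A(1) by (intro ennreal_powr_mono) auto
      also have "\<dots> = ennreal K * ennreal_powr (\<integral>\<^sup>+x. ennreal_powr (g x) Q \<partial>M) (1 / Q)"
        using SQ by (simp add: ennreal_powr_mult ennreal_powr_powr K mult.commute)
      finally show "Lp_norm s M g \<le> ennreal K * Lp_norm q M g"
        using SQ by (simp add: Lp_norm_real)
    qed (simp add: K_def)
  qed
qed

text \<open>The norm of exponent \<open>\<infinity>\<close> needs an argument: the essential supremum of a slice exceeds \<open>c\<close> exactly if
  the set where the slice exceeds \<open>c\<close> has positive measure, and this measure depends measurably on the
  slice. Since \<open>esssup\<close> of a function that is not measurable is \<open>\<infinity>\<close>, the mixed norm with \<open>q = \<infinity>\<close> depends
  on this.\<close>

lemma Lp_norm_slice_measurable: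
  fixes F :: "'a::euclidean_space \<Rightarrow> 'b::euclidean_space \<Rightarrow> ennreal"
  assumes F: "(\<lambda>v. F (fst v) (snd v)) \<in> borel_measurable borel" and r: "1 \<le> r"
  shows "(\<lambda>\<xi>. Lp_norm r lebesgue (\<lambda>x. F x \<xi>)) \<in> borel_measurable borel"
proof -
  have F': "(\<lambda>v. F (snd v) (fst v)) \<in> borel_measurable borel"
    using borel_measurable_compose_continuous[OF F, of "\<lambda>v. (snd v, fst v)"] by (simp add: continuous_intros)
  have Fx: "(\<lambda>x. F x \<xi>) \<in> borel_measurable borel" for \<xi>
    using borel_measurable_compose_continuous[OF F, of "\<lambda>x. (x, \<xi>)"] by (simp add: continuous_intros)
  show ?thesis
    using r
  proof (cases rule: exponent_cases)
    case (2 P)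
    have "(\<lambda>\<xi>. \<integral>\<^sup>+x. ennreal_powr (F x \<xi>) P \<partial>lborel) \<in> borel_measurable borel"
      by (intro borel_measurable_nn_integral_lborel ennreal_powr_measurable F')
    then show ?thesis using 2 by (simp add: Lp_norm_real nn_integral_completion)
  next
    case 1
    have m: "(\<lambda>x. F x \<xi>) \<in> borel_measurable lebesgue" for \<xi>
      using Fx by (intro measurable_completion) simp
    have iff: "esssup lebesgue (\<lambda>x. F x \<xi>) > c \<longleftrightarrow> (\<integral>\<^sup>+x. indicator {c<..} (F x \<xi>) \<partial>lborel) \<noteq> 0" for \<xi> c
    proof -
      have Im: "(\<lambda>x. indicator {c<..} (F x \<xi>) :: ennreal) \<in> borel_measurable lborel"
        using measurable_compose[OF Fx, of "indicator {c<..}" borel] by simp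
      have "esssup lebesgue (\<lambda>x. F x \<xi>) \<le> c \<longleftrightarrow> (AE x in lebesgue. F x \<xi> \<le> c)"
      proof
        assume le: "esssup lebesgue (\<lambda>x. F x \<xi>) \<le> c"
        show "AE x in lebesgue. F x \<xi> \<le> c"
          using esssup_AE[of "\<lambda>x. F x \<xi>" lebesgue] by eventually_elim (use le in auto)
      qed (rule esssup_I[OF m])
      also have "\<dots> \<longleftrightarrow> (\<integral>\<^sup>+x. indicator {c<..} (F x \<xi>) \<partial>lborel) = 0"
      proof -
        have "indicator {c<..} (F x \<xi>) = (0::ennreal) \<longleftrightarrow> F x \<xi> \<le> c" for x
          by (auto simp: indicator_def not_less)
        then show ?thesis by (simp only: AE_completion_iff nn_integral_0_iff_AE[OF Im])
      qed
      finally show ?thesis by (simp add: not_le[symmetric])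
    qed
    have "(\<lambda>\<xi>. \<integral>\<^sup>+x. indicator {c<..} (F x \<xi>) \<partial>lborel) \<in> borel_measurable borel" for c
      using measurable_compose[OF F', of "indicator {c<..}" borel]
      by (intro borel_measurable_nn_integral_lborel) simp
    then have "{\<xi>. (\<integral>\<^sup>+x. indicator {c<..} (F x \<xi>) \<partial>lborel) \<noteq> 0} \<in> sets borel" for c
      by (simp add: pred_def[symmetric])
    then have "(\<lambda>\<xi>. esssup lebesgue (\<lambda>x. F x \<xi>)) \<in> borel_measurable borel"
      by (intro borel_measurableI_greater) (simp add: iff)
    then show ?thesis using 1 by (simp add: Lp_norm_def)
  qed
qed

text \<open>Changing the function on a null set makes it Borel without leaving its support, and makes an almost
  everywhere bound hold everywhere.\<close>

lemma borel_version:
  fixes f :: "'a::euclidean_space \<Rightarrow> complex"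
  assumes f: "f \<in> borel_measurable lebesgue" and S: "S \<in> sets borel" "{w. f w \<noteq> 0} \<subseteq> S"
    and m: "AE w in lborel. ennreal (norm (f w)) \<le> m"
  obtains f' where "f' \<in> borel_measurable borel" "AE w in lborel. f w = f' w" "{w. f' w \<noteq> 0} \<subseteq> S"
    "\<And>w. ennreal (norm (f' w)) \<le> m"
proof -
  have "(\<lambda>w. Re (f w)) \<in> borel_measurable lebesgue" "(\<lambda>w. Im (f w)) \<in> borel_measurable lebesgue"
    using f by measurable
  then obtain g h where [measurable]: "g \<in> borel_measurable lborel" "h \<in> borel_measurable lborel"
    and gh: "AE w in lborel. Re (f w) = g w" "AE w in lborel. Im (f w) = h w"
    using completion_ex_borel_measurable_real by metis
  define k where "k w = Complex (g w) (h w)" for w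
  have k [measurable]: "k \<in> borel_measurable borel"
  proof -
    have "k = (\<lambda>w. complex_of_real (g w) + \<i> * complex_of_real (h w))" by (simp add: k_def Complex_eq fun_eq_iff)
    moreover have "(\<lambda>w. complex_of_real (g w) + \<i> * complex_of_real (h w)) \<in> borel_measurable lborel" by measurable
    ultimately show ?thesis by simp
  qed
  define f' where "f' w = (if w \<in> S \<and> ennreal (norm (k w)) \<le> m then k w else 0)" for w
  show ?thesis
  proof (rule that)
    show "f' \<in> borel_measurable borel" unfolding f'_def using S(1) by measurable
    show "AE w in lborel. f w = f' w"
      using gh m
    proof eventually_elim
      case (elim w)
      then have "k w = f w" by (simp add: k_def complex_eq_iff)
      then show ?case using S(2) elim by (auto simp: f'_def)
    qed
    show "{w. f' w \<noteq> 0} \<subseteq> S" by (auto simp: f'_def)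
    show "ennreal (norm (f' w)) \<le> m" for w by (simp add: f'_def)
  qed
qed

section \<open>Mixed norm estimates for the plane transform\<close>

lemma Lp_norm_cong_AE:
  assumes "1 \<le> p" "g \<in> borel_measurable M" "h \<in> borel_measurable M" "AE x in M. g x = h x"
  shows "Lp_norm p M g = Lp_norm p M h"
  using assms(1)
proof (cases rule: exponent_cases)
  case 1
  have "esssup M g = esssup M h" by (rule esssup_AE_cong[OF assms(2-4)])
  then show ?thesis using 1 by (simp add: Lp_norm_def)
next
  case (2 P)
  have "(\<integral>\<^sup>+x. ennreal_powr (g x) P \<partial>M) = (\<integral>\<^sup>+x. ennreal_powr (h x) P \<partial>M)"
    by (rule nn_integral_cong_AE) (use assms(4) in eventually_elim, simp)
  then show ?thesis using 2 by (simp add: Lp_norm_real)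
qed

definition pencil_map :: "real^'d^'d \<Rightarrow> real^'d^'d \<Rightarrow> real \<times> real \<Rightarrow> real^'d^'d" where
  "pencil_map A B z = 2 *\<^sub>R (fst z *\<^sub>R A + snd z *\<^sub>R B)"

lemma plane_family_pencil_map: "plane_family (pencil_map A B)"
  by standard (auto simp: pencil_map_def algebra_simps intro!: linearI)

lemma plane_transform_eq:
  fixes A B :: "real^'d^'d"
  assumes "transpose A = A" "transpose B = B"
  shows "plane_transform (\<lambda>x. x \<bullet> (A *v x)) (\<lambda>x. x \<bullet> (B *v x)) f x \<xi>
    = set_lebesgue_integral lebesgue square (\<lambda>z. f (x - pencil_map A B z *v \<xi>, z))"
proof -
  have "x - s *\<^sub>R gradient (\<lambda>x. x \<bullet> (A *v x)) \<xi> - t *\<^sub>R gradient (\<lambda>x. x \<bullet> (B *v x)) \<xi>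
     = x - pencil_map A B (s, t) *v \<xi>" for s t
    by (simp add: gradient_quadratic_form[OF assms(1)] gradient_quadratic_form[OF assms(2)] pencil_map_def
        matrix_vector_mult_add_rdistrib scaleR_matrix_vector_assoc[symmetric] algebra_simps)
  then show ?thesis by (simp only: plane_transform_def split_beta' prod.collapse)
qed

context plane_family
begin

definition signed_plane_integral :: "((real^'d) \<times> real \<times> real \<Rightarrow> complex) \<Rightarrow> real^'d \<Rightarrow> real^'d \<Rightarrow> complex" where
  "signed_plane_integral f x \<xi> = set_lebesgue_integral lebesgue square (\<lambda>z. f (x - L z *v \<xi>, z))"

lemma signed_integrand_measurable:
  assumes f: "f \<in> borel_measurable borel"
  shows "(\<lambda>w. indicator square (snd w) *\<^sub>R (f (fst (fst w) - L (snd w) *v snd (fst w), snd w) :: complex))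
     \<in> borel_measurable borel"
proof -
  have "(\<lambda>w. indicator square (snd w) :: real) \<in> borel_measurable borel"
    by (rule borel_measurable_compose_continuous[OF borel_measurable_indicator[OF square_borel]]) (intro continuous_intros)
  moreover have "(\<lambda>w. f (fst (fst w) - L (snd w) *v snd (fst w), snd w)) \<in> borel_measurable borel"
    by (intro borel_measurable_compose_continuous[OF f] continuous_intros)
  ultimately show ?thesis by (rule borel_measurable_scaleR)
qed

lemma signed_slice_measurable:
  assumes f: "f \<in> borel_measurable borel"
  shows "(\<lambda>z. indicator square z *\<^sub>R (f (x - L z *v \<xi>, z) :: complex)) \<in> borel_measurable borel"
  using borel_measurable_compose_continuous[OF signed_integrand_measurable[OF f], of "\<lambda>z. ((x, \<xi>), z)"]
  by (simp add: continuous_intros)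

lemma signed_plane_integral_measurable:
  assumes f: "f \<in> borel_measurable borel"
  shows "(\<lambda>v. signed_plane_integral f (fst v) (snd v)) \<in> borel_measurable borel"
proof -
  have "signed_plane_integral f (fst v) (snd v)
      = (\<integral>z. indicator square z *\<^sub>R f (fst v - L z *v snd v, z) \<partial>lborel)" for v
    unfolding signed_plane_integral_def set_lebesgue_integral_def
    using signed_slice_measurable[OF f] by (intro integral_completion) simp
  moreover have "(\<lambda>v. \<integral>z. indicator square z *\<^sub>R f (fst v - L z *v snd v, z) \<partial>lborel) \<in> borel_measurable lborel"
    using signed_integrand_measurable[OF f]
    by (intro lborel.borel_measurable_lebesgue_integral) (simp add: lborel_prod split_beta')
  ultimately show ?thesis by simp
qed

text \<open>Where the integrand is not integrable, the Bochner integral on the left is \<open>0\<close>.\<close>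

lemma norm_signed_plane_integral_le:
  assumes f: "f \<in> borel_measurable borel"
  shows "ennreal (norm (signed_plane_integral f x \<xi>)) \<le> plane_integral L (\<lambda>w. ennreal (norm (f w))) x \<xi>"
proof (cases "integrable lebesgue (\<lambda>z. indicator square z *\<^sub>R f (x - L z *v \<xi>, z))")
  case True
  have "ennreal (norm (signed_plane_integral f x \<xi>))
     \<le> (\<integral>\<^sup>+z. ennreal (norm (indicator square z *\<^sub>R f (x - L z *v \<xi>, z))) \<partial>lebesgue)"
    unfolding signed_plane_integral_def set_lebesgue_integral_def by (rule integral_norm_bound_ennreal[OF True])
  also have "\<dots> = (\<integral>\<^sup>+z. ennreal (norm (f (x - L z *v \<xi>, z))) * indicator square z \<partial>lborel)"
    unfolding nn_integral_completion by (intro nn_integral_cong) (simp add: indicator_def)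
  finally show ?thesis by (simp add: plane_integral_def)
next
  case False
  then show ?thesis
    by (simp add: signed_plane_integral_def set_lebesgue_integral_def not_integrable_integral_eq)
qed

text \<open>For fixed \<open>\<xi>\<close> the planes are disjoint translates that fill the space, so a null set meets almost
  every one of them in a null set. The exceptional set of \<open>x\<close> may depend on \<open>\<xi>\<close>, but every single \<open>\<xi>\<close> is
  covered.\<close>

lemma signed_plane_integral_AE_eq:
  assumes f': "f' \<in> borel_measurable borel" and eq: "AE w in lborel. f w = f' w"
  shows "AE x in lborel. signed_plane_integral f x \<xi> = signed_plane_integral f' x \<xi>"
proof -
  obtain N where N: "{w \<in> space lborel. \<not> f w = f' w} \<subseteq> N" "emeasure lborel N = 0" "N \<in> sets lborel"
    using AE_E[OF eq] by blast
  have off: "f w = f' w" if "w \<notin> N" for w using N(1) that by auto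
  have k: "(\<lambda>w. indicator N w :: ennreal) \<in> borel_measurable borel" using N(3) by simp
  have "(\<integral>\<^sup>+x. plane_integral L (indicator N) x \<xi> \<partial>lborel) \<le> emeasure lborel N"
    using nn_integral_plane_integral_le[OF k, of \<xi>] N(3) by simp
  then have "(\<integral>\<^sup>+x. plane_integral L (indicator N) x \<xi> \<partial>lborel) = 0" using N(2) by simp
  moreover have "(\<lambda>x. plane_integral L (indicator N) x \<xi>) \<in> borel_measurable lborel"
    using borel_measurable_compose_continuous[OF plane_integral_measurable[OF k], of "\<lambda>x. (x, \<xi>)"]
    by (simp add: continuous_intros)
  ultimately have "AE x in lborel. plane_integral L (indicator N) x \<xi> = 0"
    by (simp add: nn_integral_0_iff_AE)
  then show ?thesis
  proof eventually_elim
    case (elim x)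
    then have "AE z in lborel. indicator N (x - L z *v \<xi>, z) * indicator square z = (0::ennreal)"
      using plane_integrand_measurable[OF k, of x \<xi>]
      unfolding plane_integral_def by (subst (asm) nn_integral_0_iff_AE) simp_all
    then have ae: "AE z in lborel. indicator square z *\<^sub>R f' (x - L z *v \<xi>, z) = indicator square z *\<^sub>R f (x - L z *v \<xi>, z)"
    proof eventually_elim
      case (elim z)
      show ?case
      proof (cases "z \<in> square")
        case True
        then have "(x - L z *v \<xi>, z) \<notin> N" using elim by (auto simp: indicator_def split: if_splits)
        then show ?thesis by (simp add: off)
      qed (simp del: mem_Sigma_iff)
    qed
    have m': "(\<lambda>z. indicator square z *\<^sub>R f' (x - L z *v \<xi>, z)) \<in> borel_measurable lebesgue"
      using signed_slice_measurable[OF f', of x \<xi>] by (intro measurable_completion) simp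
    have m: "(\<lambda>z. indicator square z *\<^sub>R f (x - L z *v \<xi>, z)) \<in> borel_measurable lebesgue"
      by (rule borel_measurable_AE[OF m']) (use ae in \<open>simp only: AE_completion_iff\<close>)
    show ?case
      unfolding signed_plane_integral_def set_lebesgue_integral_def
      by (rule integral_cong_AE[OF m m']) (unfold AE_completion_iff, use ae in eventually_elim, erule sym)
  qed
qed

lemma Lp_norm_signed_plane_integral_cong:
  assumes f': "f' \<in> borel_measurable borel" and eq: "AE w in lborel. f w = f' w" and r: "1 \<le> r"
  shows "Lp_norm r lebesgue (\<lambda>x. ennreal (norm (signed_plane_integral f x \<xi>)))
       = Lp_norm r lebesgue (\<lambda>x. ennreal (norm (signed_plane_integral f' x \<xi>)))"
proof -
  have ae: "AE x in lebesgue. signed_plane_integral f' x \<xi> = signed_plane_integral f x \<xi>"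
    unfolding AE_completion_iff using signed_plane_integral_AE_eq[OF f' eq, of \<xi>] by eventually_elim simp
  have m': "(\<lambda>x. signed_plane_integral f' x \<xi>) \<in> borel_measurable lebesgue"
    using borel_measurable_compose_continuous[OF signed_plane_integral_measurable[OF f'], of "\<lambda>x. (x, \<xi>)"]
    by (intro measurable_completion) (simp add: continuous_intros)
  have m: "(\<lambda>x. signed_plane_integral f x \<xi>) \<in> borel_measurable lebesgue"
    by (rule borel_measurable_AE[OF m' ae])
  show ?thesis
  proof (rule Lp_norm_cong_AE[OF r])
    show "(\<lambda>x. ennreal (norm (signed_plane_integral f x \<xi>))) \<in> borel_measurable lebesgue"
      "(\<lambda>x. ennreal (norm (signed_plane_integral f' x \<xi>))) \<in> borel_measurable lebesgue"
      using m m' by measurable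
  qed (use ae in eventually_elim, simp)
qed

text \<open>For \<open>p = \<infinity>\<close>, and for \<open>r \<le> p\<close>, the inner norm is bounded uniformly in \<open>\<xi>\<close> by the trivial estimates. For
  \<open>r > p\<close> the hypotheses give \<open>r \<le> 2 p\<close> and \<open>q \<le> Q\<close> with \<open>1/Q = 1/p - 1/r\<close>, and the interpolated estimate
  applies to the exponent \<open>Q\<close>.\<close>

lemma mixed_norm_signed_plane_integral_borel:
  fixes p q r :: ennreal and C :: real
  assumes D: "\<And>g :: real. 0 \<le> g \<Longrightarrow> g * CARD('d) < 2 \<Longrightarrow>
      (\<integral>\<^sup>+z. ennreal (\<bar>det (L z)\<bar> powr (- g)) * indicator ({-2..2} \<times> {-2..2}) z \<partial>lborel) < \<infinity>"
    and nz: "AE z in lborel. det (L z) \<noteq> 0"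
    and p: "1 \<le> p" and q: "1 \<le> q" and r: "1 \<le> r"
    and c1: "2 + of_nat CARD('d) / r > (of_nat CARD('d) + 2) / p"
    and c2: "1 / r + 1 / q \<ge> 1 / p" and c3: "2 / r \<ge> 1 / p"
  obtains K where "K \<ge> 0"
    "\<And>f. f \<in> borel_measurable borel \<Longrightarrow> {w. f w \<noteq> 0} \<subseteq> ball 0 C \<times> square
      \<Longrightarrow> (\<And>w. p = \<infinity> \<Longrightarrow> ennreal (norm (f w)) \<le> Lp_norm p lebesgue (\<lambda>w. ennreal (norm (f w))))
      \<Longrightarrow> mixed_norm q r (signed_plane_integral f) \<le> ennreal K * Lp_norm p lebesgue (\<lambda>w. ennreal (norm (f w)))"
proof -
  let ?E = "unit_cube :: (real^'d) set"
  have Ebox: "?E = cbox (\<chi> i. - 1) (\<chi> i. 1)"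
    by (auto simp: unit_cube_def mem_box_cart)
  have bE: "bounded ?E" and Eb: "?E \<in> sets borel" by (simp_all add: Ebox)
  let ?ME = "lebesgue_on ?E"
  have spE: "space ?ME = ?E" by (simp add: space_restrict_space)
  have EM: "?E \<in> sets ?ME" using sets.top[of ?ME] by (simp only: spE)
  have EMf: "emeasure ?ME ?E < \<infinity>"
  proof -
    have "emeasure ?ME ?E = emeasure lebesgue ?E"
      by (rule emeasure_restrict_space) (use Eb in auto)
    then show ?thesis using emeasure_bounded_finite[OF bE] Eb by (simp add: emeasure_completion)
  qed
  obtain R where R: "R > 0" "\<And>z \<xi>. z \<in> square \<Longrightarrow> \<xi> \<in> ?E \<Longrightarrow> norm (L z *v \<xi>) \<le> R"
    using shift_bounded[OF bE] by blast
  let ?B = "ball (0::real^'d) (C + R)"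
  have BM: "?B \<in> sets lebesgue" by simp
  have BMf: "emeasure lebesgue ?B < \<infinity>"
    using emeasure_bounded_finite[OF bounded_ball, of "0::real^'d" "C + R"] by (simp add: emeasure_completion)
  define F where "F f x \<xi> = ennreal (norm (signed_plane_integral f x \<xi>))" for f x \<xi>
  define T where "T f x \<xi> = plane_integral L (\<lambda>w. ennreal (norm (f w :: complex))) x \<xi>" for f x \<xi>
  define \<psi> where "\<psi> f \<xi> = Lp_norm r lebesgue (\<lambda>x. F f x \<xi>)" for f \<xi>
  define N where "N f = Lp_norm p lebesgue (\<lambda>w. ennreal (norm (f w)))" for f :: "(real^'d) \<times> real \<times> real \<Rightarrow> complex"
  have mixed: "mixed_norm q r (signed_plane_integral f) = Lp_norm q ?ME (\<psi> f)" for f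
    by (simp add: mixed_norm_def \<psi>_def[abs_def] F_def)
  have FT: "F f x \<xi> \<le> T f x \<xi>" if "f \<in> borel_measurable borel" for f x \<xi>
    unfolding F_def T_def by (rule norm_signed_plane_integral_le[OF that])
  have Fm: "(\<lambda>v. F f (fst v) (snd v)) \<in> borel_measurable borel" if "f \<in> borel_measurable borel" for f
    unfolding F_def using signed_plane_integral_measurable[OF that] by measurable
  have Fx: "(\<lambda>x. F f x \<xi>) \<in> borel_measurable lebesgue" if "f \<in> borel_measurable borel" for f \<xi>
    using borel_measurable_compose_continuous[OF Fm[OF that], of "\<lambda>x. (x, \<xi>)"]
    by (intro measurable_completion) (simp add: continuous_intros)
  have \<psi>m: "\<psi> f \<in> borel_measurable ?ME" if "f \<in> borel_measurable borel" for f
  proof -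
    have "\<psi> f \<in> borel_measurable borel"
      unfolding \<psi>_def[abs_def] by (rule Lp_norm_slice_measurable[OF Fm[OF that] r])
    then show ?thesis by (intro measurable_restrict_space1 measurable_completion) simp
  qed
  have F0: "F f x \<xi> = 0"
    if "f \<in> borel_measurable borel" "{w. f w \<noteq> 0} \<subseteq> ball 0 C \<times> square" "\<xi> \<in> ?E" "x \<notin> ?B" for f x \<xi>
  proof -
    have "T f x \<xi> = 0"
      unfolding T_def
      by (rule plane_integral_eq_0[where C = C and R = R]) (use that R(2) in \<open>auto simp del: mem_Sigma_iff\<close>)
    then show ?thesis using FT[OF that(1), of x \<xi>] by simp
  qed
  obtain K2 where K2: "K2 \<ge> 0" "\<And>g c. g \<in> borel_measurable ?ME \<Longrightarrow> AE \<xi> in ?ME. g \<xi> \<le> c * indicator ?E \<xi>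
      \<Longrightarrow> Lp_norm q ?ME g \<le> ennreal K2 * c"
    using Lp_norm_le_const[OF q EM EMf] by blast
  have uniform: "mixed_norm q r (signed_plane_integral f) \<le> ennreal K2 * c"
    if "f \<in> borel_measurable borel" "\<And>\<xi>. \<xi> \<in> ?E \<Longrightarrow> \<psi> f \<xi> \<le> c" for f c
    unfolding mixed by (rule K2(2)[OF \<psi>m[OF that(1)]]) (use that(2) spE in \<open>auto intro!: AE_I2\<close>)
  show ?thesis
    using p
  proof (cases rule: exponent_cases)
    case 1
    obtain K1 where K1: "K1 \<ge> 0" "\<And>g c. g \<in> borel_measurable lebesgue \<Longrightarrow> AE x in lebesgue. g x \<le> c * indicator ?B x
        \<Longrightarrow> Lp_norm r lebesgue g \<le> ennreal K1 * c"
      using Lp_norm_le_const[OF r BM BMf] by blast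
    show ?thesis
    proof (rule that[of "K2 * (K1 * 4)"])
      fix f :: "(real^'d) \<times> real \<times> real \<Rightarrow> complex"
      assume f: "f \<in> borel_measurable borel" "{w. f w \<noteq> 0} \<subseteq> ball 0 C \<times> square"
        and le: "\<And>w. p = \<infinity> \<Longrightarrow> ennreal (norm (f w)) \<le> Lp_norm p lebesgue (\<lambda>w. ennreal (norm (f w)))"
      have "\<psi> f \<xi> \<le> ennreal K1 * (4 * N f)" if \<xi>: "\<xi> \<in> ?E" for \<xi>
      proof -
        have "F f x \<xi> \<le> 4 * N f * indicator ?B x" for x
        proof (cases "x \<in> ?B")
          case True
          have "T f x \<xi> \<le> 4 * N f" unfolding T_def N_def by (intro plane_integral_le le 1)
          then show ?thesis using True FT[OF f(1), of x \<xi>] by simp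
        qed (use F0[OF f \<xi>] in simp)
        then show ?thesis unfolding \<psi>_def by (intro K1(2) Fx f AE_I2)
      qed
      then have "mixed_norm q r (signed_plane_integral f) \<le> ennreal K2 * (ennreal K1 * (4 * N f))"
        by (rule uniform[OF f(1)])
      also have "\<dots> = ennreal (K2 * (K1 * 4)) * N f" using K1(1) K2(1) by (simp add: ennreal_mult mult.assoc)
      finally show "mixed_norm q r (signed_plane_integral f)
        \<le> ennreal (K2 * (K1 * 4)) * Lp_norm p lebesgue (\<lambda>w. ennreal (norm (f w)))" by (simp add: N_def)
    qed (use K1 K2 in simp)
  next
    case (2 P)
    let ?d = "real CARD('d)"
    have ip: "1 / p = ennreal (1 / P)" using 2 divide_ennreal[of 1 P] by simp
    have "r \<noteq> \<infinity>" using c3 2 by (auto simp: ip)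
    with r obtain S where S: "r = ennreal S" "1 \<le> S" by (cases rule: exponent_cases) auto
    have "ennreal ((?d + 2) / P) < ennreal (2 + ?d / S)"
    proof -
      have "(of_nat CARD('d) + 2) / p = ennreal ((?d + 2) / P)"
        using 2 divide_ennreal[of "?d + 2" P] by (simp add: ennreal_of_nat_eq_real_of_nat)
      moreover have "2 + of_nat CARD('d) / r = ennreal (2 + ?d / S)"
        using S divide_ennreal[of ?d S] by (simp add: ennreal_of_nat_eq_real_of_nat)
      ultimately show ?thesis using c1 by simp
    qed
    then have C1: "(?d + 2) / P < 2 + ?d / S" using 2 S by (subst (asm) ennreal_less_iff) auto
    have C3: "1 / P \<le> 2 / S"
    proof -
      have "2 / r = ennreal (2 / S)" using S divide_ennreal[of 2 S] by simp
      then have "ennreal (1 / P) \<le> ennreal (2 / S)" using c3 ip by simp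
      then show ?thesis using S by (subst (asm) ennreal_le_iff) auto
    qed
    \<comment> \<open>As \<open>1/r \<le> 1\<close>, the strict inequality excludes \<open>p = 1\<close>.\<close>
    have P1: "P > 1"
    proof (rule ccontr)
      assume "\<not> P > 1"
      then have "P = 1" using 2 by simp
      moreover have "?d / S \<le> ?d" using S by (simp add: divide_le_eq)
      ultimately show False using C1 by simp
    qed
    have Np: "N f = ennreal_powr (\<integral>\<^sup>+w. ennreal (norm (f w) powr P) \<partial>lborel) (1 / P)" for f
      using 2 by (simp add: N_def Lp_norm_real nn_integral_completion ennreal_powr_ennreal)
    show ?thesis
    proof (cases "S \<le> P")
      case True
      have "r \<le> p" "p < \<infinity>" using True S 2 by simp_all
      then obtain K1 where K1: "K1 \<ge> 0" "\<And>g. g \<in> borel_measurable lebesgue \<Longrightarrow> (\<And>x. x \<in> space lebesgue - ?B \<Longrightarrow> g x = 0)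
         \<Longrightarrow> Lp_norm r lebesgue g \<le> ennreal K1 * Lp_norm p lebesgue g"
        using Lp_norm_exponent_mono[OF r _ _ BM BMf] by metis
      define k where "k = (4 powr (P - 1)) powr (1 / P)"
      show ?thesis
      proof (rule that[of "K2 * (K1 * k)"])
        fix f :: "(real^'d) \<times> real \<times> real \<Rightarrow> complex"
        assume f: "f \<in> borel_measurable borel" "{w. f w \<noteq> 0} \<subseteq> ball 0 C \<times> square"
        have fm: "(\<lambda>w. ennreal (norm (f w))) \<in> borel_measurable borel" using f(1) by measurable
        have "\<psi> f \<xi> \<le> ennreal K1 * (ennreal k * N f)" if \<xi>: "\<xi> \<in> ?E" for \<xi>
        proof -
          have "(\<integral>\<^sup>+x. ennreal_powr (F f x \<xi>) P \<partial>lborel) \<le> (\<integral>\<^sup>+x. ennreal_powr (T f x \<xi>) P \<partial>lborel)"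
            using P1 by (intro nn_integral_mono ennreal_powr_mono FT f(1)) simp
          also have "\<dots> \<le> ennreal (4 powr (P - 1)) * (\<integral>\<^sup>+w. ennreal_powr (ennreal (norm (f w))) P \<partial>lborel)"
            unfolding T_def by (rule nn_integral_plane_integral_power_le[OF fm P1])
          finally have "Lp_norm p lebesgue (\<lambda>x. F f x \<xi>)
             \<le> ennreal_powr (ennreal (4 powr (P - 1)) * (\<integral>\<^sup>+w. ennreal (norm (f w) powr P) \<partial>lborel)) (1 / P)"
            using 2 P1 by (simp add: Lp_norm_real nn_integral_completion ennreal_powr_mono ennreal_powr_ennreal)
          also have "\<dots> = ennreal k * N f"
            using P1 by (simp add: ennreal_powr_mult ennreal_powr_ennreal k_def Np)
          finally have "ennreal K1 * Lp_norm p lebesgue (\<lambda>x. F f x \<xi>) \<le> ennreal K1 * (ennreal k * N f)"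
            by (rule mult_left_mono) simp
          moreover have "\<psi> f \<xi> \<le> ennreal K1 * Lp_norm p lebesgue (\<lambda>x. F f x \<xi>)"
            unfolding \<psi>_def by (intro K1(2) Fx f(1)) (use F0[OF f \<xi>] in simp)
          ultimately show ?thesis by (rule order_trans[rotated])
        qed
        then have "mixed_norm q r (signed_plane_integral f) \<le> ennreal K2 * (ennreal K1 * (ennreal k * N f))"
          by (rule uniform[OF f(1)])
        also have "\<dots> = ennreal (K2 * (K1 * k)) * N f" using K1(1) K2(1) by (simp add: ennreal_mult mult.assoc k_def)
        finally show "mixed_norm q r (signed_plane_integral f)
          \<le> ennreal (K2 * (K1 * k)) * Lp_norm p lebesgue (\<lambda>w. ennreal (norm (f w)))" by (simp add: N_def)
      qed (use K1 K2 in \<open>simp add: k_def\<close>)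
    next
      case False
      then have PS: "P < S" by simp
      have iPS: "1 / S < 1 / P" using P1 PS by (simp add: divide_strict_left_mono)
      define Q where "Q = 1 / (1 / P - 1 / S)"
      define s where "s = (1 - 2 / S + 1 / P) / (2 * (1 / P - 1 / S))"
      have S2P: "S \<le> 2 * P" using C3 P1 S by (simp add: field_simps)
      \<comment> \<open>This is \<open>s > (d + 4) / 4\<close>, equivalent to the strict inequality between the exponents; it makes the
        power \<open>- g\<close> of the determinant integrable.\<close>
      have s: "4 * (s - 1) > ?d"
      proof -
        have pos: "2 * (1 / P - 1 / S) > 0" using iPS by simp
        have "(?d + 4) * (2 * (1 / P - 1 / S)) < 4 * (1 - 2 / S + 1 / P)"
        proof -
          have "(?d + 4) * (2 * (a - b)) < 4 * (1 - 2 * b + a)" if "(?d + 2) * a < 2 + ?d * b" for a b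
            using that by (simp add: algebra_simps)
          from this[of "1 / P" "1 / S"] C1 show ?thesis by simp
        qed
        then have "?d + 4 < 4 * (1 - 2 / S + 1 / P) / (2 * (1 / P - 1 / S))"
          using pos by (simp only: pos_less_divide_eq)
        then show ?thesis by (simp add: s_def)
      qed
      have s1: "s > 1" using s by (smt (verit) of_nat_0_le_iff)
      define g where "g = 1 / (2 * (s - 1))"
      have g: "0 \<le> g" "g * ?d < 2" using s s1 by (simp_all add: g_def divide_less_eq)
      define D0 where "D0 = enn2real (\<integral>\<^sup>+z. ennreal (\<bar>det (L z)\<bar> powr (- g)) * indicator ({-2..2} \<times> {-2..2}) z \<partial>lborel)"
      have D0: "0 \<le> D0" "(\<integral>\<^sup>+z. ennreal (\<bar>det (L z)\<bar> powr (- g)) * indicator ({-2..2} \<times> {-2..2}) z \<partial>lborel) \<le> ennreal D0"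
        using D[OF g] by (simp_all add: D0_def)
      have Q: "1 \<le> Q" "q \<le> ennreal Q"
      proof -
        have "1 / P \<le> 1" using P1 by simp
        moreover have "1 / S > 0" using S by simp
        ultimately have "1 / P - 1 / S \<le> 1" by linarith
        then show "1 \<le> Q" using iPS by (simp add: Q_def)
        have ir: "1 / r = ennreal (1 / S)" using S divide_ennreal[of 1 S] by simp
        have "q \<noteq> \<infinity>"
        proof
          assume "q = \<infinity>"
          then have "ennreal (1 / P) \<le> ennreal (1 / S)" using c2 by (simp add: ip ir)
          then show False using iPS S by (subst (asm) ennreal_le_iff) auto
        qed
        with q obtain Q' where Q': "q = ennreal Q'" "1 \<le> Q'" by (cases rule: exponent_cases) auto
        have iq: "1 / q = ennreal (1 / Q')" using Q' divide_ennreal[of 1 Q'] by simp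
        have "ennreal (1 / P) \<le> ennreal (1 / S) + ennreal (1 / Q')"
          using c2 by (simp only: ip ir iq)
        then have "ennreal (1 / P) \<le> ennreal (1 / S + 1 / Q')"
          using S Q' by simp
        then have "1 / P - 1 / S \<le> 1 / Q'" using S Q' by (subst (asm) ennreal_le_iff) auto
        then have "Q' \<le> Q" using iPS Q' by (simp add: Q_def field_simps)
        then show "q \<le> ennreal Q" using Q' by (simp add: ennreal_leI)
      qed
      obtain K1 where K1: "K1 \<ge> 0" "\<And>g. g \<in> borel_measurable ?ME \<Longrightarrow> (\<And>x. x \<in> space ?ME - ?E \<Longrightarrow> g x = 0)
         \<Longrightarrow> Lp_norm q ?ME g \<le> ennreal K1 * Lp_norm (ennreal Q) ?ME g"
        using Lp_norm_exponent_mono[OF q Q(2) _ EM EMf] by auto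
      define k where "k = ((2 * D0) powr (2 * (s - 1))) powr (1 / Q)"
      show ?thesis
      proof (rule that[of "K1 * k"])
        fix f :: "(real^'d) \<times> real \<times> real \<Rightarrow> complex"
        assume f: "f \<in> borel_measurable borel" "{w. f w \<noteq> 0} \<subseteq> ball 0 C \<times> square"
        let ?G = "\<integral>\<^sup>+w. ennreal (norm (f w) powr P) \<partial>lborel"
        have "(\<integral>\<^sup>+\<xi>. ennreal_powr (\<psi> f \<xi>) Q \<partial>?ME)
           = (\<integral>\<^sup>+\<xi>. ennreal_powr (\<integral>\<^sup>+x. ennreal_powr (F f x \<xi>) S \<partial>lborel) (Q / S) * indicator ?E \<xi> \<partial>lborel)"
          using S Eb by (simp add: nn_integral_restrict_space nn_integral_completion \<psi>_def Lp_norm_real ennreal_powr_powr)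
        also have "\<dots> \<le> (\<integral>\<^sup>+\<xi>. ennreal_powr (\<integral>\<^sup>+x. ennreal_powr (T f x \<xi>) S \<partial>lborel) (Q / S) * indicator ?E \<xi> \<partial>lborel)"
          using S Q by (intro nn_integral_mono mult_right_mono ennreal_powr_mono FT f(1)) auto
        also have "\<dots> \<le> ennreal ((2 * D0) powr (2 * (s - 1))) * ennreal_powr ?G (Q / P)"
          unfolding T_def
          by (rule plane_integral_interpolated[where C = C, OF _ _ _ _ Eb bE P1 PS S2P s_def D0(1) _ nz Q_def])
            (use f D0(2) in \<open>auto simp: g_def\<close>)
        finally have "Lp_norm (ennreal Q) ?ME (\<psi> f)
           \<le> ennreal_powr (ennreal ((2 * D0) powr (2 * (s - 1))) * ennreal_powr ?G (Q / P)) (1 / Q)"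
          using Q(1) by (simp add: Lp_norm_real ennreal_powr_mono)
        also have "\<dots> = ennreal k * N f"
          using Q(1) by (simp add: ennreal_powr_mult ennreal_powr_ennreal ennreal_powr_powr k_def Np)
        finally have "ennreal K1 * Lp_norm (ennreal Q) ?ME (\<psi> f) \<le> ennreal K1 * (ennreal k * N f)"
          by (rule mult_left_mono) simp
        moreover have "mixed_norm q r (signed_plane_integral f) \<le> ennreal K1 * Lp_norm (ennreal Q) ?ME (\<psi> f)"
          unfolding mixed by (intro K1(2) \<psi>m f(1)) (simp add: spE)
        ultimately have "mixed_norm q r (signed_plane_integral f) \<le> ennreal K1 * (ennreal k * N f)"
          by (rule order_trans[rotated])
        also have "\<dots> = ennreal (K1 * k) * N f" using K1(1) by (simp add: ennreal_mult mult.assoc k_def)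
        finally show "mixed_norm q r (signed_plane_integral f)
          \<le> ennreal (K1 * k) * Lp_norm p lebesgue (\<lambda>w. ennreal (norm (f w)))" by (simp add: N_def)
      qed (use K1 in \<open>simp add: k_def\<close>)
    qed
  qed
qed

end


theorem corollary1:
  fixes Q1 Q2 :: "real^'d \<Rightarrow> real" and C :: real and p q r :: ennreal
  assumes "CARD('d) \<ge> 2"
    and "quadratic_form Q1" and "quadratic_form Q2"
    and "well_curved Q1 Q2"
    and "C > 0"
    and "1 \<le> p" and "1 \<le> q" and "1 \<le> r"
    and "2 + of_nat CARD('d) / r > (of_nat CARD('d) + 2) / p"
    and "1 / r + 1 / q \<ge> 1 / p"
    and "2 / r \<ge> 1 / p"
  shows "\<exists>K>0. \<forall>f :: (real^'d) \<times> real \<times> real \<Rightarrow> complex.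
    f \<in> borel_measurable lebesgue \<longrightarrow>
    {z. f z \<noteq> 0} \<subseteq> ball 0 C \<times> ({-1..1} \<times> {-1..1}) \<longrightarrow>
    mixed_norm q r (plane_transform Q1 Q2 f)
      \<le> ennreal K * Lp_norm p lebesgue (\<lambda>z. ennreal (norm (f z)))"
proof -
  obtain A B :: "real^'d^'d" where A: "transpose A = A" "Q1 = (\<lambda>x. x \<bullet> (A *v x))"
      and B: "transpose B = B" "Q2 = (\<lambda>x. x \<bullet> (B *v x))"
    using assms(2,3) unfolding quadratic_form_def fun_eq_iff by blast
  note sym = A(1) B(1)
  obtain c where c: "c > 0" "\<And>M. det M = 1 \<Longrightarrow> c \<le> gram_det (congr_matrix M A) (congr_matrix M B)"
    using well_curved_gram_det[OF sym] assms(4) unfolding A(2) B(2) by metis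
  interpret plane_family "pencil_map A B" by (rule plane_family_pencil_map)
  have det: "det (pencil_map A B z) = 2 ^ CARD('d) * det (fst z *\<^sub>R A + snd z *\<^sub>R B)" for z
    unfolding pencil_map_def by (rule det_scaleR)
  have nz: "AE z in lborel. det (pencil_map A B z) \<noteq> 0"
    using AE_pencil_det_nonzero[OF sym c] by (simp add: det)
  have D: "(\<integral>\<^sup>+z. ennreal (\<bar>det (pencil_map A B z)\<bar> powr (- g)) * indicator ({-2..2} \<times> {-2..2}) z \<partial>lborel) < \<infinity>"
    if g: "0 \<le> g" "g * CARD('d) < 2" for g :: real
  proof -
    let ?k = "\<lambda>z. ennreal (\<bar>det (fst z *\<^sub>R A + snd z *\<^sub>R B)\<bar> powr (- g)) * indicator ({-2..2} \<times> {-2..2}) z"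
    have km: "?k \<in> borel_measurable lborel"
      by (intro borel_measurable_times_ennreal borel_measurable_indicator) (measurable, auto intro!: borel_closed closed_Times)
    have "(\<integral>\<^sup>+z. ennreal (\<bar>det (pencil_map A B z)\<bar> powr (- g)) * indicator ({-2..2} \<times> {-2..2}) z \<partial>lborel)
        = (\<integral>\<^sup>+z. ennreal ((2 ^ CARD('d)) powr (- g)) * ?k z \<partial>lborel)"
      by (simp add: det abs_mult powr_mult ennreal_mult mult.assoc)
    also have "\<dots> = ennreal ((2 ^ CARD('d)) powr (- g)) * (\<integral>\<^sup>+z. ?k z \<partial>lborel)"
      by (rule nn_integral_cmult[OF km])
    also have "\<dots> < \<infinity>"
      using nn_integral_pencil_det_finite[OF sym c g, of 2] by (simp add: ennreal_mult_less_top)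
    finally show ?thesis .
  qed
  obtain K where K: "K \<ge> 0"
    "\<And>f. f \<in> borel_measurable borel \<Longrightarrow> {w. f w \<noteq> 0} \<subseteq> ball 0 C \<times> square
      \<Longrightarrow> (\<And>w. p = \<infinity> \<Longrightarrow> ennreal (norm (f w)) \<le> Lp_norm p lebesgue (\<lambda>w. ennreal (norm (f w))))
      \<Longrightarrow> mixed_norm q r (signed_plane_integral f) \<le> ennreal K * Lp_norm p lebesgue (\<lambda>w. ennreal (norm (f w)))"
    using mixed_norm_signed_plane_integral_borel[OF D nz assms(6-11)] by blast
  show ?thesis
  proof (intro exI[of _ "K + 1"] conjI allI impI)
    show "K + 1 > 0" using K(1) by simp
    fix f :: "(real^'d) \<times> real \<times> real \<Rightarrow> complex"
    assume f: "f \<in> borel_measurable lebesgue" and supp: "{z. f z \<noteq> 0} \<subseteq> ball 0 C \<times> square"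
    let ?N = "\<lambda>f :: (real^'d) \<times> real \<times> real \<Rightarrow> complex. Lp_norm p lebesgue (\<lambda>z. ennreal (norm (f z)))"
    have S: "ball (0::real^'d) C \<times> square \<in> sets borel"
      using square_borel by (auto simp: borel_prod[symmetric] simp del: square_borel)
    define m where "m = (if p = \<infinity> then ?N f else \<infinity>)"
    have bound: "AE w in lborel. ennreal (norm (f w)) \<le> m"
      using esssup_AE[of "\<lambda>z. ennreal (norm (f z))" lebesgue]
      by (auto simp: m_def Lp_norm_def AE_completion_iff)
    obtain f' where f': "f' \<in> borel_measurable borel" "AE w in lborel. f w = f' w"
        "{w. f' w \<noteq> 0} \<subseteq> ball 0 C \<times> square" "\<And>w. ennreal (norm (f' w)) \<le> m"
      using borel_version[OF f S supp bound] by blast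
    have f'm: "f' \<in> borel_measurable lebesgue" using f'(1) by (intro measurable_completion) simp
    have N: "?N f = ?N f'"
    proof (rule Lp_norm_cong_AE[OF assms(6)])
      show "AE z in lebesgue. ennreal (norm (f z)) = ennreal (norm (f' z))"
        unfolding AE_completion_iff using f'(2) by eventually_elim simp
      show "(\<lambda>z. ennreal (norm (f z))) \<in> borel_measurable lebesgue"
        "(\<lambda>z. ennreal (norm (f' z))) \<in> borel_measurable lebesgue"
        using f f'm by measurable
    qed
    have "mixed_norm q r (plane_transform Q1 Q2 f) = mixed_norm q r (signed_plane_integral f)"
      unfolding A(2) B(2) by (simp add: mixed_norm_def plane_transform_eq[OF sym] signed_plane_integral_def)
    also have "\<dots> = mixed_norm q r (signed_plane_integral f')"
      unfolding mixed_norm_def Lp_norm_signed_plane_integral_cong[OF f'(1,2) assms(8)] ..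
    also have "\<dots> \<le> ennreal K * ?N f'"
      by (rule K(2)[OF f'(1,3)]) (use f'(4) N in \<open>auto simp: m_def\<close>)
    also have "\<dots> \<le> ennreal (K + 1) * ?N f"
      unfolding N by (intro mult_right_mono ennreal_leI) auto
    finally show "mixed_norm q r (plane_transform Q1 Q2 f) \<le> ennreal (K + 1) * ?N f" .
  qed
qed

end
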